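(* Assume that $\mathbb{L}$ and $\mathbb{G}^\Omega$ satisfy (L1), (L2), (L3), (L4), (G1), (G2), (G3), and that $(q,\gamma)\in\mathbb{E}$. Let $u_*$ be the unique weak-dual solution of $$\mathbb{L}u=\frac{1}{u^q}\ \text{ in }\Omega,\qquad u>0\ \text{ in }\Omega,\qquad u=0\ \text{ on }\partial\Omega\text{ or in }\Omega^c\text{ if applicable}.$$ I. (Weakly singular nonlinearity) If $q\in(0,q^*_{s,\gamma})$, then $u_*\asymp\delta^\gamma$ in $\Omega$. II. (Critical singular nonlinearity) If $q=q^*_{s,\gamma}$, then - if $s\le\gamma$: $u_*\asymp\delta^\gamma\left(\ln\frac{d_\Omega}{\delta}\right)^{\frac{\gamma}{2s}}$ in $\Omega$; - if $s-\frac12<\gamma<s$: $\delta^\gamma\lesssim u_*\lesssim\delta^\gamma\ln\frac{d_\Omega}{\delta}$ in $\Omega$. III. (Strongly singular nonlinearity) If $q\in(q^*_{s,\gamma},q^{**}_{s,\gamma})$, then $u_*\asymp\delta^{\frac{2s}{q+1}}$ in $\Omega$.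
   Context: Setting. $N\ge 2$; $\Omega\subset\mathbb{R}^N$ is a $C^2$ bounded domain; $\delta(x)=\operatorname{dist}(x,\mathbb{R}^N\setminus\Omega)$; $d_\Omega=2\operatorname{diam}(\Omega)$; $s,\gamma\in(0,1]$ with $N>2s$. $f\lesssim g$ means $f\le Cg$ for some constant $C>0$; $f\asymp g$ means $f\lesssim g$ and $g\lesssim f$; $a\wedge b=\min\{a,b\}$. $L^1(\Omega,\delta^\gamma)$ is the space of Borel measurable $f:\Omega\to\mathbb{R}$ with $\int_\Omega|f|\delta^\gamma dx<\infty$; $L^1_0(\Omega,\delta^\gamma)$ consists of those $f\in L^1(\Omega,\delta^\gamma)$ set equal to $0$ on $\partial\Omega$ (or in $\Omega^c$ if applicable), i.e. functions on $\Omega$ regarded as extended by zero. $\delta^\gamma L^\infty(\Omega)=\{\delta^\gamma v: v\in L^\infty(\Omega)\}$. For $0<s<1$, $H^s_{00}(\Omega)=\{u\in H^s(\Omega):u/\delta^s\in L^2(\Omega)\}$, where $H^s(\Omega)$ is the usual fractional Sobolev space; for $s=1$ read $H^1_0(\Omega)$. Assumptions on the linear operator $\mathbb{L}$: (L1) $\mathbb{L}:C_c^\infty(\Omega)\subset L^2(\Omega)\to L^2(\Omega)$ is positive and symmetric. Its Friedrichs extension is still denoted $\mathbb{L}$; $\mathbb{H}(\Omega):=\operatorname{Dom}(\mathbb{L}^{1/2})$. (L2) There is $\Lambda_0>0$ with $\|u\|_{L^2(\Omega)}^2\le\Lambda_0\langle\mathbb{L}u,u\rangle_{L^2(\Omega)}$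 for all $u\in C_c^\infty(\Omega)$. Then $\mathbb{H}(\Omega)$ is a Hilbert space with inner product $\langle u,v\rangle_{\mathbb{H}(\Omega)}:=\langle\mathbb{L}^{1/2}u,\mathbb{L}^{1/2}v\rangle_{L^2(\Omega)}$. (L3) $\mathbb{H}(\Omega)=H^s_{00}(\Omega)$. (L4) For all $u,v\in\mathbb{H}(\Omega)\cap L^\infty(\Omega)$ with $v\ge0$ and every convex $p\in C^{1,1}(\mathbb{R})$ with $p(0)=p'(0)=0$: $\langle p(u),v\rangle_{\mathbb{H}(\Omega)}\le\langle u,p'(u)v\rangle_{\mathbb{H}(\Omega)}$. Assumptions on the inverse: (G1) There is an operator $\mathbb{G}^\Omega$ such that for every $f\in C_c^\infty(\Omega)$, $\mathbb{G}^\Omega[f]\in\operatorname{Dom}(\mathbb{L})\subset\mathbb{H}(\Omega)$ and $\mathbb{L}[\mathbb{G}^\Omega[f]]=f$ a.e. in $\Omega$. (G2) $\mathbb{G}^\Omega[f](x)=\int_\Omega G^\Omega(x,y)f(y)\,dy$, $x\in\Omega$, where $G^\Omega:\{(x,y)\in\Omega\times\Omega:x\ne y\}\to\mathbb{R}^+$ is Borel measurable, symmetric and $$G^\Omega(x,y)\asymp\frac{1}{|x-y|^{N-2s}}\Big(\frac{\delta(x)}{|x-y|}\wedge1\Big)^\gamma\Big(\frac{\delta(y)}{|x-y|}\wedge1\Big)^\gamma,\quad x\neq y.$$ (G3) If $x\in\Omega$, $(x_n)\subset\Omega$ and $x_n\to x$, then $G^\Omega(x_n,y)\to G^\Omega(x,y)$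 for a.e. $y\in\Omega$, $y\ne x$. Exponents. $q^*_{s,\gamma}:=\frac{2s}{\gamma}-1$; $q^{**}_{s,\gamma}:=+\infty$ if $\gamma\ge2s-1$ and $q^{**}_{s,\gamma}:=\frac{\gamma+1}{2s-\gamma-1}$ if $\gamma<2s-1$. $(q,\gamma)\in\mathbb{E}$ means: $q>0$, $0<\gamma<2s$, and either ($0<q<q^*_{s,\gamma}$ and $\gamma\ge s-\frac12$) or ($q\in[q^*_{s,\gamma},q^{**}_{s,\gamma})$ and $\gamma>s-\frac12$). Weak-dual solution of the problem: a positive function $u$ with $u\in L^1_0(\Omega,\delta^\gamma)$, $u^{-q}\in L^1(\Omega,\delta^\gamma)$ and $\int_\Omega u\,\xi\,dx=\int_\Omega u^{-q}\,\mathbb{G}^\Omega[\xi]\,dx$ for all $\xi\in\delta^\gamma L^\infty(\Omega)$. (Under the stated assumptions it exists and is unique.) *)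

theory Defs
  imports "HOL-Analysis.Analysis"
begin

text \<open>
  The ambient space is an arbitrary Euclidean space \<open>'a\<close> with \<open>N = DIM('a)\<close>. Functions on \<open>\<Omega>\<close> are
  total functions on \<open>'a\<close>; the values outside \<open>\<Omega>\<close> are irrelevant unless stated otherwise, since all
  norms, integrals and almost-everywhere statements refer to Lebesgue measure restricted to \<open>\<Omega>\<close>.
\<close>

abbreviation lborel_on :: "'a::euclidean_space set \<Rightarrow> 'a measure" where
  "lborel_on \<Omega> \<equiv> restrict_space lborel \<Omega>"

section \<open>Domains and smooth functions\<close>

primrec Ck :: "nat \<Rightarrow> ('a::euclidean_space \<Rightarrow> real) \<Rightarrow> bool" where
  "Ck 0 f \<longleftrightarrow> continuous_on UNIV f"
| "Ck (Suc k) f \<longleftrightarrow> (\<forall>x. f differentiable (at x)) \<and>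
                    (\<forall>v. Ck k (\<lambda>x. frechet_derivative f (at x) v))"

definition test_functions :: "'a::euclidean_space set \<Rightarrow> ('a \<Rightarrow> real) set" where
  "test_functions \<Omega> = {u. (\<forall>k. Ck k u) \<and> compact (closure {x. u x \<noteq> 0}) \<and> closure {x. u x \<noteq> 0} \<subseteq> \<Omega>}"

text \<open>Near each boundary point, \<open>\<Omega>\<close> lies on one side of the graph, in some unit direction \<open>e\<close>, of a
  \<open>C\<^sup>2\<close> function \<open>g\<close> of the coordinates orthogonal to \<open>e\<close>.\<close>
definition C2_bounded_domain :: "'a::euclidean_space set \<Rightarrow> bool" where
  "C2_bounded_domain \<Omega> \<longleftrightarrow> open \<Omega> \<and> connected \<Omega> \<and> \<Omega> \<noteq> {} \<and> bounded \<Omega> \<and>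
     (\<forall>x\<^sub>0\<in>frontier \<Omega>. \<exists>r>0. \<exists>e g. norm e = 1 \<and> Ck 2 g \<and>
        \<Omega> \<inter> ball x\<^sub>0 r = {x \<in> ball x\<^sub>0 r. g (x - (x \<bullet> e) *\<^sub>R e) < x \<bullet> e})"

definition bdist :: "'a::euclidean_space set \<Rightarrow> 'a \<Rightarrow> real" where
  "bdist \<Omega> x = infdist x (- \<Omega>)"

definition d_dom :: "'a::euclidean_space set \<Rightarrow> real" where
  "d_dom \<Omega> = 2 * diameter \<Omega>"

section \<open>Function spaces\<close>

definition L2 :: "'a::euclidean_space set \<Rightarrow> ('a \<Rightarrow> real) set" where
  "L2 \<Omega> = {u. u \<in> borel_measurable (lborel_on \<Omega>) \<and> integrable (lborel_on \<Omega>) (\<lambda>x. (u x)\<^sup>2)}"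

definition ip2 :: "'a::euclidean_space set \<Rightarrow> ('a \<Rightarrow> real) \<Rightarrow> ('a \<Rightarrow> real) \<Rightarrow> real" where
  "ip2 \<Omega> u v = (\<integral>x. u x * v x \<partial>lborel_on \<Omega>)"

definition norm2 :: "'a::euclidean_space set \<Rightarrow> ('a \<Rightarrow> real) \<Rightarrow> real" where
  "norm2 \<Omega> u = sqrt (ip2 \<Omega> u u)"

definition Linf :: "'a::euclidean_space set \<Rightarrow> ('a \<Rightarrow> real) set" where
  "Linf \<Omega> = {u. u \<in> borel_measurable (lborel_on \<Omega>) \<and> (\<exists>C. AE x in lborel_on \<Omega>. \<bar>u x\<bar> \<le> C)}"

definition L1w :: "'a::euclidean_space set \<Rightarrow> real \<Rightarrow> ('a \<Rightarrow> real) set" where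
  "L1w \<Omega> \<gamma> = {f. f \<in> borel_measurable (lborel_on \<Omega>) \<and>
                integrable (lborel_on \<Omega>) (\<lambda>x. \<bar>f x\<bar> * bdist \<Omega> x powr \<gamma>)}"

definition L1w0 :: "'a::euclidean_space set \<Rightarrow> real \<Rightarrow> ('a \<Rightarrow> real) set" where
  "L1w0 \<Omega> \<gamma> = {f \<in> L1w \<Omega> \<gamma>. \<forall>x. x \<notin> \<Omega> \<longrightarrow> f x = 0}"

definition weighted_Linf :: "'a::euclidean_space set \<Rightarrow> real \<Rightarrow> ('a \<Rightarrow> real) set" where
  "weighted_Linf \<Omega> \<gamma> = {\<lambda>x. bdist \<Omega> x powr \<gamma> * v x | v. v \<in> Linf \<Omega>}"

definition Hs :: "'a::euclidean_space set \<Rightarrow> real \<Rightarrow> ('a \<Rightarrow> real) set" where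
  "Hs \<Omega> s = {u \<in> L2 \<Omega>. integrable (lborel_on \<Omega> \<Otimes>\<^sub>M lborel_on \<Omega>)
      (\<lambda>(x, y). (u x - u y)\<^sup>2 / norm (x - y) powr (real DIM('a) + 2 * s))}"

definition weak_partial ::
  "'a::euclidean_space set \<Rightarrow> 'a \<Rightarrow> ('a \<Rightarrow> real) \<Rightarrow> ('a \<Rightarrow> real) \<Rightarrow> bool" where
  "weak_partial \<Omega> i u g \<longleftrightarrow>
     (\<forall>\<phi>\<in>test_functions \<Omega>. ip2 \<Omega> u (\<lambda>x. frechet_derivative \<phi> (at x) i) = - ip2 \<Omega> g \<phi>)"

text \<open>The closure of the test functions in the norm of \<open>H\<^sup>1(\<Omega>)\<close>; \<open>g i\<close> is the weak partial
  derivative of \<open>u\<close> in the coordinate direction \<open>i\<close>.\<close>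
definition H10 :: "'a::euclidean_space set \<Rightarrow> ('a \<Rightarrow> real) set" where
  "H10 \<Omega> = {u \<in> L2 \<Omega>. \<exists>g. (\<forall>i\<in>Basis. g i \<in> L2 \<Omega> \<and> weak_partial \<Omega> i u (g i)) \<and>
     (\<exists>\<phi>. (\<forall>n::nat. \<phi> n \<in> test_functions \<Omega>) \<and>
        (\<lambda>n. norm2 \<Omega> (\<lambda>x. \<phi> n x - u x)) \<longlonglongrightarrow> 0 \<and>
        (\<forall>i\<in>Basis. (\<lambda>n. norm2 \<Omega> (\<lambda>x. frechet_derivative (\<phi> n) (at x) i - g i x)) \<longlonglongrightarrow> 0))}"

definition Hs00 :: "'a::euclidean_space set \<Rightarrow> real \<Rightarrow> ('a \<Rightarrow> real) set" where
  "Hs00 \<Omega> s = (if s < 1 then {u \<in> Hs \<Omega> s. (\<lambda>x. u x / bdist \<Omega> x powr s) \<in> L2 \<Omega>} else H10 \<Omega>)"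

section \<open>Unbounded operators on \<open>L\<^sup>2(\<Omega>)\<close>\<close>

text \<open>
  An unbounded operator is given by its graph, a set of pairs of representatives. Adjoints, and hence
  self-adjoint operators and Friedrichs extensions, are closed under changing
  either component on a null set, so they are exactly the graphs in \<open>L\<^sup>2 \<times> L\<^sup>2\<close> modulo
  almost-everywhere equality.
\<close>

type_synonym 'a oper = "(('a \<Rightarrow> real) \<times> ('a \<Rightarrow> real)) set"

definition op_adjoint :: "'a::euclidean_space set \<Rightarrow> 'a oper \<Rightarrow> 'a oper" where
  "op_adjoint \<Omega> T = {(v, g). v \<in> L2 \<Omega> \<and> g \<in> L2 \<Omega> \<and> (\<forall>(u, f)\<in>T. ip2 \<Omega> f v = ip2 \<Omega> u g)}"

definition positive_selfadjoint :: "'a::euclidean_space set \<Rightarrow> 'a oper \<Rightarrow> bool" where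
  "positive_selfadjoint \<Omega> T \<longleftrightarrow>
     (\<forall>u\<in>L2 \<Omega>. \<forall>\<epsilon>>0. \<exists>v\<in>Domain T. norm2 \<Omega> (\<lambda>x. u x - v x) < \<epsilon>) \<and>
     op_adjoint \<Omega> T = T \<and>
     (\<forall>(u, f)\<in>T. 0 \<le> ip2 \<Omega> f u)"

definition op_root :: "'a::euclidean_space set \<Rightarrow> 'a oper \<Rightarrow> 'a oper \<Rightarrow> bool" where
  "op_root \<Omega> T S \<longleftrightarrow> positive_selfadjoint \<Omega> S \<and> S O S = T"

text \<open>For a positive self-adjoint \<open>T\<close> there is exactly one positive self-adjoint \<open>S\<close> with
  \<open>S\<^sup>2 = T\<close>; the empty relation is a dummy value for other \<open>T\<close>.\<close>
definition op_sqrt :: "'a::euclidean_space set \<Rightarrow> 'a oper \<Rightarrow> 'a oper" where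
  "op_sqrt \<Omega> T = (if \<exists>!S. op_root \<Omega> T S then THE S. op_root \<Omega> T S else {})"

text \<open>The value of an operator, as some representative of the almost-everywhere class.\<close>
definition op_app :: "'a oper \<Rightarrow> ('a \<Rightarrow> real) \<Rightarrow> 'a \<Rightarrow> real" where
  "op_app T u = (SOME f. (u, f) \<in> T)"

text \<open>The domain of the closure of the quadratic form \<open>\<phi> \<mapsto> \<langle>L \<phi>, \<phi>\<rangle>\<close> on test functions.\<close>
definition form_domain ::
  "'a::euclidean_space set \<Rightarrow> (('a \<Rightarrow> real) \<Rightarrow> 'a \<Rightarrow> real) \<Rightarrow> ('a \<Rightarrow> real) set" where
  "form_domain \<Omega> L = {u \<in> L2 \<Omega>. \<exists>\<phi>. (\<forall>n::nat. \<phi> n \<in> test_functions \<Omega>) \<and>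
     (\<lambda>n. norm2 \<Omega> (\<lambda>x. \<phi> n x - u x)) \<longlonglongrightarrow> 0 \<and>
     (\<forall>\<epsilon>>0. \<exists>M. \<forall>m\<ge>M. \<forall>n\<ge>M.
        ip2 \<Omega> (L (\<lambda>x. \<phi> m x - \<phi> n x)) (\<lambda>x. \<phi> m x - \<phi> n x) < \<epsilon>)}"

text \<open>The Friedrichs extension of \<open>L\<close> on test functions: the restriction of the adjoint to the form
  domain.\<close>
definition friedrichs ::
  "'a::euclidean_space set \<Rightarrow> (('a \<Rightarrow> real) \<Rightarrow> 'a \<Rightarrow> real) \<Rightarrow> 'a oper" where
  "friedrichs \<Omega> L =
     {(u, f) \<in> op_adjoint \<Omega> {(\<phi>, L \<phi>) | \<phi>. \<phi> \<in> test_functions \<Omega>}. u \<in> form_domain \<Omega> L}"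

definition HH :: "'a::euclidean_space set \<Rightarrow> (('a \<Rightarrow> real) \<Rightarrow> 'a \<Rightarrow> real) \<Rightarrow> ('a \<Rightarrow> real) set" where
  "HH \<Omega> L = Domain (op_sqrt \<Omega> (friedrichs \<Omega> L))"

definition HH_inner :: "'a::euclidean_space set \<Rightarrow> (('a \<Rightarrow> real) \<Rightarrow> 'a \<Rightarrow> real) \<Rightarrow>
    ('a \<Rightarrow> real) \<Rightarrow> ('a \<Rightarrow> real) \<Rightarrow> real" where
  "HH_inner \<Omega> L u v =
     ip2 \<Omega> (op_app (op_sqrt \<Omega> (friedrichs \<Omega> L)) u) (op_app (op_sqrt \<Omega> (friedrichs \<Omega> L)) v)"

section \<open>Assumptions on the operator\<close>

definition L1_assm :: "'a::euclidean_space set \<Rightarrow> (('a \<Rightarrow> real) \<Rightarrow> 'a \<Rightarrow> real) \<Rightarrow> bool" where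
  "L1_assm \<Omega> L \<longleftrightarrow>
     (\<forall>u\<in>test_functions \<Omega>. L u \<in> L2 \<Omega>) \<and>
     (\<forall>u\<in>test_functions \<Omega>. \<forall>v\<in>test_functions \<Omega>. \<forall>a b.
        AE x in lborel_on \<Omega>. L (\<lambda>z. a * u z + b * v z) x = a * L u x + b * L v x) \<and>
     (\<forall>u\<in>test_functions \<Omega>. \<forall>v\<in>test_functions \<Omega>. ip2 \<Omega> (L u) v = ip2 \<Omega> u (L v)) \<and>
     (\<forall>u\<in>test_functions \<Omega>. 0 \<le> ip2 \<Omega> (L u) u)"

definition L2_assm :: "'a::euclidean_space set \<Rightarrow> (('a \<Rightarrow> real) \<Rightarrow> 'a \<Rightarrow> real) \<Rightarrow> bool" where
  "L2_assm \<Omega> L \<longleftrightarrow>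
     (\<exists>\<Lambda>\<^sub>0>0. \<forall>u\<in>test_functions \<Omega>. (norm2 \<Omega> u)\<^sup>2 \<le> \<Lambda>\<^sub>0 * ip2 \<Omega> (L u) u)"

definition L3_assm ::
  "'a::euclidean_space set \<Rightarrow> real \<Rightarrow> (('a \<Rightarrow> real) \<Rightarrow> 'a \<Rightarrow> real) \<Rightarrow> bool" where
  "L3_assm \<Omega> s L \<longleftrightarrow> HH \<Omega> L = Hs00 \<Omega> s"

text \<open>\<open>p'\<close> is the derivative of \<open>p\<close>. The pairings are only meaningful for elements of
  \<open>HH \<Omega> L\<close>, which is made explicit.\<close>
definition L4_assm :: "'a::euclidean_space set \<Rightarrow> (('a \<Rightarrow> real) \<Rightarrow> 'a \<Rightarrow> real) \<Rightarrow> bool" where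
  "L4_assm \<Omega> L \<longleftrightarrow>
     (\<forall>u \<in> HH \<Omega> L \<inter> Linf \<Omega>. \<forall>v \<in> HH \<Omega> L \<inter> Linf \<Omega>. \<forall>p p' :: real \<Rightarrow> real.
        (AE x in lborel_on \<Omega>. 0 \<le> v x) \<longrightarrow>
        convex_on UNIV p \<longrightarrow> (\<forall>t. (p has_real_derivative p' t) (at t)) \<longrightarrow>
        (\<exists>K. K-lipschitz_on UNIV p') \<longrightarrow> p 0 = 0 \<longrightarrow> p' 0 = 0 \<longrightarrow>
        (\<lambda>x. p (u x)) \<in> HH \<Omega> L \<and> (\<lambda>x. p' (u x) * v x) \<in> HH \<Omega> L \<and>
        HH_inner \<Omega> L (\<lambda>x. p (u x)) v \<le> HH_inner \<Omega> L u (\<lambda>x. p' (u x) * v x))"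

section \<open>Assumptions on the Green function\<close>

definition green_op ::
  "'a::euclidean_space set \<Rightarrow> ('a \<Rightarrow> 'a \<Rightarrow> real) \<Rightarrow> ('a \<Rightarrow> real) \<Rightarrow> 'a \<Rightarrow> real" where
  "green_op \<Omega> G f x = (\<integral>y. G x y * f y \<partial>lborel_on \<Omega>)"

definition G1_assm :: "'a::euclidean_space set \<Rightarrow> (('a \<Rightarrow> real) \<Rightarrow> 'a \<Rightarrow> real) \<Rightarrow>
    ('a \<Rightarrow> 'a \<Rightarrow> real) \<Rightarrow> bool" where
  "G1_assm \<Omega> L G \<longleftrightarrow> (\<forall>f\<in>test_functions \<Omega>. (green_op \<Omega> G f, f) \<in> friedrichs \<Omega> L)"

definition green_bound ::
  "'a::euclidean_space set \<Rightarrow> real \<Rightarrow> real \<Rightarrow> 'a \<Rightarrow> 'a \<Rightarrow> real" where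
  "green_bound \<Omega> s \<gamma> x y =
     1 / norm (x - y) powr (real DIM('a) - 2 * s) *
     min (bdist \<Omega> x / norm (x - y)) 1 powr \<gamma> *
     min (bdist \<Omega> y / norm (x - y)) 1 powr \<gamma>"

definition G2_assm ::
  "'a::euclidean_space set \<Rightarrow> real \<Rightarrow> real \<Rightarrow> ('a \<Rightarrow> 'a \<Rightarrow> real) \<Rightarrow> bool" where
  "G2_assm \<Omega> s \<gamma> G \<longleftrightarrow>
     (\<lambda>(x, y). G x y) \<in> borel_measurable (restrict_space borel {(x, y). x \<in> \<Omega> \<and> y \<in> \<Omega> \<and> x \<noteq> y}) \<and>
     (\<forall>x\<in>\<Omega>. \<forall>y\<in>\<Omega>. x \<noteq> y \<longrightarrow> 0 < G x y \<and> G x y = G y x) \<and>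
     (\<exists>C>0. \<forall>x\<in>\<Omega>. \<forall>y\<in>\<Omega>. x \<noteq> y \<longrightarrow>
        G x y \<le> C * green_bound \<Omega> s \<gamma> x y \<and> green_bound \<Omega> s \<gamma> x y \<le> C * G x y)"

definition G3_assm :: "'a::euclidean_space set \<Rightarrow> ('a \<Rightarrow> 'a \<Rightarrow> real) \<Rightarrow> bool" where
  "G3_assm \<Omega> G \<longleftrightarrow>
     (\<forall>x\<in>\<Omega>. \<forall>X. (\<forall>n. X n \<in> \<Omega>) \<longrightarrow> X \<longlonglongrightarrow> x \<longrightarrow>
        (AE y in lborel_on \<Omega>. y \<noteq> x \<longrightarrow> (\<lambda>n. G (X n) y) \<longlonglongrightarrow> G x y))"

section \<open>Exponents\<close>

definition q_crit :: "real \<Rightarrow> real \<Rightarrow> real" where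
  "q_crit s \<gamma> = 2 * s / \<gamma> - 1"

definition q_crit2 :: "real \<Rightarrow> real \<Rightarrow> ereal" where
  "q_crit2 s \<gamma> = (if \<gamma> \<ge> 2 * s - 1 then \<infinity> else ereal ((\<gamma> + 1) / (2 * s - \<gamma> - 1)))"

definition admissible :: "real \<Rightarrow> (real \<times> real) set" where
  "admissible s = {(q, \<gamma>). q > 0 \<and> 0 < \<gamma> \<and> \<gamma> < 2 * s \<and>
     ((0 < q \<and> q < q_crit s \<gamma> \<and> \<gamma> \<ge> s - 1 / 2) \<or>
      (q_crit s \<gamma> \<le> q \<and> ereal q < q_crit2 s \<gamma> \<and> \<gamma> > s - 1 / 2))}"

section \<open>Solutions and comparison up to constants\<close>

definition weak_dual_solution :: "'a::euclidean_space set \<Rightarrow> real \<Rightarrow> real \<Rightarrow>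
    ('a \<Rightarrow> 'a \<Rightarrow> real) \<Rightarrow> ('a \<Rightarrow> real) \<Rightarrow> bool" where
  "weak_dual_solution \<Omega> \<gamma> q G u \<longleftrightarrow>
     u \<in> L1w0 \<Omega> \<gamma> \<and> (AE x in lborel_on \<Omega>. 0 < u x) \<and>
     (\<lambda>x. u x powr (- q)) \<in> L1w \<Omega> \<gamma> \<and>
     (\<forall>\<xi>\<in>weighted_Linf \<Omega> \<gamma>.
        (\<integral>x. u x * \<xi> x \<partial>lborel_on \<Omega>) = (\<integral>x. u x powr (- q) * green_op \<Omega> G \<xi> x \<partial>lborel_on \<Omega>))"

text \<open>Solutions are determined only up to null sets, so the comparisons hold almost everywhere.\<close>
definition lesssim_on ::
  "'a::euclidean_space set \<Rightarrow> ('a \<Rightarrow> real) \<Rightarrow> ('a \<Rightarrow> real) \<Rightarrow> bool" where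
  "lesssim_on \<Omega> f g \<longleftrightarrow> (\<exists>C>0. AE x in lborel_on \<Omega>. f x \<le> C * g x)"

definition comparable_on ::
  "'a::euclidean_space set \<Rightarrow> ('a \<Rightarrow> real) \<Rightarrow> ('a \<Rightarrow> real) \<Rightarrow> bool" where
  "comparable_on \<Omega> f g \<longleftrightarrow> lesssim_on \<Omega> f g \<and> lesssim_on \<Omega> g f"

end

theory Submission
  imports Defs
begin

text \<open>
  Testing with \<open>\<xi> = \<delta>\<^sup>\<gamma> 1\<^sub>S\<close> for all Borel sets \<open>S\<close> turns a weak-dual solution into an almost everywhere solution of
  \<open>u = \<integral> G(\<cdot>, y) u(y)\<^sup>-\<^sup>q dy\<close>, and only the explicit two-sided bound \<open>k\<close> for \<open>G\<close> matters from there on.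

  The bound \<open>k(x, y) \<ge> c \<delta>(x)\<^sup>\<gamma> \<delta>(y)\<^sup>\<gamma>\<close> gives \<open>u \<ge> c \<delta>\<^sup>\<gamma>\<close>. The potential of \<open>\<delta>\<^sup>-\<^sup>b\<close>, \<open>b < 1 + \<gamma>\<close>, is at most
  a multiple of \<open>\<delta>\<^sup>\<gamma>\<close>, \<open>\<delta>\<^sup>\<gamma> ln(D/\<delta>)\<close> or \<open>\<delta>\<^sup>2\<^sup>s\<^sup>-\<^sup>b\<close> according as \<open>b\<close> is less than, equal to or greater than
  \<open>2s - \<gamma>\<close>; with \<open>b = q\<gamma>\<close> this settles the weakly singular case and the upper bound with a full logarithm.

  In the strongly singular case, \<open>k(\<cdot>, y)\<close> satisfies a mean value inequality on balls of radius comparable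
  to \<open>\<delta>\<close>, so \<open>u\<close> is at most a multiple of \<open>u(x)\<close> on half of such a ball around \<open>x\<close>; hence
  \<open>u(x) \<ge> c \<delta>(x)\<^sup>2\<^sup>s u(x)\<^sup>-\<^sup>q\<close>, the sharp lower bound, and the potential estimate gives the upper one.

  In the critical case, let \<open>E = {u \<le> t \<delta>\<^sup>\<gamma>}\<close>. As \<open>k\<close> divided by \<open>\<delta>(x)\<^sup>\<gamma> \<delta>(y)\<^sup>\<gamma>\<close> is a quasi-metric kernel, the potential of
  \<open>u\<^sup>-\<^sup>q 1\<^sub>E\<close> is at most a multiple of \<open>t \<delta>\<^sup>\<gamma>\<close> everywhere. If \<open>t\<close> is a small multiple of \<open>u(x) / \<delta>(x)\<^sup>\<gamma>\<close>, at least
  half of \<open>u(x)\<close> thus comes from the set where \<open>u\<^sup>-\<^sup>q < (t \<delta>\<^sup>\<gamma>)\<^sup>-\<^sup>q\<close>, so \<open>u\<^sup>q\<^sup>+\<^sup>1\<close> is at most a multiple of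
  \<open>\<delta>\<^sup>\<gamma>\<^sup>(\<^sup>q\<^sup>+\<^sup>1\<^sup>) ln(D/\<delta>)\<close>. Inserting this bound into the integral equation gives the matching lower bound.
\<close>

section \<open>Boundary charts\<close>

lemma Ck2_continuous: "Ck 2 g \<Longrightarrow> continuous_on UNIV g"
  by (simp add: numeral_2_eq_2 continuous_on_eq_continuous_within differentiable_imp_continuous_within)

text \<open>The partial derivatives are continuous, hence bounded on the compact ball, and their
  bounds add up to a bound for the operator norm of the derivative. The ball is convex, so the mean
  value inequality applies.\<close>

lemma Ck2_lipschitz_cball:
  fixes g :: "'a::euclidean_space \<Rightarrow> real"
  assumes "Ck 2 g"
  obtains M where "M > 0" "\<And>x y. x \<in> cball a r \<Longrightarrow> y \<in> cball a r \<Longrightarrow> \<bar>g x - g y\<bar> \<le> M * norm (x - y)"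
proof -
  have d: "(g has_derivative frechet_derivative g (at x)) (at x)" for x
    using assms by (simp add: numeral_2_eq_2 frechet_derivative_works)
  have c: "continuous_on UNIV (\<lambda>x. frechet_derivative g (at x) v)" for v
    using assms by (simp add: numeral_2_eq_2 continuous_on_eq_continuous_within
        differentiable_imp_continuous_within)
  have "\<exists>B. \<forall>x\<in>cball a r. norm (frechet_derivative g (at x) v) \<le> B" for v
  proof -
    have "compact ((\<lambda>x. frechet_derivative g (at x) v) ` cball a r)"
      by (intro compact_continuous_image continuous_on_subset[OF c]) auto
    then show ?thesis
      by (auto dest!: compact_imp_bounded simp: bounded_iff)
  qed
  then obtain B where B: "\<And>v x. x \<in> cball a r \<Longrightarrow> norm (frechet_derivative g (at x) v) \<le> B v"
    by metis
  \<comment> \<open>The maximum with 1 keeps the constant positive even if the derivative vanishes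
    or the ball is empty.\<close>
  let ?M = "max 1 (\<Sum>i\<in>Basis. B i)"
  have "onorm (frechet_derivative g (at x)) \<le> ?M" if "x \<in> cball a r" for x
  proof -
    have "onorm (frechet_derivative g (at x)) \<le> (\<Sum>i\<in>Basis. norm (frechet_derivative g (at x) i))"
      by (rule onorm_componentwise) (use d has_derivative_bounded_linear in blast)
    also have "\<dots> \<le> (\<Sum>i\<in>Basis. B i)"
      using B[OF that] by (rule sum_mono)
    finally show ?thesis by simp
  qed
  then have "norm (g x - g y) \<le> ?M * norm (x - y)" if "x \<in> cball a r" "y \<in> cball a r" for x y
    using d that by (intro differentiable_bound[of "cball a r"]) (auto intro: has_derivative_at_withinI)
  then show thesis
    by (intro that[of ?M]) auto
qed

locale C2_domain =
  fixes \<Omega> :: "'a::euclidean_space set"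
  assumes C2: "C2_bounded_domain \<Omega>"
begin

abbreviation \<delta> :: "'a \<Rightarrow> real" where "\<delta> \<equiv> bdist \<Omega>"
abbreviation D :: real where "D \<equiv> d_dom \<Omega>"

section \<open>Elementary properties of the boundary distance\<close>

lemma open_dom: "open \<Omega>" and bounded_dom: "bounded \<Omega>" and dom_nonempty: "\<Omega> \<noteq> {}"
  using C2 by (auto simp: C2_bounded_domain_def)

lemma dom_measurable [measurable]: "\<Omega> \<in> sets borel"
  using open_dom by simp

text \<open>Since \<open>infdist\<close> to the empty set is 0 by convention, this is what makes the
  distance to the complement meaningful.\<close>

lemma compl_nonempty: "- \<Omega> \<noteq> {}"
  using bounded_dom not_bounded_UNIV by (metis Compl_empty_eq double_compl)

lemma closed_compl: "closed (- \<Omega>)"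
  using open_dom by (simp add: closed_Compl)

lemma bdist_pos: "x \<in> \<Omega> \<Longrightarrow> 0 < \<delta> x"
  unfolding bdist_def using closed_compl compl_nonempty infdist_pos_not_in_closed by fastforce

lemma bdist_nonneg [simp]: "0 \<le> \<delta> x"
  by (simp add: bdist_def infdist_nonneg)

lemma bdist_notin: "x \<notin> \<Omega> \<Longrightarrow> \<delta> x = 0"
  by (simp add: bdist_def)

lemma bdist_le_add_dist: "\<delta> x \<le> \<delta> y + norm (x - y)"
  unfolding bdist_def using infdist_triangle[of x "- \<Omega>" y] by (simp add: dist_norm)

lemma bdist_le_dist: "y \<notin> \<Omega> \<Longrightarrow> \<delta> x \<le> norm (x - y)"
  using bdist_le_add_dist[of x y] by (simp add: bdist_notin)

lemma ball_bdist_subset: "norm (x - y) < \<delta> x \<Longrightarrow> y \<in> \<Omega>"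
  using bdist_le_dist[of y x] by linarith

lemma continuous_bdist: "continuous_on S \<delta>"
  unfolding bdist_def by (intro continuous_intros)

lemma bdist_measurable [measurable]: "\<delta> \<in> borel_measurable borel"
  by (rule borel_measurable_continuous_onI[OF continuous_bdist])

text \<open>A nearest point of the closed complement is also a limit of points of the open ball of
  radius \<open>\<delta> x\<close>, which lies in \<Omega>; hence it is on the frontier.\<close>

lemma bdist_attained:
  assumes "x \<in> \<Omega>"
  obtains z where "z \<in> frontier \<Omega>" "norm (x - z) = \<delta> x"
proof -
  obtain z where z: "z \<in> - \<Omega>" "\<delta> x = dist x z"
    using infdist_attains_inf[OF closed_compl compl_nonempty] unfolding bdist_def by metis
  have "ball x (\<delta> x) \<subseteq> \<Omega>"
    by (auto simp: dist_norm intro: ball_bdist_subset)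
  moreover have "z \<in> closure (ball x (\<delta> x))"
    using z bdist_pos[OF assms] by simp
  ultimately have "z \<in> closure \<Omega>"
    using closure_mono by blast
  then show thesis
    using z open_dom by (intro that[of z]) (auto simp: frontier_def interior_open dist_norm)
qed

text \<open>The ball of radius \<open>\<delta> x\<close> around \<open>x\<close> lies in \<Omega>,
  so its diameter \<open>2 * \<delta> x\<close> is at most that of \<Omega>, and \<open>D\<close> is
  twice the latter.\<close>

lemma bdist_le_D: "x \<in> \<Omega> \<Longrightarrow> 4 * \<delta> x \<le> D"
  using diameter_subset[of "ball x (\<delta> x)" \<Omega>] bounded_dom ball_bdist_subset
  by (auto simp: d_dom_def diameter_ball dist_norm subset_eq split: if_splits)

lemma D_pos: "0 < D"
  using dom_nonempty bdist_le_D bdist_pos by fastforce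

lemma norm_diff_lt_D: "x \<in> \<Omega> \<Longrightarrow> y \<in> \<Omega> \<Longrightarrow> norm (x - y) < D"
  using diameter_bounded_bound[OF bounded_dom, of x y] D_pos by (simp add: d_dom_def dist_norm)

section \<open>The frontier and its charts\<close>

lemma compact_frontier_dom: "compact (frontier \<Omega>)"
  by (simp add: bounded_dom compact_frontier_bounded)

lemma frontier_notin: "z \<in> frontier \<Omega> \<Longrightarrow> z \<notin> \<Omega>"
  using open_dom by (simp add: frontier_def interior_open)

text \<open>Here \<open>h\<close> stands for the height above the graph that bounds \<Omega> near
  \<open>z\<close>. Its lower bound for \<open>\<delta>\<close> serves to estimate negative powers
  of \<open>\<delta>\<close> near the frontier and to find points far from it.\<close>

definition chart :: "real \<Rightarrow> real \<Rightarrow> 'a \<Rightarrow> 'a \<Rightarrow> ('a \<Rightarrow> real) \<Rightarrow> bool" where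
  "chart \<rho> c z e h \<longleftrightarrow> norm e = 1 \<and> continuous_on UNIV h \<and> (\<forall>y t. h (y + t *\<^sub>R e) = h y + t) \<and>
     (\<forall>y\<in>ball z \<rho>. (y \<in> \<Omega> \<longleftrightarrow> 0 < h y) \<and> c * h y \<le> \<delta> y)"

lemma chart_mono: "chart \<rho> c z e h \<Longrightarrow> \<rho>' \<le> \<rho> \<Longrightarrow> 0 \<le> c' \<Longrightarrow> c' \<le> c \<Longrightarrow> chart \<rho>' c' z e h"
proof -
  assume a: "chart \<rho> c z e h" "\<rho>' \<le> \<rho>" "0 \<le> c'" "c' \<le> c"
  have "c' * h y \<le> \<delta> y" if "y \<in> ball z \<rho>'" for y
  proof (cases "0 < h y")
    case True
    then have "c' * h y \<le> c * h y" using a by simp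
    also have "\<dots> \<le> \<delta> y" using a that by (auto simp: chart_def)
    finally show ?thesis .
  next
    case False
    then have "c' * h y \<le> 0" using a by (simp add: mult_nonneg_nonpos)
    then show ?thesis using bdist_nonneg order_trans by blast
  qed
  then show "chart \<rho>' c' z e h"
    using a by (auto simp: chart_def)
qed

text \<open>With \<open>P\<close> the projection along \<open>e\<close>, the height
  \<open>h y = y \<bullet> e - g (P y)\<close> has Lipschitz constant \<open>1 + M\<close> near
  \<open>x\<^sub>0\<close> and is nonpositive at the boundary point nearest to \<open>y\<close>, so
  \<open>h y \<le> (1 + M) * \<delta> y\<close>. The same \<open>e\<close> and \<open>h\<close>
  serve all frontier points near \<open>x\<^sub>0\<close>, which is the form that compactness
  needs.\<close>

lemma local_chart:
  assumes x0: "x\<^sub>0 \<in> frontier \<Omega>"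
  obtains \<rho> c where "\<rho> > 0" "c > 0" "\<And>z. z \<in> ball x\<^sub>0 \<rho> \<Longrightarrow> z \<in> frontier \<Omega> \<Longrightarrow> \<exists>e h. chart \<rho> c z e h"
proof -
  obtain r e g where r: "r > 0" and e: "norm e = 1" and g: "Ck 2 g"
    and gr: "\<Omega> \<inter> ball x\<^sub>0 r = {x \<in> ball x\<^sub>0 r. g (x - (x \<bullet> e) *\<^sub>R e) < x \<bullet> e}"
    using C2 x0 unfolding C2_bounded_domain_def by blast
  define P where "P = (\<lambda>y. y - (y \<bullet> e) *\<^sub>R e)"
  define h where "h = (\<lambda>y. y \<bullet> e - g (P y))"
  have P_diff: "norm (P y - P z) \<le> norm (y - z)" for y z
  proof -
    have "(norm (P (y - z)))\<^sup>2 = (norm (y - z))\<^sup>2 - ((y - z) \<bullet> e)\<^sup>2"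
      using e unfolding P_def power2_norm_eq_inner
      by (simp add: algebra_simps power2_eq_square norm_eq_1 inner_commute)
    then have "(norm (P (y - z)))\<^sup>2 \<le> (norm (y - z))\<^sup>2"
      by simp
    moreover have "P (y - z) = P y - P z"
      by (simp add: P_def algebra_simps)
    ultimately show ?thesis
      by (simp add: power2_le_iff_abs_le)
  qed
  have Pe: "P (y + t *\<^sub>R e) = P y" for y t
    using e by (simp add: P_def algebra_simps norm_eq_1)
  obtain M where M: "M > 0" "\<And>x y. x \<in> cball (P x\<^sub>0) r \<Longrightarrow> y \<in> cball (P x\<^sub>0) r \<Longrightarrow> \<bar>g x - g y\<bar> \<le> M * norm (x - y)"
    using Ck2_lipschitz_cball[OF g] by blast
  have hlip: "h y - h z \<le> (1 + M) * norm (y - z)" if "y \<in> ball x\<^sub>0 r" "z \<in> ball x\<^sub>0 r" for y z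
  proof -
    have "y \<bullet> e - z \<bullet> e \<le> norm (y - z)"
      using norm_cauchy_schwarz[of "y - z" e] e by (simp add: inner_diff_left)
    moreover have "P w \<in> cball (P x\<^sub>0) r" if "w \<in> ball x\<^sub>0 r" for w
      using that P_diff[of x\<^sub>0 w] by (simp add: dist_norm)
    then have "\<bar>g (P y) - g (P z)\<bar> \<le> M * norm (P y - P z)"
      using that by (intro M(2)) auto
    then have "\<bar>g (P y) - g (P z)\<bar> \<le> M * norm (y - z)"
      using P_diff[of y z] \<open>M > 0\<close> by (meson mult_left_mono less_imp_le order_trans)
    ultimately show ?thesis
      by (simp add: h_def algebra_simps)
  qed
  have hdom: "y \<in> \<Omega> \<longleftrightarrow> 0 < h y" if "y \<in> ball x\<^sub>0 r" for y
  proof -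
    have "y \<in> \<Omega> \<inter> ball x\<^sub>0 r \<longleftrightarrow> y \<in> {x \<in> ball x\<^sub>0 r. g (x - (x \<bullet> e) *\<^sub>R e) < x \<bullet> e}"
      by (simp only: gr)
    then show ?thesis
      using that unfolding h_def P_def by auto
  qed
  have cont: "continuous_on UNIV h"
    unfolding h_def P_def
    by (intro continuous_intros continuous_on_compose2[OF Ck2_continuous[OF g]]) auto
  have shift: "h (y + t *\<^sub>R e) = h y + t" for y t
    using e Pe by (simp add: h_def inner_add_left norm_eq_1)
  \<comment> \<open>For \<open>z\<close> within \<open>\<rho>\<close> of \<open>x\<^sub>0\<close>
    and \<open>y\<close> within \<open>\<rho>\<close> of \<open>z\<close>, the boundary point
    nearest to \<open>y\<close> has distance less than \<open>3 * \<rho>\<close> from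
    \<open>x\<^sub>0\<close>, so the Lipschitz bound covers both points.\<close>
  define \<rho> where "\<rho> = r / 4"
  define c where "c = 1 / (1 + M)"
  have "chart \<rho> c z e h" if z: "z \<in> ball x\<^sub>0 \<rho>" "z \<in> frontier \<Omega>" for z
    unfolding chart_def
  proof (intro conjI allI ballI e cont shift)
    fix y assume y: "y \<in> ball z \<rho>"
    have yx: "dist x\<^sub>0 y < r / 2"
      using y z dist_triangle[of x\<^sub>0 y z] by (simp add: \<rho>_def)
    then show yd: "y \<in> \<Omega> \<longleftrightarrow> 0 < h y" by (intro hdom) (use r in auto)
    show "c * h y \<le> \<delta> y"
    proof (cases "y \<in> \<Omega>")
      case False
      then have "c * h y \<le> 0" using yd M by (simp add: c_def divide_nonpos_pos)
      then show ?thesis using bdist_nonneg order_trans by blast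
    next
      case True
      then obtain p where p: "p \<in> frontier \<Omega>" "norm (y - p) = \<delta> y"
        using bdist_attained by blast
      have "\<delta> y \<le> norm (y - z)"
        using frontier_notin[OF z(2)] by (rule bdist_le_dist)
      then have "dist x\<^sub>0 p < r"
        using p yx y dist_triangle[of x\<^sub>0 p y] r by (simp add: \<rho>_def dist_norm norm_minus_commute)
      then have "h y - h p \<le> (1 + M) * \<delta> y" "h p \<le> 0"
        using hlip[of y p] hdom[of p] frontier_notin[OF p(1)] p yx r by auto
      then have "h y \<le> (1 + M) * \<delta> y" by linarith
      then show ?thesis using M by (simp add: c_def divide_simps mult.commute)
    qed
  qed
  then show thesis
    using r M by (intro that[of \<rho> c]) (auto simp: \<rho>_def c_def)
qed

text \<open>Finitely many of the local neighbourhoods cover the compact frontier, and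
  \<open>chart\<close> is inherited by smaller radii and constants.\<close>

lemma uniform_chart:
  obtains \<rho> c where "\<rho> > 0" "c > 0" "c \<le> 1" "\<And>z. z \<in> frontier \<Omega> \<Longrightarrow> \<exists>e h. chart \<rho> c z e h"
proof -
  have "\<forall>x\<in>frontier \<Omega>. \<exists>\<rho> c. \<rho> > 0 \<and> c > 0 \<and> (\<forall>z \<in> ball x \<rho> \<inter> frontier \<Omega>. \<exists>e h. chart \<rho> c z e h)"
    using local_chart by (metis IntD1 IntD2)
  then obtain \<rho> c where rc: "\<And>x. x \<in> frontier \<Omega> \<Longrightarrow> \<rho> x > 0 \<and> c x > 0 \<and>
      (\<forall>z \<in> ball x (\<rho> x) \<inter> frontier \<Omega>. \<exists>e h. chart (\<rho> x) (c x) z e h)"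
    by metis
  obtain F where F: "F \<subseteq> frontier \<Omega>" "finite F" "frontier \<Omega> \<subseteq> (\<Union>x\<in>F. ball x (\<rho> x))"
  proof (rule compactE_image[OF compact_frontier_dom])
    show "frontier \<Omega> \<subseteq> (\<Union>x\<in>frontier \<Omega>. ball x (\<rho> x))"
      using rc by fastforce
  qed auto
  \<comment> \<open>The inserted 1 gives a value when \<open>F\<close> is empty and, in the next
    definition, also ensures \<open>K \<le> 1\<close>.\<close>
  define R where "R = Min (insert 1 (\<rho> ` F))"
  define K where "K = Min (insert 1 (c ` F))"
  have pos: "R > 0" "K > 0" "K \<le> 1"
    using F rc by (auto simp: R_def K_def Min_gr_iff)
  have "\<exists>e h. chart R K z e h" if z: "z \<in> frontier \<Omega>" for z
  proof -
    obtain x where x: "x \<in> F" "z \<in> ball x (\<rho> x)" using F z by blast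
    then obtain e h where "chart (\<rho> x) (c x) z e h" using rc F z by blast
    moreover have "R \<le> \<rho> x" "K \<le> c x" using x F by (auto simp: R_def K_def)
    ultimately show ?thesis using chart_mono pos by (metis less_imp_le)
  qed
  then show thesis using pos that by blast
qed

end

section \<open>Power integrals\<close>

lemma cball_measurable [measurable]: "cball (x::'a::metric_space) r \<in> sets borel"
  by (simp add: borel_closed)

lemma nn_integral_powr_0:
  assumes "0 < \<eta>" "0 \<le> R"
  shows "(\<integral>\<^sup>+r. ennreal (r powr (\<eta> - 1)) * indicator {0..R} r \<partial>lborel) = ennreal (R powr \<eta> / \<eta>)"
proof -
  have "((\<lambda>r. if r \<in> {0..R} then r powr (\<eta> - 1) else 0) has_integral (R powr \<eta> / \<eta>)) UNIV"
    using has_integral_powr_from_0[of "\<eta> - 1" R] assms by (subst has_integral_restrict_UNIV) auto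
  then have "(\<integral>\<^sup>+r. ennreal (if r \<in> {0..R} then r powr (\<eta> - 1) else 0) \<partial>lborel) = ennreal (R powr \<eta> / \<eta>)"
    by (intro nn_integral_has_integral_lborel) auto
  moreover have "ennreal (r powr (\<eta> - 1)) * indicator {0..R} r = ennreal (if r \<in> {0..R} then r powr (\<eta> - 1) else 0)" for r
    by (auto simp: indicator_def)
  ultimately show ?thesis by simp
qed

lemma nn_integral_powr_Icc:
  assumes "\<eta> \<noteq> 0" "0 < a" "a \<le> b"
  shows "(\<integral>\<^sup>+r. ennreal (r powr (\<eta> - 1)) * indicator {a..b} r \<partial>lborel) = ennreal ((b powr \<eta> - a powr \<eta>) / \<eta>)"
proof -
  have "((\<lambda>r. r powr \<eta> / \<eta>) has_real_derivative x powr (\<eta> - 1)) (at x)" if "a \<le> x" for x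
    using assms that by (auto intro!: derivative_eq_intros)
  then show ?thesis
    using assms by (subst nn_integral_FTC_Icc[where F = "\<lambda>r. r powr \<eta> / \<eta>"]) (auto simp: diff_divide_distrib)
qed

lemma nn_integral_inverse_Icc:
  assumes "0 < a" "a \<le> b"
  shows "(\<integral>\<^sup>+r. ennreal (r powr (-1)) * indicator {a..b} r \<partial>lborel) = ennreal (ln (b / a))"
proof -
  have "(ln has_real_derivative x powr (-1)) (at x)" if "a \<le> x" for x
    using assms that by (auto intro!: derivative_eq_intros simp: powr_minus divide_simps)
  then show ?thesis
    using assms by (subst nn_integral_FTC_Icc[where F = ln]) (auto simp: ln_div)
qed

text \<open>Writing |x - y|^(-p) as R^(-p) plus the integral of p r^(-p-1) over r from |x - y| to R
  and exchanging the integrals leaves only the mass of \<open>\<phi>\<close> on balls around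
  \<open>x\<close>. The inner radius admits mass bounds that are known only for balls that are not
  too small.\<close>

lemma layer_cake:
  fixes \<phi> :: "'a::euclidean_space \<Rightarrow> ennreal"
  assumes [measurable]: "\<phi> \<in> borel_measurable borel" and p: "0 < p" and r0: "0 \<le> r\<^sub>0" and C: "0 \<le> C"
    and R: "0 < R" "r\<^sub>0 \<le> R"
    and mass: "\<And>r. r\<^sub>0 \<le> r \<Longrightarrow> 0 < r \<Longrightarrow> r \<le> R \<Longrightarrow>
      (\<integral>\<^sup>+y. \<phi> y * indicator (cball x r) y \<partial>lborel) \<le> ennreal (C * r powr \<kappa>)"
  shows "(\<integral>\<^sup>+y. ennreal (norm (x - y) powr - p) * \<phi> y * indicator {y. r\<^sub>0 \<le> norm (x - y) \<and> norm (x - y) \<le> R} y \<partial>lborel)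
    \<le> ennreal (C * R powr (\<kappa> - p)) +
       ennreal (C * p) * (\<integral>\<^sup>+r. ennreal (r powr (\<kappa> - p - 1)) * indicator {r\<^sub>0..R} r \<partial>lborel)"
proof -
  \<comment> \<open>For |x - y| between the inner radius and \<open>R\<close>, the radii that count
    in \<open>J y\<close> are those from |x - y| to \<open>R\<close>.\<close>
  define J where "J = (\<lambda>y. \<integral>\<^sup>+r. ennreal (p * r powr (- p - 1)) * indicator {r\<^sub>0..R} r * (\<phi> y * indicator (cball x r) y) \<partial>lborel)"
  have ind: "indicator (cball x r) y = indicator {y. norm (x - y) \<le> r} y" for r and y :: 'a
    by (simp add: indicator_def dist_norm)
  have le: "ennreal (norm (x - y) powr - p) * \<phi> y * indicator {y. r\<^sub>0 \<le> norm (x - y) \<and> norm (x - y) \<le> R} y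
      \<le> ennreal (R powr - p) * (\<phi> y * indicator (cball x R) y) + J y" for y
  proof (cases "0 < norm (x - y) \<and> r\<^sub>0 \<le> norm (x - y) \<and> norm (x - y) \<le> R")
    case False
    then show ?thesis by (auto simp: indicator_def)
  next
    case True
    let ?\<rho> = "norm (x - y)"
    have "(\<integral>\<^sup>+r. ennreal (p * r powr (- p - 1)) * indicator {?\<rho>..R} r \<partial>lborel) = ennreal (- (R powr - p) - - (?\<rho> powr - p))"
    proof (rule nn_integral_FTC_Icc[where F = "\<lambda>r. - (r powr - p)"])
      fix r assume "r \<in> {?\<rho>..R}"
      then have "?\<rho> \<le> r" by simp
      then have "0 < r" using True by linarith
      then show "((\<lambda>r. - (r powr - p)) has_real_derivative p * r powr (- p - 1)) (at r)" "0 \<le> p * r powr (- p - 1)"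
        using p by (auto intro!: derivative_eq_intros)
    qed (use True in auto)
    moreover have "R powr - p \<le> ?\<rho> powr - p"
      using True p by (intro powr_mono2') auto
    ultimately have "ennreal (?\<rho> powr - p) = ennreal (R powr - p) + (\<integral>\<^sup>+r. ennreal (p * r powr (- p - 1)) * indicator {?\<rho>..R} r \<partial>lborel)"
      by (simp add: ennreal_plus[symmetric])
    then have "ennreal (?\<rho> powr - p) * \<phi> y = ennreal (R powr - p) * \<phi> y
        + (\<integral>\<^sup>+r. ennreal (p * r powr (- p - 1)) * indicator {?\<rho>..R} r * \<phi> y \<partial>lborel)"
      by (simp add: distrib_right nn_integral_multc)
    also have "(\<integral>\<^sup>+r. ennreal (p * r powr (- p - 1)) * indicator {?\<rho>..R} r * \<phi> y \<partial>lborel) \<le> J y"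
      unfolding J_def using True
      by (intro nn_integral_mono) (auto simp: indicator_def dist_norm)
    finally show ?thesis
      using True by (simp add: indicator_def dist_norm)
  qed
  have "(\<integral>\<^sup>+y. ennreal (norm (x - y) powr - p) * \<phi> y * indicator {y. r\<^sub>0 \<le> norm (x - y) \<and> norm (x - y) \<le> R} y \<partial>lborel)
      \<le> (\<integral>\<^sup>+y. ennreal (R powr - p) * (\<phi> y * indicator (cball x R) y) + J y \<partial>lborel)"
    by (intro nn_integral_mono le)
  also have "\<dots> = ennreal (R powr - p) * (\<integral>\<^sup>+y. \<phi> y * indicator (cball x R) y \<partial>lborel) + (\<integral>\<^sup>+y. J y \<partial>lborel)"
    unfolding J_def ind by (subst nn_integral_add) (auto simp: nn_integral_cmult)
  also have "(\<integral>\<^sup>+y. J y \<partial>lborel) = (\<integral>\<^sup>+r. \<integral>\<^sup>+y. ennreal (p * r powr (- p - 1)) * indicator {r\<^sub>0..R} r * (\<phi> y * indicator (cball x r) y) \<partial>lborel \<partial>lborel)"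
    unfolding J_def ind by (rule lborel_pair.Fubini') measurable
  also have "\<dots> \<le> (\<integral>\<^sup>+r. ennreal (C * p) * (ennreal (r powr (\<kappa> - p - 1)) * indicator {r\<^sub>0..R} r) \<partial>lborel)"
  proof (rule nn_integral_mono)
    fix r :: real
    show "(\<integral>\<^sup>+y. ennreal (p * r powr (- p - 1)) * indicator {r\<^sub>0..R} r * (\<phi> y * indicator (cball x r) y) \<partial>lborel)
      \<le> ennreal (C * p) * (ennreal (r powr (\<kappa> - p - 1)) * indicator {r\<^sub>0..R} r)"
    proof (cases "0 < r \<and> r\<^sub>0 \<le> r \<and> r \<le> R")
      case False
      \<comment> \<open>The mass bound is assumed for positive radii only; at radius 0 the weight
        vanishes because \<open>0 powr a = 0\<close>.\<close>
      then have "r = 0 \<or> r \<notin> {r\<^sub>0..R}" using r0 by auto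
      then show ?thesis by auto
    next
      case True
      then have "(\<integral>\<^sup>+y. ennreal (p * r powr (- p - 1)) * indicator {r\<^sub>0..R} r * (\<phi> y * indicator (cball x r) y) \<partial>lborel)
        = ennreal (p * r powr (- p - 1)) * (\<integral>\<^sup>+y. \<phi> y * indicator (cball x r) y \<partial>lborel)"
        by (simp add: nn_integral_cmult)
      also have "\<dots> \<le> ennreal (p * r powr (- p - 1)) * ennreal (C * r powr \<kappa>)"
        using True by (intro mult_left_mono mass) auto
      also have "\<dots> = ennreal (C * p * (r powr (- p - 1) * r powr \<kappa>))"
        using p C by (simp add: ennreal_mult'[symmetric] mult_ac)
      also have "r powr (- p - 1) * r powr \<kappa> = r powr (\<kappa> - p - 1)"
        by (simp add: powr_add[symmetric] algebra_simps)
      finally show ?thesis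
        using True p C by (simp add: ennreal_mult')
    qed
  qed
  also have "\<dots> = ennreal (C * p) * (\<integral>\<^sup>+r. ennreal (r powr (\<kappa> - p - 1)) * indicator {r\<^sub>0..R} r \<partial>lborel)"
    by (rule nn_integral_cmult) simp
  also have "ennreal (R powr - p) * (\<integral>\<^sup>+y. \<phi> y * indicator (cball x R) y \<partial>lborel) \<le> ennreal (R powr - p) * ennreal (C * R powr \<kappa>)"
    using R by (intro mult_left_mono mass) auto
  also have "\<dots> = ennreal (C * (R powr - p * R powr \<kappa>))"
    using C by (simp add: ennreal_mult'[symmetric] mult_ac)
  also have "R powr - p * R powr \<kappa> = R powr (\<kappa> - p)"
    by (simp add: powr_add[symmetric] algebra_simps)
  finally show ?thesis by simp
qed

lemma emeasure_cball_powr: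
  "0 < r \<Longrightarrow> emeasure lborel (cball (x::'a::euclidean_space) r) = ennreal (unit_ball_vol (real DIM('a)) * r powr real DIM('a))"
  by (simp add: emeasure_cball powr_realpow)

text \<open>The layer cake formula with \<open>\<phi> = 1\<close>, where the mass of a ball is its
  volume; \<open>p < real DIM('a)\<close> makes the radial integral converge at 0.\<close>

lemma riesz_potential_cball:
  fixes x :: "'a::euclidean_space"
  assumes "0 < p" "p < real DIM('a)" "0 < R"
  shows "(\<integral>\<^sup>+y. ennreal (norm (x - y) powr - p) * indicator (cball x R) y \<partial>lborel)
    \<le> ennreal (unit_ball_vol (real DIM('a)) * (1 + p / (real DIM('a) - p)) * R powr (real DIM('a) - p))"
proof -
  let ?N = "real DIM('a)" and ?V = "unit_ball_vol (real DIM('a))"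
  have "(\<integral>\<^sup>+y. ennreal (norm (x - y) powr - p) * 1 * indicator {y. 0 \<le> norm (x - y) \<and> norm (x - y) \<le> R} y \<partial>lborel)
    \<le> ennreal (?V * R powr (?N - p)) +
       ennreal (?V * p) * (\<integral>\<^sup>+r. ennreal (r powr (?N - p - 1)) * indicator {0..R} r \<partial>lborel)"
    using assms by (intro layer_cake) (auto simp: emeasure_cball_powr)
  also have "(\<integral>\<^sup>+r. ennreal (r powr (?N - p - 1)) * indicator {0..R} r \<partial>lborel) = ennreal (R powr (?N - p) / (?N - p))"
    using assms by (intro nn_integral_powr_0) auto
  also have "ennreal (?V * R powr (?N - p)) + ennreal (?V * p) * ennreal (R powr (?N - p) / (?N - p))
    = ennreal (?V * (1 + p / (?N - p)) * R powr (?N - p))"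
    using assms by (subst ennreal_mult'[symmetric], simp, subst ennreal_plus[symmetric]) (auto simp: algebra_simps)
  finally show ?thesis
    by (simp add: cball_def dist_norm)
qed

lemma nn_integral_lborel_translate:
  fixes c :: "'a::euclidean_space"
  assumes [measurable]: "f \<in> borel_measurable borel"
  shows "(\<integral>\<^sup>+y. f (y + c) \<partial>lborel) = (\<integral>\<^sup>+y. f y \<partial>lborel)"
proof -
  have "(\<integral>\<^sup>+y. f y \<partial>lborel) = (\<integral>\<^sup>+y. f y \<partial>distr lborel borel ((+) c))"
    by (simp add: lborel_distr_plus)
  also have "\<dots> = (\<integral>\<^sup>+y. f (c + y) \<partial>lborel)"
    by (rule nn_integral_distr) auto
  finally show ?thesis by (simp add: add.commute)
qed

text \<open>The quotient of \<open>y\<close> and \<open>x\<close> lies between \<open>1 / l\<close>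
  and \<open>l\<close>, so the absolute value in the exponent covers increasing and decreasing
  powers together.\<close>

lemma powr_comparable:
  fixes x y a l :: real
  assumes "0 < x" "1 \<le> l" "x / l \<le> y" "y \<le> l * x"
  shows "y powr a \<le> l powr \<bar>a\<bar> * x powr a"
proof (cases "0 \<le> a")
  case True
  have "0 \<le> x / l" using assms by simp
  then have "0 \<le> y" using assms(3) by (rule order_trans)
  then have "y powr a \<le> (l * x) powr a"
    using assms True by (intro powr_mono2) auto
  then show ?thesis using assms True by (simp add: powr_mult)
next
  case False
  have "y powr a \<le> (x / l) powr a"
    using assms False by (intro powr_mono2') auto
  also have "\<dots> = l powr \<bar>a\<bar> * x powr a"
    using assms False by (simp add: powr_divide powr_minus divide_simps)
  finally show ?thesis .
qed

section \<open>Integrals of powers of the boundary distance\<close>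

context C2_domain
begin

section \<open>Integration and comparison over the domain\<close>

lemma dom_sets_lborel: "\<Omega> \<inter> space lborel \<in> sets lborel"
  using dom_measurable by (simp only: space_lborel space_borel Int_UNIV_right sets_lborel)

lemma nn_integral_lborel_on: "(\<integral>\<^sup>+x. f x \<partial>lborel_on \<Omega>) = (\<integral>\<^sup>+x. f x * indicator \<Omega> x \<partial>lborel)"
  by (rule nn_integral_restrict_space[OF dom_sets_lborel])

lemma AE_lborel_on: "(AE x in lborel_on \<Omega>. P x) \<longleftrightarrow> (AE x in lborel. x \<in> \<Omega> \<longrightarrow> P x)"
  by (rule AE_restrict_space_iff[OF dom_sets_lborel])

lemma borel_measurable_lborel_onI: "f \<in> borel_measurable borel \<Longrightarrow> f \<in> borel_measurable (lborel_on \<Omega>)"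
  by (rule measurable_restrict_space1) simp

lemma space_lborel_on: "space (lborel_on \<Omega>) = \<Omega>"
  by (simp add: space_restrict_space)

lemma lesssim_onI:
  "0 < C \<Longrightarrow> AE x in lborel. x \<in> \<Omega> \<longrightarrow> f x \<le> C * g x \<Longrightarrow> lesssim_on \<Omega> f g"
  unfolding lesssim_on_def AE_lborel_on[symmetric] by blast

lemma lesssim_onI':
  assumes "0 < c" "AE x in lborel. x \<in> \<Omega> \<longrightarrow> c * f x \<le> g x"
  shows "lesssim_on \<Omega> f g"
proof (rule lesssim_onI)
  show "0 < 1 / c" using assms by simp
  show "AE x in lborel. x \<in> \<Omega> \<longrightarrow> f x \<le> 1 / c * g x"
    using assms(2)
  proof eventually_elim
    fix x assume "x \<in> \<Omega> \<longrightarrow> c * f x \<le> g x"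
    then show "x \<in> \<Omega> \<longrightarrow> f x \<le> 1 / c * g x"
      using assms(1) by (simp add: pos_le_divide_eq mult.commute)
  qed
qed

section \<open>Mass of powers of the boundary distance on balls\<close>

text \<open>In the chart \<open>c * h y \<le> \<delta> y\<close>, so the integrand is at most a
  multiple of h^(-\<theta>), whose integral over a slab of thickness \<open>r\<close> is of order
  r^(1-\<theta>) r^(N-1); \<open>\<theta> < 1\<close> makes it converge.\<close>

lemma strip_mass_chart:
  assumes ch: "chart \<rho> c z e h" and c: "c > 0" and \<theta>: "0 \<le> \<theta>" "\<theta> < 1" and r: "0 < r" "r < \<rho>"
  shows "(\<integral>\<^sup>+y. ennreal (\<delta> y powr - \<theta>) * indicator \<Omega> y * indicator (cball z r) y \<partial>lborel)
    \<le> ennreal (c powr - \<theta> * unit_ball_vol (real DIM('a)) * (1 + 2 powr real DIM('a) / (1 - \<theta>)) * r powr (real DIM('a) - \<theta>))"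
proof -
  let ?N = "real DIM('a)" and ?V = "unit_ball_vol (real DIM('a))"
  have e: "norm e = 1" and cont: "continuous_on UNIV h" and sh: "\<And>y t. h (y + t *\<^sub>R e) = h y + t"
    and dom: "\<And>y. y \<in> ball z \<rho> \<Longrightarrow> y \<in> \<Omega> \<longleftrightarrow> 0 < h y" and low: "\<And>y. y \<in> ball z \<rho> \<Longrightarrow> c * h y \<le> \<delta> y"
    using ch unfolding chart_def by blast+
  have [measurable]: "h \<in> borel_measurable borel"
    by (rule borel_measurable_continuous_onI[OF cont])
  define a where "a = (\<lambda>s. ennreal (s powr - \<theta>) * indicator {0<..r} s)"
  have [measurable]: "a \<in> borel_measurable borel"
    unfolding a_def by measurable
  have aint: "(\<integral>\<^sup>+s. a s \<partial>lborel) \<le> ennreal (r powr (1 - \<theta>) / (1 - \<theta>))"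
  proof -
    have "(\<integral>\<^sup>+s. a s \<partial>lborel) \<le> (\<integral>\<^sup>+s. ennreal (s powr ((1 - \<theta>) - 1)) * indicator {0..r} s \<partial>lborel)"
      unfolding a_def by (intro nn_integral_mono) (auto simp: indicator_def)
    then show ?thesis
      using nn_integral_powr_0[of "1 - \<theta>" r] \<theta> r by simp
  qed
  define F where "F = (\<lambda>y. a (h y) * indicator (cball z r) y)"
  have [measurable]: "F \<in> borel_measurable borel"
    unfolding F_def by measurable
  \<comment> \<open>Averaging the translates of the strip over a shift of length \<open>r\<close> in the direction \<open>e\<close> replaces
    Fubini in the coordinates of the chart.\<close>
  have avg: "ennreal r * (\<integral>\<^sup>+y. F y \<partial>lborel) \<le> ennreal (r powr (1 - \<theta>) / (1 - \<theta>)) * ennreal (?V * (2 * r) powr ?N)"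
  proof -
    have "ennreal r * (\<integral>\<^sup>+y. F y \<partial>lborel) = (\<integral>\<^sup>+t. (\<integral>\<^sup>+y. F y \<partial>lborel) * indicator {0..r} t \<partial>lborel)"
      using r by (simp add: nn_integral_cmult_indicator mult.commute)
    also have "\<dots> = (\<integral>\<^sup>+t. (\<integral>\<^sup>+y. F (y + (- t) *\<^sub>R e) \<partial>lborel) * indicator {0..r} t \<partial>lborel)"
      by (subst nn_integral_lborel_translate) auto
    also have "\<dots> = (\<integral>\<^sup>+t. \<integral>\<^sup>+y. F (y + (- t) *\<^sub>R e) * indicator {0..r} t \<partial>lborel \<partial>lborel)"
      by (subst nn_integral_multc) auto
    also have "\<dots> \<le> (\<integral>\<^sup>+t. \<integral>\<^sup>+y. a (h y - t) * indicator (cball z (2 * r)) y \<partial>lborel \<partial>lborel)"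
    proof (intro nn_integral_mono)
      fix t :: real and y :: 'a
      have "h (y + (- t) *\<^sub>R e) = h y - t"
        using sh[of y "- t"] by simp
      moreover have "dist z y \<le> 2 * r" if "dist z (y + (- t) *\<^sub>R e) \<le> r" "0 \<le> t" "t \<le> r"
      proof -
        have "dist (y + (- t) *\<^sub>R e) y \<le> r"
          using that e by (simp add: dist_norm)
        then show ?thesis
          using that dist_triangle[of z y "y + (- t) *\<^sub>R e"] by linarith
      qed
      ultimately show "F (y + (- t) *\<^sub>R e) * indicator {0..r} t \<le> a (h y - t) * indicator (cball z (2 * r)) y"
        by (auto simp: F_def indicator_def simp del: scaleR_minus_left)
    qed
    also have "\<dots> = (\<integral>\<^sup>+y. \<integral>\<^sup>+t. a (h y - t) * indicator (cball z (2 * r)) y \<partial>lborel \<partial>lborel)"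
      by (rule lborel_pair.Fubini') measurable
    also have "\<dots> = (\<integral>\<^sup>+y. (\<integral>\<^sup>+t. a (h y - t) \<partial>lborel) * indicator (cball z (2 * r)) y \<partial>lborel)"
      by (subst nn_integral_multc) auto
    also have "\<dots> = (\<integral>\<^sup>+y. (\<integral>\<^sup>+s. a s \<partial>lborel) * indicator (cball z (2 * r)) y \<partial>lborel)"
      using nn_integral_real_affine[of a "-1" "h _"] by simp
    also have "\<dots> = (\<integral>\<^sup>+s. a s \<partial>lborel) * ennreal (?V * (2 * r) powr ?N)"
      using r by (simp add: nn_integral_cmult_indicator emeasure_cball_powr)
    also have "\<dots> \<le> ennreal (r powr (1 - \<theta>) / (1 - \<theta>)) * ennreal (?V * (2 * r) powr ?N)"
      by (intro mult_right_mono aint) simp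
    finally show ?thesis .
  qed
  have "ennreal (1 / r) * (ennreal r * (\<integral>\<^sup>+y. F y \<partial>lborel)) = (\<integral>\<^sup>+y. F y \<partial>lborel)"
    using r by (simp add: mult.assoc[symmetric] ennreal_mult'[symmetric])
  then have "(\<integral>\<^sup>+y. F y \<partial>lborel) \<le> ennreal (1 / r) * (ennreal (r powr (1 - \<theta>) / (1 - \<theta>)) * ennreal (?V * (2 * r) powr ?N))"
    using mult_left_mono[OF avg, of "ennreal (1 / r)"] by simp
  also have "\<dots> = ennreal (1 / r * (r powr (1 - \<theta>) / (1 - \<theta>) * (?V * (2 * r) powr ?N)))"
    using r \<theta> by (simp add: ennreal_mult'[symmetric] mult_ac)
  also have "1 / r * (r powr (1 - \<theta>) / (1 - \<theta>) * (?V * (2 * r) powr ?N)) = ?V * (2 powr ?N / (1 - \<theta>)) * r powr (?N - \<theta>)"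
    using r \<theta> by (simp add: powr_diff powr_mult field_simps)
  finally have Fint: "(\<integral>\<^sup>+y. F y \<partial>lborel) \<le> ennreal (?V * (2 powr ?N / (1 - \<theta>)) * r powr (?N - \<theta>))" .
  \<comment> \<open>The first term covers heights up to \<open>r\<close>, the second one the points
    of the ball at greater height.\<close>
  have le: "ennreal (\<delta> y powr - \<theta>) * indicator \<Omega> y * indicator (cball z r) y
     \<le> ennreal (c powr - \<theta>) * (F y + ennreal (r powr - \<theta>) * indicator (cball z r) y)" for y
  proof (cases "y \<in> \<Omega> \<and> y \<in> cball z r")
    case True
    then have hy: "0 < h y" "c * h y \<le> \<delta> y" using dom low r by auto
    have "\<delta> y powr - \<theta> \<le> (c * h y) powr - \<theta>"
      using hy c \<theta> by (intro powr_mono2') auto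
    also have "\<dots> = c powr - \<theta> * h y powr - \<theta>" using hy c by (simp add: powr_mult)
    finally have 1: "\<delta> y powr - \<theta> \<le> c powr - \<theta> * h y powr - \<theta>" .
    show ?thesis
    proof (cases "h y \<le> r")
      case True
      have "ennreal (\<delta> y powr - \<theta>) \<le> ennreal (c powr - \<theta>) * ennreal (h y powr - \<theta>)"
        using 1 by (simp add: ennreal_mult'[symmetric] ennreal_leI)
      also have "\<dots> \<le> ennreal (c powr - \<theta>) * (ennreal (h y powr - \<theta>) + ennreal (r powr - \<theta>))"
        by (intro mult_left_mono) auto
      finally show ?thesis
        using True hy \<open>y \<in> \<Omega> \<and> y \<in> cball z r\<close> by (simp add: F_def a_def)
    next
      case False
      then have "h y powr - \<theta> \<le> r powr - \<theta>" using r \<theta> by (intro powr_mono2') auto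
      then have "c powr - \<theta> * h y powr - \<theta> \<le> c powr - \<theta> * r powr - \<theta>"
        by (intro mult_left_mono) auto
      then have "ennreal (\<delta> y powr - \<theta>) \<le> ennreal (c powr - \<theta>) * ennreal (r powr - \<theta>)"
        using 1 by (simp add: ennreal_mult'[symmetric] ennreal_leI)
      then show ?thesis
        using False \<open>y \<in> \<Omega> \<and> y \<in> cball z r\<close> by (simp add: F_def a_def)
    qed
  qed (auto simp: indicator_def)
  have "(\<integral>\<^sup>+y. ennreal (\<delta> y powr - \<theta>) * indicator \<Omega> y * indicator (cball z r) y \<partial>lborel)
     \<le> (\<integral>\<^sup>+y. ennreal (c powr - \<theta>) * (F y + ennreal (r powr - \<theta>) * indicator (cball z r) y) \<partial>lborel)"
    by (intro nn_integral_mono le)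
  also have "\<dots> = ennreal (c powr - \<theta>) * ((\<integral>\<^sup>+y. F y \<partial>lborel) + ennreal (r powr - \<theta>) * emeasure lborel (cball z r))"
    by (subst nn_integral_cmult, simp, subst nn_integral_add) (auto simp: nn_integral_cmult_indicator)
  also have "\<dots> \<le> ennreal (c powr - \<theta>) * (ennreal (?V * (2 powr ?N / (1 - \<theta>)) * r powr (?N - \<theta>)) + ennreal (r powr - \<theta>) * ennreal (?V * r powr ?N))"
    using r by (intro mult_left_mono add_mono Fint) (auto simp: emeasure_cball_powr)
  also have "ennreal (r powr - \<theta>) * ennreal (?V * r powr ?N) = ennreal (?V * (r powr - \<theta> * r powr ?N))"
    by (simp add: ennreal_mult'[symmetric] mult_ac)
  also have "r powr - \<theta> * r powr ?N = r powr (?N - \<theta>)"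
    by (simp add: powr_add[symmetric] algebra_simps)
  also have "ennreal (c powr - \<theta>) * (ennreal (?V * (2 powr ?N / (1 - \<theta>)) * r powr (?N - \<theta>)) + ennreal (?V * r powr (?N - \<theta>)))
     = ennreal (c powr - \<theta> * ?V * (1 + 2 powr ?N / (1 - \<theta>)) * r powr (?N - \<theta>))"
    using \<theta> by (simp add: ennreal_plus[symmetric] ennreal_mult'[symmetric] algebra_simps del: ennreal_plus)
  finally show ?thesis .
qed

text \<open>Only a neighbourhood of the frontier matters, and finitely many balls with the bound of
  \<open>strip_mass_chart\<close> cover it. Away from the frontier the integrand is bounded, and
  \<Omega> has finite measure.\<close>

lemma total_mass_finite:
  assumes "0 \<le> \<theta>" "\<theta> < 1"
  shows "(\<integral>\<^sup>+y. ennreal (\<delta> y powr - \<theta>) * indicator \<Omega> y \<partial>lborel) < \<infinity>"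
proof -
  obtain \<rho> c where \<rho>: "\<rho> > 0" and c: "c > 0" "c \<le> 1"
    and ch: "\<And>z. z \<in> frontier \<Omega> \<Longrightarrow> \<exists>e h. chart \<rho> c z e h"
    by (rule uniform_chart) (rule that)
  define r where "r = \<rho> / 2"
  have r: "0 < r" "r < \<rho>" using \<rho> by (auto simp: r_def)
  \<comment> \<open>With half the radius in the cover, a point closer than \<open>r / 2\<close> to
    the frontier lies in one of the balls of radius \<open>r\<close>.\<close>
  obtain F where F: "F \<subseteq> frontier \<Omega>" "finite F" "frontier \<Omega> \<subseteq> (\<Union>z\<in>F. ball z (r / 2))"
  proof (rule compactE_image[OF compact_frontier_dom])
    show "frontier \<Omega> \<subseteq> (\<Union>x\<in>frontier \<Omega>. ball x (r / 2))"
      using r by fastforce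
  qed auto
  let ?f = "\<lambda>y. ennreal (\<delta> y powr - \<theta>) * indicator \<Omega> y"
  have le: "?f y \<le> ennreal ((r / 2) powr - \<theta>) * indicator \<Omega> y + (\<Sum>z\<in>F. ?f y * indicator (cball z r) y)" for y
  proof (cases "y \<in> \<Omega> \<and> \<delta> y < r / 2")
    case True
    then obtain p where p: "p \<in> frontier \<Omega>" "norm (y - p) = \<delta> y"
      using bdist_attained by blast
    then have "p \<in> (\<Union>z\<in>F. ball z (r / 2))" using F by blast
    then obtain z where z: "z \<in> F" "dist z p < r / 2" by auto
    have "y \<in> cball z r"
      using z p True dist_triangle[of z y p] by (simp add: dist_norm norm_minus_commute)
    then have "?f y = ?f y * indicator (cball z r) y" by simp
    also have "\<dots> \<le> (\<Sum>z\<in>F. ?f y * indicator (cball z r) y)"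
      using z F by (intro member_le_sum) auto
    finally show ?thesis by (rule add_increasing[rotated]) simp
  next
    case False
    then have "?f y \<le> ennreal ((r / 2) powr - \<theta>) * indicator \<Omega> y"
      using r assms by (auto simp: indicator_def intro!: ennreal_leI powr_mono2')
    then show ?thesis by (rule add_increasing2[rotated]) simp
  qed
  have "(\<integral>\<^sup>+y. ?f y \<partial>lborel) \<le> (\<integral>\<^sup>+y. ennreal ((r / 2) powr - \<theta>) * indicator \<Omega> y + (\<Sum>z\<in>F. ?f y * indicator (cball z r) y) \<partial>lborel)"
    by (intro nn_integral_mono le)
  also have "\<dots> = ennreal ((r / 2) powr - \<theta>) * emeasure lborel \<Omega> + (\<Sum>z\<in>F. \<integral>\<^sup>+y. ?f y * indicator (cball z r) y \<partial>lborel)"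
    by (subst nn_integral_add) (auto simp: nn_integral_cmult_indicator nn_integral_sum)
  also have "\<dots> < \<infinity>"
  proof -
    have "(\<integral>\<^sup>+y. ?f y * indicator (cball z r) y \<partial>lborel) < \<infinity>" if "z \<in> F" for z
    proof -
      obtain e h where "chart \<rho> c z e h" using ch F \<open>z \<in> F\<close> by blast
      from strip_mass_chart[OF this c(1) assms r] show ?thesis
        by (simp add: le_less_trans)
    qed
    moreover have "emeasure lborel \<Omega> < \<infinity>"
      by (rule emeasure_bounded_finite[OF bounded_dom])
    ultimately show ?thesis
      using F by (auto simp: ennreal_mult_less_top)
  qed
  finally show ?thesis .
qed

text \<open>A ball of radius \<open>r \<ge> \<delta> x / 2\<close> lies in the ball of radius
  \<open>3 * r\<close> around the frontier point nearest to \<open>x\<close>, where the chart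
  estimate applies if \<open>r\<close> is small; for larger \<open>r\<close> the finite total mass
  suffices. For negative \<open>\<theta>\<close> the bound \<open>\<delta> y \<le> 3 * r\<close> on
  the ball is enough.\<close>

lemma ball_mass:
  assumes "\<theta> < 1"
  obtains C where "C > 0" "\<And>x r. x \<in> \<Omega> \<Longrightarrow> \<delta> x / 2 \<le> r \<Longrightarrow>
    (\<integral>\<^sup>+y. ennreal (\<delta> y powr - \<theta>) * indicator \<Omega> y * indicator (cball x r) y \<partial>lborel) \<le> ennreal (C * r powr (real DIM('a) - \<theta>))"
proof (cases "0 \<le> \<theta>")
  case False
  let ?N = "real DIM('a)" and ?V = "unit_ball_vol (real DIM('a))"
  show thesis
  proof (rule that)
    show "3 powr - \<theta> * ?V > 0" by simp
    fix x r assume x: "x \<in> \<Omega>" "\<delta> x / 2 \<le> r"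
    then have r: "r > 0" using bdist_pos by fastforce
    have "(\<integral>\<^sup>+y. ennreal (\<delta> y powr - \<theta>) * indicator \<Omega> y * indicator (cball x r) y \<partial>lborel)
      \<le> (\<integral>\<^sup>+y. ennreal ((3 * r) powr - \<theta>) * indicator (cball x r) y \<partial>lborel)"
    proof (intro nn_integral_mono)
      fix y
      have "\<delta> y \<le> 3 * r" if "y \<in> cball x r"
        using that x bdist_le_add_dist[of y x] by (simp add: dist_norm norm_minus_commute)
      then show "ennreal (\<delta> y powr - \<theta>) * indicator \<Omega> y * indicator (cball x r) y \<le> ennreal ((3 * r) powr - \<theta>) * indicator (cball x r) y"
        using False by (auto simp: indicator_def intro!: ennreal_leI powr_mono2)
    qed
    also have "\<dots> = ennreal ((3 * r) powr - \<theta> * (?V * r powr ?N))"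
      using r by (simp add: nn_integral_cmult_indicator emeasure_cball_powr ennreal_mult'[symmetric])
    also have "(3 * r) powr - \<theta> * (?V * r powr ?N) = 3 powr - \<theta> * ?V * r powr (?N - \<theta>)"
      using r by (simp add: powr_mult powr_diff powr_minus divide_simps)
    finally show "(\<integral>\<^sup>+y. ennreal (\<delta> y powr - \<theta>) * indicator \<Omega> y * indicator (cball x r) y \<partial>lborel) \<le> ennreal (3 powr - \<theta> * ?V * r powr (?N - \<theta>))" .
  qed
next
  case True
  let ?N = "real DIM('a)" and ?V = "unit_ball_vol (real DIM('a))"
  let ?f = "\<lambda>y. ennreal (\<delta> y powr - \<theta>) * indicator \<Omega> y"
  have \<theta>N: "\<theta> < ?N"
    using assms DIM_positive[where 'a='a] by linarith
  obtain \<rho> c where \<rho>: "\<rho> > 0" and c: "c > 0" "c \<le> 1"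
    and ch: "\<And>z. z \<in> frontier \<Omega> \<Longrightarrow> \<exists>e h. chart \<rho> c z e h"
    by (rule uniform_chart) (rule that)
  define A where "A = c powr - \<theta> * ?V * (1 + 2 powr ?N / (1 - \<theta>))"
  have A: "A > 0" using c assms by (auto simp: A_def intro!: mult_pos_pos add_pos_pos divide_pos_pos)
  obtain T where T: "0 \<le> T" "(\<integral>\<^sup>+y. ?f y \<partial>lborel) = ennreal T"
    using total_mass_finite[OF True assms] by (cases "\<integral>\<^sup>+y. ?f y \<partial>lborel") auto
  \<comment> \<open>Chosen such that the total mass \<open>T\<close> is at most
    \<open>B * r powr (?N - \<theta>)\<close> for all \<open>r \<ge> \<rho> / 3\<close>.\<close>
  define B where "B = T / (\<rho> / 3) powr (?N - \<theta>)"
  have B: "B \<ge> 0" using T by (simp add: B_def)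
  show thesis
  proof (rule that)
    show "A * 3 powr (?N - \<theta>) + B > 0" using A B by (simp add: add_pos_nonneg)
    fix x r assume x: "x \<in> \<Omega>" "\<delta> x / 2 \<le> r"
    then have r: "r > 0" using bdist_pos by fastforce
    show "(\<integral>\<^sup>+y. ?f y * indicator (cball x r) y \<partial>lborel) \<le> ennreal ((A * 3 powr (?N - \<theta>) + B) * r powr (?N - \<theta>))"
    proof (cases "3 * r < \<rho>")
      case small: True
      obtain z where z: "z \<in> frontier \<Omega>" "norm (x - z) = \<delta> x" using bdist_attained x by blast
      obtain e h where "chart \<rho> c z e h" using ch z by blast
      have "(\<integral>\<^sup>+y. ?f y * indicator (cball x r) y \<partial>lborel) \<le> (\<integral>\<^sup>+y. ?f y * indicator (cball z (3 * r)) y \<partial>lborel)"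
      proof (intro nn_integral_mono mult_left_mono)
        fix y
        have "dist z y \<le> 3 * r" if "dist x y \<le> r"
          using that z x dist_triangle[of z y x] by (simp add: dist_norm norm_minus_commute)
        then show "indicator (cball x r) y \<le> (indicator (cball z (3 * r)) y :: ennreal)"
          by (auto simp: indicator_def)
      qed simp
      also have "\<dots> \<le> ennreal (A * (3 * r) powr (?N - \<theta>))"
        unfolding A_def using strip_mass_chart[OF \<open>chart \<rho> c z e h\<close> c(1) True assms, of "3 * r"] r small by simp
      also have "A * (3 * r) powr (?N - \<theta>) \<le> (A * 3 powr (?N - \<theta>) + B) * r powr (?N - \<theta>)"
        using r B by (simp add: powr_mult algebra_simps)
      finally show ?thesis by (simp add: ennreal_leI)
    next
      case False
      have "(\<integral>\<^sup>+y. ?f y * indicator (cball x r) y \<partial>lborel) \<le> (\<integral>\<^sup>+y. ?f y \<partial>lborel)"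
        by (intro nn_integral_mono) (auto simp: indicator_def)
      also have "\<dots> = ennreal T" by (rule T)
      also have "T = B * (\<rho> / 3) powr (?N - \<theta>)" using \<rho> by (simp add: B_def)
      also have "\<dots> \<le> B * r powr (?N - \<theta>)"
        using B \<rho> False \<theta>N by (intro mult_left_mono powr_mono2) auto
      also have "\<dots> \<le> (A * 3 powr (?N - \<theta>) + B) * r powr (?N - \<theta>)"
        using A by (simp add: algebra_simps)
      finally show ?thesis by (simp add: ennreal_leI)
    qed
  qed
qed

text \<open>From \<open>4 * \<delta> x \<le> D\<close> and e \<le> 3. It allows constants to be
  absorbed into the logarithm.\<close>

lemma ln_D_ge_1: "x \<in> \<Omega> \<Longrightarrow> 1 \<le> ln (D / \<delta> x)"
proof -
  assume x: "x \<in> \<Omega>"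
  have "exp 1 \<le> (3::real)" by (rule exp_le)
  also have "3 \<le> D / \<delta> x"
    using bdist_le_D[OF x] bdist_pos[OF x] by (simp add: le_divide_eq)
  finally show ?thesis
    by (smt (verit) exp_gt_zero ln_exp ln_mono)
qed

end

section \<open>The Green kernel\<close>

locale green_kernel = C2_domain \<Omega> for \<Omega> :: "'a::euclidean_space set" +
  fixes s \<gamma> :: real
  assumes s_pos: "0 < s" and \<gamma>_pos: "0 < \<gamma>" and s_dim: "2 * s < real DIM('a)"
begin

abbreviation k :: "'a \<Rightarrow> 'a \<Rightarrow> real" where "k \<equiv> green_bound \<Omega> s \<gamma>"

section \<open>Upper bounds for the kernel\<close>

lemma k_nonneg [simp]: "0 \<le> k x y"
  by (simp add: green_bound_def)

lemma k_measurable [measurable]: "(\<lambda>(x, y). k x y) \<in> borel_measurable (borel \<Otimes>\<^sub>M borel)"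
  unfolding green_bound_def by measurable

lemma k_le_riesz: "k x y \<le> norm (x - y) powr - (real DIM('a) - 2 * s)"
proof -
  have "min (\<delta> z / norm (x - y)) 1 powr \<gamma> \<le> 1" for z
    using \<gamma>_pos by (intro powr_le1) auto
  then have "min (\<delta> x / norm (x - y)) 1 powr \<gamma> * min (\<delta> y / norm (x - y)) 1 powr \<gamma> \<le> 1"
    by (intro mult_le_one) auto
  then have "norm (x - y) powr - (real DIM('a) - 2 * s) * (min (\<delta> x / norm (x - y)) 1 powr \<gamma> * min (\<delta> y / norm (x - y)) 1 powr \<gamma>)
      \<le> norm (x - y) powr - (real DIM('a) - 2 * s)"
    by (simp add: mult_left_le)
  then show ?thesis
    unfolding green_bound_def powr_minus_divide by simp
qed

text \<open>Each minimum is at most its first entry; away from the pole this keeps the decay of both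
  factors towards the boundary.\<close>

lemma k_le_far: "k x y \<le> \<delta> x powr \<gamma> * \<delta> y powr \<gamma> * norm (x - y) powr - (real DIM('a) - 2 * s + 2 * \<gamma>)"
proof (cases "x = y")
  case False
  let ?r = "norm (x - y)"
  have r: "?r > 0" using False by simp
  have m: "min (\<delta> z / ?r) 1 powr \<gamma> \<le> \<delta> z powr \<gamma> * ?r powr - \<gamma>" for z
  proof -
    have "min (\<delta> z / ?r) 1 powr \<gamma> \<le> (\<delta> z / ?r) powr \<gamma>"
      using \<gamma>_pos by (intro powr_mono2) auto
    then show ?thesis using r by (simp add: powr_divide powr_minus_divide)
  qed
  have "k x y = ?r powr - (real DIM('a) - 2 * s) * (min (\<delta> x / ?r) 1 powr \<gamma> * min (\<delta> y / ?r) 1 powr \<gamma>)"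
    unfolding green_bound_def powr_minus_divide by simp
  also have "\<dots> \<le> ?r powr - (real DIM('a) - 2 * s) * ((\<delta> x powr \<gamma> * ?r powr - \<gamma>) * (\<delta> y powr \<gamma> * ?r powr - \<gamma>))"
    by (intro mult_left_mono mult_mono m) auto
  also have "\<dots> = \<delta> x powr \<gamma> * \<delta> y powr \<gamma> * (?r powr - (real DIM('a) - 2 * s) * ?r powr - \<gamma> * ?r powr - \<gamma>)"
    by simp
  also have "?r powr - (real DIM('a) - 2 * s) * ?r powr - \<gamma> * ?r powr - \<gamma> = ?r powr - (real DIM('a) - 2 * s + 2 * \<gamma>)"
    by (simp add: powr_add[symmetric] algebra_simps)
  finally show ?thesis .
\<comment> \<open>On the diagonal \<open>k\<close> is 0 by division by zero.\<close>
qed (simp add: green_bound_def)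

text \<open>The integral is split at |x - y| = \<delta>(x) / 2. On the inner ball
  \<open>\<delta> y\<close> is comparable to \<open>\<delta> x\<close>, and the Riesz kernel
  contributes order \<delta>(x)^(2s). Outside, \<open>k_le_far\<close> leaves the density
  \<delta>^(-(b-\<gamma>)), to which \<open>layer_cake\<close> and \<open>ball_mass\<close> apply;
  \<open>b < 1 + \<gamma>\<close> is the integrability condition there. The radial integral is kept,
  as its size depends on the sign of 2s - \<gamma> - b.\<close>

lemma potential_bound:
  assumes b: "b < 1 + \<gamma>"
  obtains C where "C > 0" "\<And>x. x \<in> \<Omega> \<Longrightarrow>
    (\<integral>\<^sup>+y. ennreal (k x y) * ennreal (\<delta> y powr - b) * indicator \<Omega> y \<partial>lborel)
    \<le> ennreal C * (ennreal (\<delta> x powr (2 * s - b) + \<delta> x powr \<gamma>) + ennreal (\<delta> x powr \<gamma>) *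
       (\<integral>\<^sup>+r. ennreal (r powr (2 * s - \<gamma> - b - 1)) * indicator {\<delta> x / 2..D} r \<partial>lborel))"
proof -
  define p where "p = real DIM('a) - 2 * s + 2 * \<gamma>"
  have p: "p > 0" using s_dim \<gamma>_pos by (simp add: p_def)
  obtain C1 where C1: "C1 > 0" "\<And>x r. x \<in> \<Omega> \<Longrightarrow> \<delta> x / 2 \<le> r \<Longrightarrow>
    (\<integral>\<^sup>+y. ennreal (\<delta> y powr - (b - \<gamma>)) * indicator \<Omega> y * indicator (cball x r) y \<partial>lborel) \<le> ennreal (C1 * r powr (real DIM('a) - (b - \<gamma>)))"
    by (rule ball_mass[of "b - \<gamma>"]) (use b in auto)
  define C2 where "C2 = unit_ball_vol (real DIM('a)) * (1 + (real DIM('a) - 2 * s) / (2 * s))"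
  have C2: "C2 > 0" using s_dim s_pos by (auto simp: C2_def intro!: mult_pos_pos add_pos_nonneg)
  define C where "C = 2 powr \<bar>b\<bar> * C2 + C1 * D powr (2 * s - \<gamma> - b) + C1 * p"
  have C: "C > 0" using C1 C2 p by (simp add: C_def add_pos_nonneg)
  have "(\<integral>\<^sup>+y. ennreal (k x y) * ennreal (\<delta> y powr - b) * indicator \<Omega> y \<partial>lborel)
    \<le> ennreal C * (ennreal (\<delta> x powr (2 * s - b) + \<delta> x powr \<gamma>) + ennreal (\<delta> x powr \<gamma>) *
       (\<integral>\<^sup>+r. ennreal (r powr (2 * s - \<gamma> - b - 1)) * indicator {\<delta> x / 2..D} r \<partial>lborel))"
    if x: "x \<in> \<Omega>" for x
  proof -
    let ?J = "\<integral>\<^sup>+r. ennreal (r powr (2 * s - \<gamma> - b - 1)) * indicator {\<delta> x / 2..D} r \<partial>lborel"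
    let ?near = "\<lambda>y. ennreal (norm (x - y) powr - (real DIM('a) - 2 * s)) * indicator (cball x (\<delta> x / 2)) y"
    let ?\<phi> = "\<lambda>y. ennreal (\<delta> y powr - (b - \<gamma>)) * indicator \<Omega> y"
    let ?far = "\<lambda>y. ennreal (norm (x - y) powr - p) * ?\<phi> y * indicator {y. \<delta> x / 2 \<le> norm (x - y) \<and> norm (x - y) \<le> D} y"
    have dx: "\<delta> x > 0" using x by (rule bdist_pos)
    have le: "ennreal (k x y) * ennreal (\<delta> y powr - b) * indicator \<Omega> y
      \<le> ennreal (2 powr \<bar>b\<bar> * \<delta> x powr - b) * ?near y + ennreal (\<delta> x powr \<gamma>) * ?far y" for y
    proof (cases "y \<in> \<Omega>")
      case y: True
      show ?thesis
      proof (cases "norm (x - y) \<le> \<delta> x / 2")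
        case True
        have "\<delta> y powr - b \<le> 2 powr \<bar>- b\<bar> * \<delta> x powr - b"
          using bdist_le_add_dist[of x y] bdist_le_add_dist[of y x] True dx
          by (intro powr_comparable) (auto simp: norm_minus_commute)
        then have "k x y * \<delta> y powr - b \<le> norm (x - y) powr - (real DIM('a) - 2 * s) * (2 powr \<bar>b\<bar> * \<delta> x powr - b)"
          by (intro mult_mono k_le_riesz) auto
        then have "ennreal (k x y * \<delta> y powr - b) \<le> ennreal (2 powr \<bar>b\<bar> * \<delta> x powr - b) * ennreal (norm (x - y) powr - (real DIM('a) - 2 * s))"
          by (simp add: ennreal_mult'[symmetric] ennreal_leI mult_ac)
        then have "ennreal (k x y) * ennreal (\<delta> y powr - b) * indicator \<Omega> y \<le> ennreal (2 powr \<bar>b\<bar> * \<delta> x powr - b) * ?near y"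
          using True y by (simp add: ennreal_mult' dist_norm)
        then show ?thesis by (rule add_increasing2[rotated]) simp
      next
        case False
        have "k x y * \<delta> y powr - b \<le> (\<delta> x powr \<gamma> * \<delta> y powr \<gamma> * norm (x - y) powr - p) * \<delta> y powr - b"
          using k_le_far unfolding p_def by (intro mult_right_mono) auto
        also have "\<dots> = \<delta> x powr \<gamma> * (norm (x - y) powr - p * (\<delta> y powr \<gamma> * \<delta> y powr - b))"
          by simp
        also have "\<delta> y powr \<gamma> * \<delta> y powr - b = \<delta> y powr - (b - \<gamma>)"
          by (simp add: powr_add[symmetric] algebra_simps)
        finally have "ennreal (k x y * \<delta> y powr - b) \<le> ennreal (\<delta> x powr \<gamma>) * (ennreal (norm (x - y) powr - p) * ennreal (\<delta> y powr - (b - \<gamma>)))"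
          by (simp add: ennreal_mult'[symmetric] ennreal_leI)
        then have "ennreal (k x y) * ennreal (\<delta> y powr - b) * indicator \<Omega> y \<le> ennreal (\<delta> x powr \<gamma>) * ?far y"
          using False y norm_diff_lt_D[OF x y] by (simp add: ennreal_mult')
        then show ?thesis by (rule add_increasing[rotated]) simp
      qed
    qed simp
    have "(\<integral>\<^sup>+y. ennreal (k x y) * ennreal (\<delta> y powr - b) * indicator \<Omega> y \<partial>lborel)
      \<le> (\<integral>\<^sup>+y. ennreal (2 powr \<bar>b\<bar> * \<delta> x powr - b) * ?near y + ennreal (\<delta> x powr \<gamma>) * ?far y \<partial>lborel)"
      by (intro nn_integral_mono le)
    also have "\<dots> = ennreal (2 powr \<bar>b\<bar> * \<delta> x powr - b) * (\<integral>\<^sup>+y. ?near y \<partial>lborel) + ennreal (\<delta> x powr \<gamma>) * (\<integral>\<^sup>+y. ?far y \<partial>lborel)"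
      by (subst nn_integral_add, simp, simp, subst nn_integral_cmult, simp, subst nn_integral_cmult) simp_all
    also have "\<dots> \<le> ennreal (2 powr \<bar>b\<bar> * \<delta> x powr - b) * ennreal (C2 * \<delta> x powr (2 * s))
       + ennreal (\<delta> x powr \<gamma>) * (ennreal (C1 * D powr (2 * s - \<gamma> - b)) + ennreal (C1 * p) * ?J)"
    proof (intro add_mono mult_left_mono)
      have "(\<integral>\<^sup>+y. ?near y \<partial>lborel) \<le> ennreal (C2 * (\<delta> x / 2) powr (2 * s))"
        using riesz_potential_cball[of "real DIM('a) - 2 * s" "\<delta> x / 2" x] s_dim s_pos dx by (simp add: C2_def)
      also have "\<dots> \<le> ennreal (C2 * \<delta> x powr (2 * s))"
        using dx C2 s_pos by (intro ennreal_leI mult_left_mono powr_mono2) auto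
      finally show "(\<integral>\<^sup>+y. ?near y \<partial>lborel) \<le> ennreal (C2 * \<delta> x powr (2 * s))" .
      have "(\<integral>\<^sup>+y. ?far y \<partial>lborel) \<le> ennreal (C1 * D powr (real DIM('a) - (b - \<gamma>) - p)) +
         ennreal (C1 * p) * (\<integral>\<^sup>+r. ennreal (r powr (real DIM('a) - (b - \<gamma>) - p - 1)) * indicator {\<delta> x / 2..D} r \<partial>lborel)"
        using p C1 x D_pos bdist_le_D[OF x] dx by (intro layer_cake) (auto simp: mult.assoc)
      moreover have "real DIM('a) - (b - \<gamma>) - p = 2 * s - \<gamma> - b"
        by (simp add: p_def)
      ultimately show "(\<integral>\<^sup>+y. ?far y \<partial>lborel) \<le> ennreal (C1 * D powr (2 * s - \<gamma> - b)) + ennreal (C1 * p) * ?J"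
        by simp
    qed auto
    also have "ennreal (2 powr \<bar>b\<bar> * \<delta> x powr - b) * ennreal (C2 * \<delta> x powr (2 * s)) = ennreal (2 powr \<bar>b\<bar> * C2 * \<delta> x powr (2 * s - b))"
      using dx C2 by (simp add: ennreal_mult'[symmetric] powr_diff powr_minus divide_simps mult_ac)
    also have "\<dots> + ennreal (\<delta> x powr \<gamma>) * (ennreal (C1 * D powr (2 * s - \<gamma> - b)) + ennreal (C1 * p) * ?J)
      \<le> ennreal (C * \<delta> x powr (2 * s - b)) + (ennreal (C * \<delta> x powr \<gamma>) + ennreal (C * \<delta> x powr \<gamma>) * ?J)"
    proof -
      have "2 powr \<bar>b\<bar> * C2 \<le> C" "C1 * D powr (2 * s - \<gamma> - b) \<le> C" "C1 * p \<le> C"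
        using C1 C2 p by (auto simp: C_def)
      then have "2 powr \<bar>b\<bar> * C2 * \<delta> x powr (2 * s - b) \<le> C * \<delta> x powr (2 * s - b)"
        "C1 * D powr (2 * s - \<gamma> - b) * \<delta> x powr \<gamma> \<le> C * \<delta> x powr \<gamma>"
        "C1 * p * \<delta> x powr \<gamma> \<le> C * \<delta> x powr \<gamma>"
        by (simp_all add: mult_right_mono)
      moreover have "ennreal (\<delta> x powr \<gamma>) * ennreal a = ennreal (a * \<delta> x powr \<gamma>)" for a
        by (simp add: ennreal_mult'' mult.commute)
      ultimately show ?thesis
        unfolding distrib_left mult.assoc[symmetric]
        by (intro add_mono mult_right_mono) (simp_all only: ennreal_leI zero_le)
    qed
    also have "\<dots> = ennreal C * (ennreal (\<delta> x powr (2 * s - b) + \<delta> x powr \<gamma>) + ennreal (\<delta> x powr \<gamma>) * ?J)"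
      using C by (simp add: ennreal_mult' distrib_left ennreal_plus mult_ac add_ac)
    finally show ?thesis .
  qed
  then show thesis using that C by blast
qed

section \<open>Potentials of powers of the boundary distance\<close>

definition pot :: "('a \<Rightarrow> ennreal) \<Rightarrow> 'a \<Rightarrow> ennreal" where
  "pot f x = (\<integral>\<^sup>+y. ennreal (k x y) * f y * indicator \<Omega> y \<partial>lborel)"

text \<open>Factoring out \<delta>(x)^\<gamma> leaves terms governed by the single exponent
  \<open>\<eta>\<close>; \<open>j\<close> is any finite bound of the radial integral, supplied
  separately for each sign of \<open>\<eta>\<close>.\<close>

lemma pot_bound:
  assumes b: "b < 1 + \<gamma>" and \<eta>: "\<eta> = 2 * s - \<gamma> - b"
  obtains C where "C > 0" "\<And>x j. x \<in> \<Omega> \<Longrightarrow> 0 \<le> j \<Longrightarrow>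
    (\<integral>\<^sup>+r. ennreal (r powr (\<eta> - 1)) * indicator {\<delta> x / 2..D} r \<partial>lborel) \<le> ennreal j \<Longrightarrow>
    pot (\<lambda>y. ennreal (\<delta> y powr - b)) x \<le> ennreal (C * \<delta> x powr \<gamma> * (\<delta> x powr \<eta> + 1 + j))"
proof -
  obtain C where C: "C > 0" "\<And>x. x \<in> \<Omega> \<Longrightarrow>
    pot (\<lambda>y. ennreal (\<delta> y powr - b)) x
    \<le> ennreal C * (ennreal (\<delta> x powr (2 * s - b) + \<delta> x powr \<gamma>) + ennreal (\<delta> x powr \<gamma>) *
       (\<integral>\<^sup>+r. ennreal (r powr (\<eta> - 1)) * indicator {\<delta> x / 2..D} r \<partial>lborel))"
    unfolding pot_def \<eta> by (rule potential_bound[OF b]) (rule that[unfolded pot_def \<eta>])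
  show thesis
  proof (rule that[OF C(1)])
    fix x j
    assume x: "x \<in> \<Omega>" and j: "0 \<le> j"
      "(\<integral>\<^sup>+r. ennreal (r powr (\<eta> - 1)) * indicator {\<delta> x / 2..D} r \<partial>lborel) \<le> ennreal j"
    have "pot (\<lambda>y. ennreal (\<delta> y powr - b)) x
      \<le> ennreal C * (ennreal (\<delta> x powr (2 * s - b) + \<delta> x powr \<gamma>) + ennreal (\<delta> x powr \<gamma>) * ennreal j)"
      using j by (intro order_trans[OF C(2)[OF x]] mult_left_mono add_left_mono) auto
    also have "\<dots> = ennreal (C * (\<delta> x powr (2 * s - b) + \<delta> x powr \<gamma> + \<delta> x powr \<gamma> * j))"
      using j C by (simp add: ennreal_mult' ennreal_plus)
    also have "\<delta> x powr (2 * s - b) = \<delta> x powr \<gamma> * \<delta> x powr \<eta>"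
      by (simp add: powr_add[symmetric] \<eta>)
    finally show "pot (\<lambda>y. ennreal (\<delta> y powr - b)) x \<le> ennreal (C * \<delta> x powr \<gamma> * (\<delta> x powr \<eta> + 1 + j))"
      by (simp add: algebra_simps)
  qed
qed

text \<open>Here \<open>\<eta> > 0\<close>, so the radial integral converges at 0 and is bounded
  independently of \<open>x\<close>.\<close>

lemma pot_subcritical:
  assumes "b < 1 + \<gamma>" "b < 2 * s - \<gamma>"
  obtains C where "C > 0" "\<And>x. x \<in> \<Omega> \<Longrightarrow> pot (\<lambda>y. ennreal (\<delta> y powr - b)) x \<le> ennreal (C * \<delta> x powr \<gamma>)"
proof -
  define \<eta> where "\<eta> = 2 * s - \<gamma> - b"
  have \<eta>: "\<eta> > 0" using assms by (simp add: \<eta>_def)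
  obtain C where C: "C > 0" "\<And>x j. x \<in> \<Omega> \<Longrightarrow> 0 \<le> j \<Longrightarrow>
    (\<integral>\<^sup>+r. ennreal (r powr (\<eta> - 1)) * indicator {\<delta> x / 2..D} r \<partial>lborel) \<le> ennreal j \<Longrightarrow>
    pot (\<lambda>y. ennreal (\<delta> y powr - b)) x \<le> ennreal (C * \<delta> x powr \<gamma> * (\<delta> x powr \<eta> + 1 + j))"
    by (rule pot_bound[OF assms(1) \<eta>_def]) (rule that)
  show thesis
  proof (rule that)
    show "C * (D powr \<eta> + 1 + D powr \<eta> / \<eta>) > 0" using C \<eta> by (simp add: add_nonneg_pos add_pos_nonneg)
    fix x assume x: "x \<in> \<Omega>"
    have "(\<integral>\<^sup>+r. ennreal (r powr (\<eta> - 1)) * indicator {\<delta> x / 2..D} r \<partial>lborel)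
      \<le> (\<integral>\<^sup>+r. ennreal (r powr (\<eta> - 1)) * indicator {0..D} r \<partial>lborel)"
    proof (intro nn_integral_mono mult_left_mono)
      show "indicator {\<delta> x / 2..D} r \<le> (indicator {0..D} r :: ennreal)" for r
        using bdist_pos[OF x] by (intro indicator_leI) auto
    qed simp
    also have "\<dots> = ennreal (D powr \<eta> / \<eta>)"
      using \<eta> D_pos by (intro nn_integral_powr_0) auto
    finally have "pot (\<lambda>y. ennreal (\<delta> y powr - b)) x \<le> ennreal (C * \<delta> x powr \<gamma> * (\<delta> x powr \<eta> + 1 + D powr \<eta> / \<eta>))"
      using \<eta> by (intro C x) auto
    also have "\<dots> \<le> ennreal (C * \<delta> x powr \<gamma> * (D powr \<eta> + 1 + D powr \<eta> / \<eta>))"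
      using C \<eta> bdist_le_D[OF x] bdist_pos[OF x]
      by (intro ennreal_leI mult_left_mono add_mono powr_mono2) auto
    finally show "pot (\<lambda>y. ennreal (\<delta> y powr - b)) x \<le> ennreal (C * (D powr \<eta> + 1 + D powr \<eta> / \<eta>) * \<delta> x powr \<gamma>)"
      by (simp add: mult_ac)
  qed
qed

text \<open>The case \<open>\<eta> = 0\<close>, in which the radial integral is a logarithm. The
  hypothesis is the condition \<open>b < 1 + \<gamma>\<close> for
  \<open>b = 2 * s - \<gamma>\<close>.\<close>

lemma pot_critical:
  assumes "s - 1 / 2 < \<gamma>"
  obtains C where "C > 0" "\<And>x. x \<in> \<Omega> \<Longrightarrow>
    pot (\<lambda>y. ennreal (\<delta> y powr - (2 * s - \<gamma>))) x \<le> ennreal (C * (\<delta> x powr \<gamma> * ln (D / \<delta> x)))"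
proof -
  obtain C where C: "C > 0" "\<And>x j. x \<in> \<Omega> \<Longrightarrow> 0 \<le> j \<Longrightarrow>
    (\<integral>\<^sup>+r. ennreal (r powr (0 - 1)) * indicator {\<delta> x / 2..D} r \<partial>lborel) \<le> ennreal j \<Longrightarrow>
    pot (\<lambda>y. ennreal (\<delta> y powr - (2 * s - \<gamma>))) x \<le> ennreal (C * \<delta> x powr \<gamma> * (\<delta> x powr 0 + 1 + j))"
    by (rule pot_bound[of "2 * s - \<gamma>" 0]) (use assms in auto)
  show thesis
  proof (rule that)
    show "4 * C > 0" using C by simp
    fix x assume x: "x \<in> \<Omega>"
    let ?l = "ln (D / \<delta> x)"
    have dx: "0 < \<delta> x" "4 * \<delta> x \<le> D" using bdist_pos bdist_le_D x by auto
    have l: "1 \<le> ?l" using x by (rule ln_D_ge_1)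
    \<comment> \<open>The factor 2 is absorbed by squaring, since \<open>D / \<delta> x\<close> is
      at least 4.\<close>
    have "ln (D / (\<delta> x / 2)) \<le> ln ((D / \<delta> x) * (D / \<delta> x))"
      using dx by (intro ln_mono) (auto simp: divide_simps)
    also have "\<dots> = 2 * ?l" using dx by (subst ln_mult) auto
    finally have "(\<integral>\<^sup>+r. ennreal (r powr (0 - 1)) * indicator {\<delta> x / 2..D} r \<partial>lborel) \<le> ennreal (2 * ?l)"
      using dx nn_integral_inverse_Icc[of "\<delta> x / 2" D] by (simp add: ennreal_leI)
    then have "pot (\<lambda>y. ennreal (\<delta> y powr - (2 * s - \<gamma>))) x \<le> ennreal (C * \<delta> x powr \<gamma> * (\<delta> x powr 0 + 1 + 2 * ?l))"
      using l by (intro C x) auto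
    also have "\<dots> \<le> ennreal (C * \<delta> x powr \<gamma> * (4 * ?l))"
      using C l dx by (intro ennreal_leI mult_left_mono) auto
    finally show "pot (\<lambda>y. ennreal (\<delta> y powr - (2 * s - \<gamma>))) x \<le> ennreal (4 * C * (\<delta> x powr \<gamma> * ?l))"
      by (simp add: mult_ac)
  qed
qed

text \<open>Here \<open>\<eta> < 0\<close>: the radial integral is dominated by its lower limit, of
  order \<delta>(x)^\<eta>, and \<gamma> + \<eta> = 2s - b.\<close>

lemma pot_supercritical:
  assumes "b < 1 + \<gamma>" "2 * s - \<gamma> < b"
  obtains C where "C > 0" "\<And>x. x \<in> \<Omega> \<Longrightarrow> pot (\<lambda>y. ennreal (\<delta> y powr - b)) x \<le> ennreal (C * \<delta> x powr (2 * s - b))"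
proof -
  define \<eta> where "\<eta> = 2 * s - \<gamma> - b"
  have \<eta>: "\<eta> < 0" using assms by (simp add: \<eta>_def)
  obtain C where C: "C > 0" "\<And>x j. x \<in> \<Omega> \<Longrightarrow> 0 \<le> j \<Longrightarrow>
    (\<integral>\<^sup>+r. ennreal (r powr (\<eta> - 1)) * indicator {\<delta> x / 2..D} r \<partial>lborel) \<le> ennreal j \<Longrightarrow>
    pot (\<lambda>y. ennreal (\<delta> y powr - b)) x \<le> ennreal (C * \<delta> x powr \<gamma> * (\<delta> x powr \<eta> + 1 + j))"
    by (rule pot_bound[OF assms(1) \<eta>_def]) (rule that)
  \<comment> \<open>The three summands bound \<delta>^\<eta>, the constant 1 and the radial integral
    by multiples of \<delta>^\<eta>; for the constant, \<delta>^(-\<eta>) is at most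
    D^(-\<eta>).\<close>
  define B where "B = 1 + D powr - \<eta> + 2 powr - \<eta> / (- \<eta>)"
  have "0 \<le> 2 powr - \<eta> / (- \<eta>)" using \<eta> by (intro divide_nonneg_pos) auto
  then have B: "B > 0" unfolding B_def by (intro add_pos_nonneg) auto
  show thesis
  proof (rule that)
    show "C * B > 0" using B C by simp
    fix x assume x: "x \<in> \<Omega>"
    have dx: "0 < \<delta> x" "4 * \<delta> x \<le> D" using bdist_pos bdist_le_D x by auto
    have half: "(\<delta> x / 2) powr \<eta> = 2 powr - \<eta> * \<delta> x powr \<eta>"
      using dx by (simp add: powr_divide powr_minus divide_simps)
    have "(\<integral>\<^sup>+r. ennreal (r powr (\<eta> - 1)) * indicator {\<delta> x / 2..D} r \<partial>lborel) = ennreal ((D powr \<eta> - (\<delta> x / 2) powr \<eta>) / \<eta>)"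
      using \<eta> dx by (intro nn_integral_powr_Icc) auto
    also have "\<dots> \<le> ennreal (2 powr - \<eta> / (- \<eta>) * \<delta> x powr \<eta>)"
      unfolding half using \<eta> by (intro ennreal_leI) (simp add: divide_simps)
    finally have "pot (\<lambda>y. ennreal (\<delta> y powr - b)) x \<le> ennreal (C * \<delta> x powr \<gamma> * (\<delta> x powr \<eta> + 1 + 2 powr - \<eta> / (- \<eta>) * \<delta> x powr \<eta>))"
      using \<eta> by (intro C x) (auto simp: divide_nonneg_neg divide_nonpos_neg intro!: mult_nonpos_nonneg)
    also have "\<dots> \<le> ennreal (C * \<delta> x powr \<gamma> * (B * \<delta> x powr \<eta>))"
    proof (intro ennreal_leI mult_left_mono)
      have "\<delta> x powr - \<eta> \<le> D powr - \<eta>" using \<eta> dx by (intro powr_mono2) auto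
      then have "1 \<le> D powr - \<eta> * \<delta> x powr \<eta>" using dx by (simp add: powr_minus[of "\<delta> x"] divide_simps mult.commute)
      then show "\<delta> x powr \<eta> + 1 + 2 powr - \<eta> / (- \<eta>) * \<delta> x powr \<eta> \<le> B * \<delta> x powr \<eta>"
        by (simp add: B_def algebra_simps)
    qed (use C in auto)
    also have "C * \<delta> x powr \<gamma> * (B * \<delta> x powr \<eta>) = C * B * (\<delta> x powr \<gamma> * \<delta> x powr \<eta>)" by simp
    also have "\<delta> x powr \<gamma> * \<delta> x powr \<eta> = \<delta> x powr (2 * s - b)"
      by (simp add: powr_add[symmetric] \<eta>_def)
    finally show "pot (\<lambda>y. ennreal (\<delta> y powr - b)) x \<le> ennreal (C * B * \<delta> x powr (2 * s - b))" .
  qed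
qed

section \<open>Pointwise comparison of kernel values\<close>

lemma k_commute: "k x y = k y x"
  by (simp add: green_bound_def norm_minus_commute mult_ac)

text \<open>As min(a / r, 1) = a / max(a, r), the dependence on |x - y| becomes a product of
  decreasing functions, so kernel values can be compared factor by factor.\<close>

lemma k_eq_max:
  assumes "x \<noteq> y"
  shows "k x y = \<delta> x powr \<gamma> * \<delta> y powr \<gamma> * norm (x - y) powr - (real DIM('a) - 2 * s) *
    max (\<delta> x) (norm (x - y)) powr - \<gamma> * max (\<delta> y) (norm (x - y)) powr - \<gamma>"
proof -
  let ?r = "norm (x - y)"
  have r: "?r > 0" using assms by simp
  have "min (\<delta> z / ?r) 1 powr \<gamma> = \<delta> z powr \<gamma> * max (\<delta> z) ?r powr - \<gamma>" for z
  proof -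
    have "min (\<delta> z / ?r) 1 = \<delta> z / max (\<delta> z) ?r"
      using r by (auto simp: min_def max_def divide_simps)
    then show ?thesis using r by (simp add: powr_divide powr_minus_divide le_max_iff_disj)
  qed
  then show ?thesis
    unfolding green_bound_def powr_minus_divide[symmetric] by simp
qed

text \<open>In the form of \<open>k_eq_max\<close> the factors other than the weights are negative
  powers of quantities at most \<open>R\<close>, and their exponents add up.\<close>

lemma k_ge:
  assumes xy: "x \<noteq> y" and R: "norm (x - y) \<le> R" "\<delta> x \<le> R" "\<delta> y \<le> R"
  shows "R powr - (real DIM('a) - 2 * s + 2 * \<gamma>) * \<delta> x powr \<gamma> * \<delta> y powr \<gamma> \<le> k x y"
proof -
  let ?r = "norm (x - y)"
  have r: "?r > 0" using xy by simp
  have "R powr - (real DIM('a) - 2 * s + 2 * \<gamma>) = R powr - (real DIM('a) - 2 * s) * R powr - \<gamma> * R powr - \<gamma>"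
    by (simp add: powr_add[symmetric] algebra_simps)
  also have "\<dots> \<le> ?r powr - (real DIM('a) - 2 * s) * max (\<delta> x) ?r powr - \<gamma> * max (\<delta> y) ?r powr - \<gamma>"
    using r R s_dim \<gamma>_pos by (intro mult_mono powr_mono2') (auto simp: less_max_iff_disj)
  finally have "R powr - (real DIM('a) - 2 * s + 2 * \<gamma>) * (\<delta> x powr \<gamma> * \<delta> y powr \<gamma>)
      \<le> (?r powr - (real DIM('a) - 2 * s) * max (\<delta> x) ?r powr - \<gamma> * max (\<delta> y) ?r powr - \<gamma>) * (\<delta> x powr \<gamma> * \<delta> y powr \<gamma>)"
    by (rule mult_right_mono) simp
  then show ?thesis
    unfolding k_eq_max[OF xy] by (simp add: mult_ac)
qed

text \<open>So close to \<open>x\<close> both maxima in \<open>k_eq_max\<close> are the boundary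
  distances and cancel against the weights.\<close>

lemma k_near:
  assumes "x \<in> \<Omega>" "x \<noteq> y" "norm (x - y) \<le> \<delta> x / 2"
  shows "k x y = norm (x - y) powr - (real DIM('a) - 2 * s)"
proof -
  let ?r = "norm (x - y)"
  have dx: "0 < \<delta> x" using bdist_pos assms by blast
  have "\<delta> x \<le> \<delta> y + ?r" by (rule bdist_le_add_dist)
  then have dy: "0 < \<delta> y" "?r \<le> \<delta> y" using assms dx by linarith+
  have "max (\<delta> x) ?r = \<delta> x" "max (\<delta> y) ?r = \<delta> y" using assms dx dy by auto
  then show ?thesis
    unfolding k_eq_max[OF assms(2)] using dx dy by (simp add: powr_minus divide_simps)
qed

text \<open>This is the quasi-metric property of the kernel divided by \<delta>(x)^\<gamma>
  \<delta>(y)^\<gamma>: passing from \<open>x\<close> to \<open>x'\<close> enlarges the distance to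
  \<open>y\<close> and both maxima of \<open>k_eq_max\<close> by at most the factor
  \<open>l\<close>, and the exponents add up. The weights are cross-multiplied to avoid
  division.\<close>

lemma k_compare:
  assumes xy: "x \<noteq> y" "x' \<noteq> y" and l: "1 \<le> l"
    and r: "norm (x' - y) \<le> l * norm (x - y)" "\<delta> x' \<le> l * max (\<delta> x) (norm (x - y))"
  shows "k x y * \<delta> x' powr \<gamma> \<le> l powr (real DIM('a) - 2 * s + 2 * \<gamma>) * k x' y * \<delta> x powr \<gamma>"
proof -
  let ?r = "norm (x - y)" and ?r' = "norm (x' - y)" and ?n = "real DIM('a) - 2 * s"
  have pos: "?r > 0" "?r' > 0" using xy by auto
  have *: "a powr - e \<le> l powr e * a' powr - e" if "0 < a'" "0 < a" "a' \<le> l * a" "0 \<le> e" for a a' e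
  proof -
    have "(l * a) powr - e \<le> a' powr - e" using that by (intro powr_mono2') auto
    then have "l powr e * (l powr - e * a powr - e) \<le> l powr e * a' powr - e"
      using that l by (intro mult_left_mono) (auto simp: powr_mult)
    moreover have "l powr e * l powr - e = 1" using l by (simp add: powr_minus)
    ultimately show ?thesis by (simp add: mult.assoc[symmetric])
  qed
  have "?r \<le> l * ?r" using l mult_right_mono[of 1 l ?r] by simp
  have m: "max (\<delta> x') ?r' \<le> l * max (\<delta> x) ?r" "max (\<delta> y) ?r' \<le> l * max (\<delta> y) ?r"
  proof -
    have "l * ?r \<le> l * max (\<delta> x) ?r" "l * ?r \<le> l * max (\<delta> y) ?r" "l * \<delta> y \<le> l * max (\<delta> y) ?r" "\<delta> y \<le> l * \<delta> y"
      using l mult_right_mono[of 1 l "\<delta> y"] by auto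
    then show "max (\<delta> x') ?r' \<le> l * max (\<delta> x) ?r" "max (\<delta> y) ?r' \<le> l * max (\<delta> y) ?r"
      using r by auto
  qed
  have "?r powr - ?n * max (\<delta> x) ?r powr - \<gamma> * max (\<delta> y) ?r powr - \<gamma>
    \<le> (l powr ?n * ?r' powr - ?n) * (l powr \<gamma> * max (\<delta> x') ?r' powr - \<gamma>) * (l powr \<gamma> * max (\<delta> y) ?r' powr - \<gamma>)"
    using pos r m s_dim \<gamma>_pos by (intro mult_mono *) (auto simp: less_max_iff_disj)
  also have "\<dots> = (l powr ?n * l powr \<gamma> * l powr \<gamma>) * (?r' powr - ?n * max (\<delta> x') ?r' powr - \<gamma> * max (\<delta> y) ?r' powr - \<gamma>)"
    by (simp only: mult_ac)
  also have "l powr ?n * l powr \<gamma> * l powr \<gamma> = l powr (?n + 2 * \<gamma>)"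
    by (simp add: powr_add[symmetric] algebra_simps)
  finally have "(?r powr - ?n * max (\<delta> x) ?r powr - \<gamma> * max (\<delta> y) ?r powr - \<gamma>) * (\<delta> x powr \<gamma> * \<delta> y powr \<gamma> * \<delta> x' powr \<gamma>)
    \<le> l powr (?n + 2 * \<gamma>) * (?r' powr - ?n * max (\<delta> x') ?r' powr - \<gamma> * max (\<delta> y) ?r' powr - \<gamma>) * (\<delta> x powr \<gamma> * \<delta> y powr \<gamma> * \<delta> x' powr \<gamma>)"
    by (rule mult_right_mono) simp
  then show ?thesis
    unfolding k_eq_max[OF xy(1)] k_eq_max[OF xy(2)] by (simp only: mult_ac)
qed

lemma k_measurable_snd [measurable]: "k x \<in> borel_measurable borel"
  unfolding green_bound_def by measurable

text \<open>If \<open>y\<close> is within \<delta>(x) / 2 of \<open>x\<close>, the Riesz kernel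
  integrates to order \<delta>(x)^(2s), and \<open>k x y\<close> is at least \<delta>(x)^(-(N-2s)).
  If \<open>y\<close> is farther away, \<open>k_compare\<close> with \<open>l = 2\<close> bounds
  \<open>k z y\<close> by a multiple of \<open>k x y\<close> on the whole ball.\<close>

lemma k_mean_le:
  obtains C where "C > 0" "\<And>x y. x \<in> \<Omega> \<Longrightarrow> y \<in> \<Omega> \<Longrightarrow> y \<noteq> x \<Longrightarrow>
    (\<integral>\<^sup>+z. ennreal (k z y) * indicator (cball x (\<delta> x / 4)) z \<partial>lborel) \<le> ennreal (C * \<delta> x powr real DIM('a) * k x y)"
proof -
  let ?n = "real DIM('a) - 2 * s" and ?V = "unit_ball_vol (real DIM('a))"
  define C1 where "C1 = 2 powr (?n + 2 * \<gamma>) * 2 powr \<gamma> * ?V"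
  define C2 where "C2 = ?V * (1 + ?n / (2 * s))"
  have C: "C1 > 0" "C2 > 0" using s_dim s_pos by (auto simp: C1_def C2_def intro!: mult_pos_pos add_pos_nonneg)
  show thesis
  proof (rule that)
    show "C1 + C2 > 0" using C by simp
    fix x y assume x: "x \<in> \<Omega>" and y: "y \<in> \<Omega>" "y \<noteq> x"
    have dx: "0 < \<delta> x" using bdist_pos x by blast
    have "(\<integral>\<^sup>+z. ennreal (k z y) * indicator (cball x (\<delta> x / 4)) z \<partial>lborel) \<le> ennreal ((if norm (x - y) \<le> \<delta> x / 2 then C2 else C1) * \<delta> x powr real DIM('a) * k x y)"
    proof (cases "norm (x - y) \<le> \<delta> x / 2")
      case True
      \<comment> \<open>Recentring at the pole \<open>y\<close>: the ball around \<open>x\<close>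
        lies in \<open>cball y (\<delta> x)\<close>, as 1/4 + 1/2 < 1.\<close>
      have "(\<integral>\<^sup>+z. ennreal (k z y) * indicator (cball x (\<delta> x / 4)) z \<partial>lborel)
        \<le> (\<integral>\<^sup>+z. ennreal (norm (y - z) powr - ?n) * indicator (cball y (\<delta> x)) z \<partial>lborel)"
      proof (intro nn_integral_mono mult_mono ennreal_leI)
        fix z
        show "k z y \<le> norm (y - z) powr - ?n"
          using k_le_riesz[of z y] by (simp add: norm_minus_commute)
        have "dist y z \<le> \<delta> x" if "dist x z \<le> \<delta> x / 4"
          using that True dist_triangle[of y z x] dx by (simp add: dist_norm norm_minus_commute)
        then show "indicator (cball x (\<delta> x / 4)) z \<le> (indicator (cball y (\<delta> x)) z :: ennreal)"
          by (auto simp: indicator_def)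
      qed auto
      also have "\<dots> \<le> ennreal (C2 * \<delta> x powr (2 * s))"
        using riesz_potential_cball[of ?n "\<delta> x" y] s_dim s_pos dx by (simp add: C2_def)
      also have "\<dots> \<le> ennreal (C2 * \<delta> x powr real DIM('a) * k x y)"
      proof (intro ennreal_leI)
        have "\<delta> x powr - ?n \<le> norm (x - y) powr - ?n"
          using True y s_dim dx by (intro powr_mono2') auto
        then have "\<delta> x powr - ?n \<le> k x y" using k_near[OF x _ True] y by simp
        then have "C2 * \<delta> x powr real DIM('a) * \<delta> x powr - ?n \<le> C2 * \<delta> x powr real DIM('a) * k x y"
          using C by (intro mult_left_mono) auto
        moreover have "\<delta> x powr real DIM('a) * \<delta> x powr - ?n = \<delta> x powr (2 * s)"
          by (simp add: powr_add[symmetric])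
        ultimately show "C2 * \<delta> x powr (2 * s) \<le> C2 * \<delta> x powr real DIM('a) * k x y"
          by (simp add: mult.assoc)
      qed
      finally show ?thesis using True by simp
    next
      case False
      have le: "k z y \<le> 2 powr (?n + 2 * \<gamma>) * 2 powr \<gamma> * k x y" if "z \<in> cball x (\<delta> x / 4)" for z
      proof -
        have z: "norm (x - z) \<le> \<delta> x / 4" using that by (simp add: dist_norm)
        have zy: "norm (x - y) \<le> 2 * norm (z - y)"
          using norm_triangle_ineq[of "x - z" "z - y"] z False by simp
        then have "z \<noteq> y" using False dx by auto
        have dz: "\<delta> x \<le> 2 * \<delta> z" "\<delta> z \<le> 2 * \<delta> x" "0 < \<delta> z"
          using bdist_le_add_dist[of x z] bdist_le_add_dist[of z x] z dx by (auto simp: norm_minus_commute)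
        have "k z y * \<delta> x powr \<gamma> \<le> 2 powr (?n + 2 * \<gamma>) * k x y * \<delta> z powr \<gamma>"
          using y zy dz \<open>z \<noteq> y\<close> by (intro k_compare) auto
        also have "\<dots> \<le> 2 powr (?n + 2 * \<gamma>) * k x y * (2 powr \<gamma> * \<delta> x powr \<gamma>)"
          using dz \<gamma>_pos by (intro mult_left_mono) (auto simp: powr_mult[symmetric] intro!: powr_mono2)
        finally have "k z y * \<delta> x powr \<gamma> \<le> (2 powr (?n + 2 * \<gamma>) * 2 powr \<gamma> * k x y) * \<delta> x powr \<gamma>"
          by (simp only: mult_ac)
        then show ?thesis using dx by (simp add: mult_le_cancel_right)
      qed
      have "(\<integral>\<^sup>+z. ennreal (k z y) * indicator (cball x (\<delta> x / 4)) z \<partial>lborel)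
        \<le> (\<integral>\<^sup>+z. ennreal (2 powr (?n + 2 * \<gamma>) * 2 powr \<gamma> * k x y) * indicator (cball x (\<delta> x)) z \<partial>lborel)"
        using le dx by (intro nn_integral_mono) (auto simp: indicator_def intro!: ennreal_leI)
      also have "\<dots> = ennreal (2 powr (?n + 2 * \<gamma>) * 2 powr \<gamma> * k x y) * ennreal (?V * \<delta> x powr real DIM('a))"
        using dx by (simp add: nn_integral_cmult_indicator emeasure_cball_powr)
      also have "\<dots> = ennreal (C1 * \<delta> x powr real DIM('a) * k x y)"
        by (simp add: C1_def ennreal_mult'[symmetric] mult_ac)
      finally show ?thesis using False by simp
    qed
    also have "\<dots> \<le> ennreal ((C1 + C2) * \<delta> x powr real DIM('a) * k x y)"
      using C by (intro ennreal_leI mult_right_mono) auto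
    finally show "(\<integral>\<^sup>+z. ennreal (k z y) * indicator (cball x (\<delta> x / 4)) z \<partial>lborel) \<le> ennreal ((C1 + C2) * \<delta> x powr real DIM('a) * k x y)" .
  qed
qed

section \<open>Rules for the potential operator and weak domination\<close>

lemma AE_neq: "AE y in lborel. y \<noteq> (x::'a)"
  by (rule AE_lborel_singleton)

lemma pot_mono_AE:
  assumes "AE y in lborel. y \<in> \<Omega> \<longrightarrow> f y \<le> g y"
  shows "pot f x \<le> pot g x"
  unfolding pot_def by (rule nn_integral_mono_AE) (use assms in eventually_elim, auto simp: indicator_def intro: mult_left_mono)

lemma pot_cmult:
  assumes [measurable]: "f \<in> borel_measurable borel"
  shows "pot (\<lambda>y. c * f y) x = c * pot f x"
  unfolding pot_def by (subst nn_integral_cmult[symmetric]) (auto simp: mult_ac)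

lemma pot_measurable [measurable]:
  assumes [measurable]: "f \<in> borel_measurable borel"
  shows "pot f \<in> borel_measurable borel"
proof -
  have "(\<lambda>x. \<integral>\<^sup>+y. ennreal (k x y) * f y * indicator \<Omega> y \<partial>lborel) \<in> borel_measurable lborel"
    by (rule lborel.borel_measurable_nn_integral) measurable
  then show ?thesis by (simp add: pot_def[abs_def])
qed

lemma pot_add:
  assumes [measurable]: "f \<in> borel_measurable borel" "g \<in> borel_measurable borel"
  shows "pot (\<lambda>y. f y + g y) x = pot f x + pot g x"
  unfolding pot_def by (subst nn_integral_add[symmetric]) (auto simp: distrib_left distrib_right)

text \<open>The weak domination principle of quasi-metric kernels: a point off \<open>E\<close> is compared with an
  almost nearest point of \<open>E\<close>. As \<open>x\<close> may lie in the closure of \<open>E\<close>, the nearest point is taken in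
  the part of \<open>E\<close> outside a small ball around \<open>x\<close>.\<close>
lemma weak_domination:
  assumes [measurable]: "f \<in> borel_measurable borel" "E \<in> sets borel" and E: "E \<subseteq> \<Omega>" and t: "0 \<le> t"
    and le: "\<And>y. y \<in> E \<Longrightarrow> pot (\<lambda>y. f y * indicator E y) y \<le> ennreal (t * \<delta> y powr \<gamma>)" and x: "x \<in> \<Omega>"
  shows "pot (\<lambda>y. f y * indicator E y) x \<le> ennreal (3 powr (real DIM('a) - 2 * s + 2 * \<gamma>) * t * \<delta> x powr \<gamma>)"
proof -
  let ?P = "3 powr (real DIM('a) - 2 * s + 2 * \<gamma>)"
  define En where "En = (\<lambda>n. {y \<in> E. 1 / real (Suc n) \<le> norm (x - y)})"
  define g where "g = (\<lambda>n y. ennreal (k x y) * (f y * indicator (En n) y) * indicator \<Omega> y)"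
  have [measurable]: "En n \<in> sets borel" for n
    unfolding En_def by measurable
  have bound: "(\<integral>\<^sup>+y. g n y \<partial>lborel) \<le> ennreal (?P * t * \<delta> x powr \<gamma>)" for n
  proof (cases "En n = {}")
    case True
    then show ?thesis by (simp add: g_def)
  next
    case False
    let ?\<rho> = "INF y\<in>En n. norm (x - y)"
    have bdd: "bdd_below ((\<lambda>y. norm (x - y)) ` En n)"
      by (rule bdd_belowI[of _ 0]) auto
    have "1 / real (Suc n) \<le> ?\<rho>"
      using False by (intro cINF_greatest) (auto simp: En_def)
    then have "0 < ?\<rho>" by (rule less_le_trans[rotated]) simp
    then have "?\<rho> < 2 * ?\<rho>" by simp
    then obtain x' where x': "x' \<in> En n" "norm (x - x') < 2 * ?\<rho>"
      using cINF_less_iff[OF False bdd] by blast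
    have x'E: "x' \<in> E" "x' \<in> \<Omega>" using x' E by (auto simp: En_def)
    have dx': "0 < \<delta> x'" using bdist_pos x'E by blast
    let ?a = "?P * \<delta> x powr \<gamma> / \<delta> x' powr \<gamma>"
    have kle: "k x y \<le> ?a * k x' y" if y: "y \<in> En n" "y \<noteq> x'" for y
    proof -
      have "0 < 1 / real (Suc n)" by simp
      also have "\<dots> \<le> norm (x - y)" using y by (simp add: En_def)
      finally have "x \<noteq> y" by auto
      have "?\<rho> \<le> norm (x - y)" using y by (intro cINF_lower bdd)
      then have r: "norm (x - x') \<le> 2 * norm (x - y)" using x' by linarith
      have "norm (x' - y) \<le> norm (x - x') + norm (x - y)"
        using norm_triangle_ineq[of "x' - x" "x - y"] by (simp add: norm_minus_commute)
      \<comment> \<open>The constant 3 is 1 + 2: \<open>x'\<close> is at most twice as far from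
        \<open>x\<close> as any \<open>y \<in> En n\<close>.\<close>
      then have r': "norm (x' - y) \<le> 3 * norm (x - y)" using r by linarith
      have "\<delta> x' \<le> 3 * max (\<delta> x) (norm (x - y))"
        using bdist_le_add_dist[of x' x] r by (auto simp: norm_minus_commute max_def)
      then have "k x y * \<delta> x' powr \<gamma> \<le> ?P * k x' y * \<delta> x powr \<gamma>"
        using y \<open>x \<noteq> y\<close> r' by (intro k_compare) auto
      then show ?thesis using dx' by (simp add: divide_simps mult_ac)
    qed
    have "(\<integral>\<^sup>+y. g n y \<partial>lborel) \<le> (\<integral>\<^sup>+y. ennreal ?a * (ennreal (k x' y) * (f y * indicator E y) * indicator \<Omega> y) \<partial>lborel)"
    proof (rule nn_integral_mono_AE, use AE_neq[of x'] in eventually_elim)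
      fix y assume "y \<noteq> x'"
      show "g n y \<le> ennreal ?a * (ennreal (k x' y) * (f y * indicator E y) * indicator \<Omega> y)"
      proof (cases "y \<in> En n")
        case True
        then have "ennreal (k x y) \<le> ennreal ?a * ennreal (k x' y)"
          using kle \<open>y \<noteq> x'\<close> by (simp add: ennreal_mult'[symmetric] ennreal_leI)
        moreover have "y \<in> E" using True by (simp add: En_def)
        ultimately show ?thesis
          by (simp add: g_def True mult.assoc[symmetric] mult_right_mono)
      qed (simp add: g_def)
    qed
    also have "\<dots> = ennreal ?a * pot (\<lambda>y. f y * indicator E y) x'"
      unfolding pot_def by (rule nn_integral_cmult) measurable
    also have "\<dots> \<le> ennreal ?a * ennreal (t * \<delta> x' powr \<gamma>)"
      by (intro mult_left_mono le x'E) simp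
    also have "\<dots> = ennreal (?a * (t * \<delta> x' powr \<gamma>))"
      by (rule ennreal_mult'[symmetric]) simp
    also have "?a * (t * \<delta> x' powr \<gamma>) = ?P * t * \<delta> x powr \<gamma>"
      using dx' by simp
    finally show ?thesis .
  qed
  \<comment> \<open>Monotone convergence in \<open>n\<close> recovers all of \<open>E\<close> except
    possibly the point \<open>x\<close>, a null set.\<close>
  have "pot (\<lambda>y. f y * indicator E y) x \<le> (\<integral>\<^sup>+y. (SUP n. g n y) \<partial>lborel)"
    unfolding pot_def
  proof (rule nn_integral_mono_AE, use AE_neq[of x] in eventually_elim)
    fix y assume "y \<noteq> x"
    then obtain n where "1 / real (Suc n) < norm (x - y)"
      using nat_approx_posE[of "norm (x - y)"] by auto
    then have "ennreal (k x y) * (f y * indicator E y) * indicator \<Omega> y = g n y"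
      by (auto simp: g_def En_def indicator_def)
    then show "ennreal (k x y) * (f y * indicator E y) * indicator \<Omega> y \<le> (SUP n. g n y)"
      by (simp only:) (rule SUP_upper, rule UNIV_I)
  qed
  also have "\<dots> = (SUP n. \<integral>\<^sup>+y. g n y \<partial>lborel)"
  proof (rule nn_integral_monotone_convergence_SUP)
    show "incseq g"
    proof (intro incseq_SucI le_funI)
      fix n y
      have "1 / real (Suc (Suc n)) \<le> 1 / real (Suc n)" by (simp add: divide_simps)
      then have "En n \<subseteq> En (Suc n)" by (auto simp: En_def)
      then have "indicator (En n) y \<le> (indicator (En (Suc n)) y :: ennreal)"
        by (intro indicator_leI) auto
      then show "g n y \<le> g (Suc n) y"
        unfolding g_def by (intro mult_right_mono mult_left_mono) auto
    qed
  qed (simp add: g_def)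
  also have "\<dots> \<le> ennreal (?P * t * \<delta> x powr \<gamma>)"
    by (intro SUP_least bound)
  finally show ?thesis .
qed

section \<open>Logarithmic lower bound for critical potentials\<close>

text \<open>On the small ball |x - y| is at most 2t and \<open>\<delta> y\<close> is comparable to
  \<open>t\<close>, so the integrand is at least of order \<delta>(x)^\<gamma> t^(-p)
  t^(2\<gamma>-2s) with p = N - 2s + 2\<gamma>, that is \<delta>(x)^\<gamma> t^(-N). The volume of
  the ball cancels the power of \<open>t\<close>, so every scale contributes the same
  amount.\<close>

lemma ball_contribution:
  assumes x: "x \<in> \<Omega>" and t: "\<delta> x \<le> t" and w: "norm (x - w) \<le> t" and c: "0 < c" "c \<le> 1" "c * t \<le> \<delta> w"
  shows "ennreal (3 powr - (real DIM('a) - 2 * s + 2 * \<gamma>) * (4 / c) powr - \<bar>2 * \<gamma> - 2 * s\<bar> *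
      unit_ball_vol (real DIM('a)) * (c / 4) powr real DIM('a) * \<delta> x powr \<gamma>)
    \<le> (\<integral>\<^sup>+y. ennreal (k x y) * ennreal (\<delta> y powr - (2 * s - \<gamma>)) * indicator (cball w (c * t / 4)) y \<partial>lborel)"
proof -
  let ?N = "real DIM('a)" and ?V = "unit_ball_vol (real DIM('a))"
  define p where "p = ?N - 2 * s + 2 * \<gamma>"
  \<comment> \<open>The exponent of \<open>\<delta> y\<close> that results from the weight of the
    kernel and the density together.\<close>
  define a where "a = 2 * \<gamma> - 2 * s"
  have dx: "0 < \<delta> x" using bdist_pos x by blast
  then have tp: "0 < t" using t by simp
  let ?b = "3 powr - p * (4 / c) powr - \<bar>a\<bar> * \<delta> x powr \<gamma> * t powr - ?N"
  have le: "?b \<le> k x y * \<delta> y powr - (2 * s - \<gamma>)" if y: "y \<in> cball w (c * t / 4)" "y \<noteq> x" for y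
  proof -
    have ct: "0 < c * t" "c * t \<le> t" using c tp by auto
    have wy: "norm (w - y) \<le> c * t / 4" using y by (simp add: dist_norm)
    then have "norm (x - y) \<le> t + c * t / 4"
      using w norm_triangle_ineq[of "x - w" "w - y"] by simp
    then have xy: "norm (x - y) \<le> 2 * t" using ct by simp
    have dy: "c * t / 2 \<le> \<delta> y" "\<delta> y \<le> 3 * t"
      using bdist_le_add_dist[of w y] wy c(3) ct bdist_le_add_dist[of y x] xy t by (auto simp: norm_minus_commute)
    then have dy0: "0 < \<delta> y" using ct by linarith
    have "(3 * t) powr - p * \<delta> x powr \<gamma> * \<delta> y powr \<gamma> \<le> k x y"
      unfolding p_def using y xy dy t tp by (intro k_ge) auto
    then have "(3 * t) powr - p * \<delta> x powr \<gamma> * \<delta> y powr \<gamma> * \<delta> y powr - (2 * s - \<gamma>) \<le> k x y * \<delta> y powr - (2 * s - \<gamma>)"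
      by (rule mult_right_mono) simp
    also have "(3 * t) powr - p * \<delta> x powr \<gamma> * \<delta> y powr \<gamma> * \<delta> y powr - (2 * s - \<gamma>) = (3 * t) powr - p * \<delta> x powr \<gamma> * \<delta> y powr a"
      by (simp add: powr_add[symmetric] a_def)
    finally have 1: "(3 * t) powr - p * \<delta> x powr \<gamma> * \<delta> y powr a \<le> k x y * \<delta> y powr - (2 * s - \<gamma>)" .
    have "t powr a \<le> (4 / c) powr \<bar>a\<bar> * \<delta> y powr a"
    proof (rule powr_comparable)
      show "0 < \<delta> y" "1 \<le> 4 / c" using dy0 c by auto
      have "c * \<delta> y \<le> \<delta> y" using c dy0 by simp
      then show "\<delta> y / (4 / c) \<le> t" using dy c tp by (simp add: mult.commute)
      show "t \<le> 4 / c * \<delta> y" using dy c ct by (simp add: divide_simps mult.commute)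
    qed
    then have "(4 / c) powr - \<bar>a\<bar> * t powr a \<le> \<delta> y powr a"
      using c by (simp add: powr_minus divide_simps mult.commute)
    then have "(3 * t) powr - p * \<delta> x powr \<gamma> * ((4 / c) powr - \<bar>a\<bar> * t powr a) \<le> (3 * t) powr - p * \<delta> x powr \<gamma> * \<delta> y powr a"
      by (intro mult_left_mono) auto
    moreover have "(3 * t) powr - p * \<delta> x powr \<gamma> * ((4 / c) powr - \<bar>a\<bar> * t powr a)
      = 3 powr - p * (4 / c) powr - \<bar>a\<bar> * \<delta> x powr \<gamma> * (t powr - p * t powr a)"
      using tp by (simp add: powr_mult)
    moreover have "t powr - p * t powr a = t powr - ?N"
      by (simp add: powr_add[symmetric] p_def a_def)
    ultimately show ?thesis using 1 by simp
  qed
  have "ennreal (3 powr - p * (4 / c) powr - \<bar>a\<bar> * ?V * (c / 4) powr ?N * \<delta> x powr \<gamma>) = ennreal ?b * ennreal (?V * (c * t / 4) powr ?N)"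
  proof -
    have "?b * (?V * (c * t / 4) powr ?N) = 3 powr - p * (4 / c) powr - \<bar>a\<bar> * ?V * (c / 4) powr ?N * \<delta> x powr \<gamma> * (t powr - ?N * t powr ?N)"
      using tp c powr_mult[of "c / 4" t ?N] by simp
    also have "t powr - ?N * t powr ?N = 1" using tp by (simp add: powr_minus)
    finally have eq: "?b * (?V * (c * t / 4) powr ?N) = 3 powr - p * (4 / c) powr - \<bar>a\<bar> * ?V * (c / 4) powr ?N * \<delta> x powr \<gamma>"
      by (simp only: mult_1_right)
    show ?thesis unfolding eq[symmetric] by (rule ennreal_mult') simp
  qed
  also have "\<dots> = (\<integral>\<^sup>+y. ennreal ?b * indicator (cball w (c * t / 4)) y \<partial>lborel)"
    using tp c by (simp add: nn_integral_cmult_indicator emeasure_cball_powr)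
  also have "\<dots> \<le> (\<integral>\<^sup>+y. ennreal (k x y) * ennreal (\<delta> y powr - (2 * s - \<gamma>)) * indicator (cball w (c * t / 4)) y \<partial>lborel)"
  proof (rule nn_integral_mono_AE, use AE_neq[of x] in eventually_elim)
    fix y assume "y \<noteq> x"
    then show "ennreal ?b * indicator (cball w (c * t / 4)) y \<le> ennreal (k x y) * ennreal (\<delta> y powr - (2 * s - \<gamma>)) * indicator (cball w (c * t / 4)) y"
      using le[of y] by (auto simp: indicator_def ennreal_mult'[symmetric] intro!: ennreal_leI)
  qed
  finally show ?thesis by (simp add: p_def a_def)
qed

text \<open>The logarithm counts the disjoint balls of radius comparable to \<open>4 ^ j * \<delta> x\<close>, centred at
  height \<open>4 ^ j * \<delta> x\<close> above \<open>x\<close> in the direction of the chart; each contributes the same amount.\<close>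
lemma cone_integral:
  obtains c\<^sub>0 c\<^sub>1 where "0 < c\<^sub>0" "c\<^sub>0 \<le> 1" "0 < c\<^sub>1" "\<And>x. x \<in> \<Omega> \<Longrightarrow>
    ennreal (c\<^sub>1 * \<delta> x powr \<gamma> * ln (D / \<delta> x)) \<le>
    (\<integral>\<^sup>+y. ennreal (k x y) * ennreal (\<delta> y powr - (2 * s - \<gamma>)) * indicator {y \<in> \<Omega>. c\<^sub>0 * \<delta> x \<le> \<delta> y} y \<partial>lborel)"
proof -
  obtain \<rho> c where \<rho>: "\<rho> > 0" and c: "c > 0" "c \<le> 1"
    and ch: "\<And>z. z \<in> frontier \<Omega> \<Longrightarrow> \<exists>e h. chart \<rho> c z e h"
    by (rule uniform_chart) (rule that)
  define b where "b = 3 powr - (real DIM('a) - 2 * s + 2 * \<gamma>) * (4 / c) powr - \<bar>2 * \<gamma> - 2 * s\<bar> *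
      unit_ball_vol (real DIM('a)) * (c / 4) powr real DIM('a)"
  have b: "b > 0" using c by (simp add: b_def)
  \<comment> \<open>If the logarithm is at most \<open>\<Lambda>\<close>, a single ball around
    \<open>x\<close> suffices. Otherwise \<open>ln (4 * D / \<rho>)\<close> is less than half of it,
    so more than half is left for counting balls.\<close>
  define \<Lambda> where "\<Lambda> = max 1 (2 * ln (4 * D / \<rho>))"
  have \<Lambda>: "1 \<le> \<Lambda>" "2 * ln (4 * D / \<rho>) \<le> \<Lambda>" by (auto simp: \<Lambda>_def)
  define c1 where "c1 = min (b / \<Lambda>) (b / (2 * ln 4))"
  have ln4: "0 < ln (4::real)" by simp
  have c1: "c1 > 0" using b \<Lambda> ln4 by (simp add: c1_def)
  show thesis
  proof (rule that[of "c / 2" c1])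
    show "0 < c / 2" "c / 2 \<le> 1" "0 < c1" using c c1 by auto
    fix x assume x: "x \<in> \<Omega>"
    have dx: "0 < \<delta> x" "4 * \<delta> x \<le> D" using bdist_pos bdist_le_D x by auto
    let ?S = "{y \<in> \<Omega>. c / 2 * \<delta> x \<le> \<delta> y}"
    let ?g = "\<lambda>y. ennreal (k x y) * ennreal (\<delta> y powr - (2 * s - \<gamma>))"
    let ?l = "ln (D / \<delta> x)"
    have l: "1 \<le> ?l" using x by (rule ln_D_ge_1)
    have contrib: "ennreal (b * \<delta> x powr \<gamma>) \<le> (\<integral>\<^sup>+y. ?g y * indicator (cball w (c * t / 4)) y \<partial>lborel)"
      if "\<delta> x \<le> t" "norm (x - w) \<le> t" "c * t \<le> \<delta> w" for t w
      unfolding b_def using ball_contribution[OF x that(1,2) c that(3)] .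
    have sub: "y \<in> ?S" if y: "y \<in> cball w (c * t / 4)" and t: "\<delta> x \<le> t" "c * t \<le> \<delta> w" for w t y
    proof -
      have "c * \<delta> x \<le> c * t" "0 < c * \<delta> x" using t c dx by auto
      moreover have "\<delta> w \<le> \<delta> y + c * t / 4"
        using bdist_le_add_dist[of w y] y by (simp add: dist_norm)
      ultimately have "c / 2 * \<delta> x \<le> \<delta> y" "0 < \<delta> y" using t by auto
      then show ?thesis using bdist_notin[of y] by fastforce
    qed
    show "ennreal (c1 * \<delta> x powr \<gamma> * ?l) \<le> (\<integral>\<^sup>+y. ?g y * indicator ?S y \<partial>lborel)"
    proof (cases "?l \<le> \<Lambda>")
      case True
      have "c * \<delta> x \<le> \<delta> x" using c dx by simp
      have "c1 * ?l \<le> b / \<Lambda> * \<Lambda>" using True l c1 \<Lambda> b by (intro mult_mono) (auto simp: c1_def)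
      then have "c1 * ?l * \<delta> x powr \<gamma> \<le> b * \<delta> x powr \<gamma>" using \<Lambda> by (intro mult_right_mono) auto
      then have "ennreal (c1 * \<delta> x powr \<gamma> * ?l) \<le> ennreal (b * \<delta> x powr \<gamma>)"
        by (intro ennreal_leI) (simp add: mult_ac)
      also have "\<dots> \<le> (\<integral>\<^sup>+y. ?g y * indicator (cball x (c * \<delta> x / 4)) y \<partial>lborel)"
        using \<open>c * \<delta> x \<le> \<delta> x\<close> dx by (intro contrib) auto
      also have "\<dots> \<le> (\<integral>\<^sup>+y. ?g y * indicator ?S y \<partial>lborel)"
        using sub[of _ x "\<delta> x"] \<open>c * \<delta> x \<le> \<delta> x\<close> by (intro nn_integral_mono mult_left_mono indicator_leI) auto
      finally show ?thesis .
    next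
      case False
      \<comment> \<open>The exponent at which the height 4^m \<delta>(x) equals \<rho> / 4. The
        successor in \<open>n\<close> counts the ball with \<open>j = 0\<close>.\<close>
      define m where "m = log 4 (\<rho> / (4 * \<delta> x))"
      define n where "n = Suc (nat \<lfloor>m\<rfloor>)"
      define T where "T = (\<lambda>j::nat. 4 ^ j * \<delta> x)"
      have "ln (\<rho> / (4 * \<delta> x)) = ?l - ln (4 * D / \<rho>)"
        using \<rho> dx by (simp add: ln_div ln_mult)
      then have m: "?l / (2 * ln 4) \<le> m"
        using \<Lambda> False ln4 by (simp add: m_def log_def divide_simps)
      then have m0: "0 \<le> m" using l ln4 by (meson divide_nonneg_pos le_less_trans less_imp_le mult_pos_pos order_trans zero_less_numeral zero_less_one)
      then have nm: "m \<le> real n" by (simp add: n_def) linarith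
      have T: "\<delta> x \<le> T j" for j using dx by (simp add: T_def)
      have T4: "T j \<le> \<rho> / 4" if "j < n" for j
      proof -
        have "real j \<le> m" using that m0 unfolding n_def by (simp add: less_Suc_eq_le le_nat_iff le_floor_iff)
        then have "4 powr real j \<le> 4 powr m" by (intro powr_mono) auto
        also have "\<dots> = \<rho> / (4 * \<delta> x)" using \<rho> dx by (simp add: m_def)
        finally show ?thesis using dx by (simp add: T_def powr_realpow divide_simps mult_ac)
      qed
      obtain z where z: "z \<in> frontier \<Omega>" "norm (x - z) = \<delta> x" using bdist_attained x by blast
      obtain e h where eh: "chart \<rho> c z e h" using ch z by blast
      have e: "norm e = 1" using eh by (simp add: chart_def)
      define w where "w = (\<lambda>j. x + T j *\<^sub>R e)"
      define B where "B = (\<lambda>j. cball (w j) (c * T j / 4))"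
      have xw: "norm (x - w j) = T j" for j
        using e dx by (simp add: w_def T_def)
      \<comment> \<open>Going up by \<open>T j\<close> along \<open>e\<close> raises
        \<open>h\<close> by exactly \<open>T j\<close>, and the chart turns height into boundary
        distance.\<close>
      have wd: "c * T j \<le> \<delta> (w j)" if "j < n" for j
      proof -
        have \<rho>': "T j \<le> \<rho> / 4" "\<delta> x \<le> \<rho> / 4" using T4[OF that] T[of j] by auto
        then have "x \<in> ball z \<rho>" using z \<rho> dx by (simp add: dist_norm norm_minus_commute)
        then have "0 < h x" using eh x by (auto simp: chart_def)
        have "norm (z - w j) \<le> norm (z - x) + norm (x - w j)" using norm_triangle_ineq[of "z - x" "x - w j"] by simp
        then have "w j \<in> ball z \<rho>" using \<rho>' \<rho> xw z by (simp add: dist_norm norm_minus_commute)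
        then have "c * h (w j) \<le> \<delta> (w j)" using eh by (auto simp: chart_def)
        moreover have "h (w j) = h x + T j" using eh by (simp add: chart_def w_def)
        ultimately show ?thesis using c \<open>0 < h x\<close> by (smt (verit) mult_left_mono)
      qed
      \<comment> \<open>Each ball lies in the annulus around \<open>x\<close> with radii 3/4 and 5/4
        of \<open>T j\<close>; as the heights grow by the factor 4 > 5/3, the annuli are
        disjoint.\<close>
      have Bdist: "3 / 4 * T j \<le> norm (x - y) \<and> norm (x - y) \<le> 5 / 4 * T j" if "y \<in> B j" for y j
      proof -
        have "norm (w j - y) \<le> c * T j / 4" using that by (simp add: B_def dist_norm)
        moreover have "c * T j \<le> T j" using c T[of j] dx by simp
        moreover have "norm (x - y) \<le> norm (x - w j) + norm (w j - y)" "norm (x - w j) \<le> norm (x - y) + norm (w j - y)"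
          using norm_triangle_ineq[of "x - w j" "w j - y"] norm_triangle_ineq[of "x - y" "y - w j"]
          by (auto simp: norm_minus_commute)
        ultimately show ?thesis using xw[of j] by linarith
      qed
      have less: "B i \<inter> B j = {}" if "i < j" for i j
      proof -
        have "(4::real) ^ Suc i \<le> 4 ^ j" using that by (intro power_increasing) auto
        then have "4 * T i \<le> T j" using dx by (simp add: T_def)
        then have "5 / 4 * T i < 3 / 4 * T j" using T[of i] dx by linarith
        then show ?thesis using Bdist[of _ i] Bdist[of _ j] by fastforce
      qed
      have disj: "disjoint_family_on B {..<n}"
        unfolding disjoint_family_on_def using less by (metis inf_commute linorder_neqE_nat)
      have "c1 * ?l \<le> b / (2 * ln 4) * ?l" using l by (intro mult_right_mono) (auto simp: c1_def)
      also have "\<dots> = b * (?l / (2 * ln 4))" by simp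
      also have "\<dots> \<le> b * real n" using m nm b by (intro mult_left_mono) auto
      finally have "c1 * ?l * \<delta> x powr \<gamma> \<le> b * real n * \<delta> x powr \<gamma>" by (rule mult_right_mono) simp
      then have "ennreal (c1 * \<delta> x powr \<gamma> * ?l) \<le> ennreal (real n * (b * \<delta> x powr \<gamma>))"
        by (intro ennreal_leI) (simp add: mult_ac)
      also have "\<dots> = (\<Sum>j<n. ennreal (b * \<delta> x powr \<gamma>))"
        using b by (simp add: ennreal_mult' ennreal_of_nat_eq_real_of_nat)
      also have "\<dots> \<le> (\<Sum>j<n. \<integral>\<^sup>+y. ?g y * indicator (B j) y \<partial>lborel)"
        unfolding B_def using T xw wd by (intro sum_mono contrib) auto
      also have "\<dots> = (\<integral>\<^sup>+y. (\<Sum>j<n. ?g y * indicator (B j) y) \<partial>lborel)"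
        unfolding B_def by (rule nn_integral_sum[symmetric]) measurable
      also have "\<dots> = (\<integral>\<^sup>+y. ?g y * indicator (\<Union>j<n. B j) y \<partial>lborel)"
        using disj by (simp add: sum_distrib_left[symmetric] indicator_UN_disjoint)
      also have "\<dots> \<le> (\<integral>\<^sup>+y. ?g y * indicator ?S y \<partial>lborel)"
      proof (intro nn_integral_mono mult_left_mono indicator_leI)
        fix y assume "y \<in> (\<Union>j<n. B j)"
        then obtain j where "j < n" "y \<in> B j" by blast
        then show "y \<in> ?S" unfolding B_def by (intro sub[of _ "w j" "T j"] T wd)
      qed simp
      finally show ?thesis .
    qed
  qed
qed

text \<open>On the region of \<open>cone_integral\<close> the logarithm at \<open>y\<close> is at
  most a constant times the logarithm at \<open>x\<close>, so its negative power is bounded below by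
  a value depending on \<open>x\<close> alone, which leaves the integral.\<close>

lemma pot_log_lower:
  assumes "0 \<le> \<kappa>"
  obtains c where "0 < c" "\<And>x. x \<in> \<Omega> \<Longrightarrow>
    ennreal (c * (\<delta> x powr \<gamma> * ln (D / \<delta> x) powr (1 - \<kappa>)))
    \<le> pot (\<lambda>y. ennreal (\<delta> y powr - (2 * s - \<gamma>) * ln (D / \<delta> y) powr - \<kappa>)) x"
proof -
  obtain c\<^sub>0 c\<^sub>1 where c: "0 < c\<^sub>0" "c\<^sub>0 \<le> 1" "0 < c\<^sub>1" "\<And>x. x \<in> \<Omega> \<Longrightarrow>
    ennreal (c\<^sub>1 * \<delta> x powr \<gamma> * ln (D / \<delta> x)) \<le>
    (\<integral>\<^sup>+y. ennreal (k x y) * ennreal (\<delta> y powr - (2 * s - \<gamma>)) * indicator {y \<in> \<Omega>. c\<^sub>0 * \<delta> x \<le> \<delta> y} y \<partial>lborel)"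
    by (rule cone_integral) (rule that)
  \<comment> \<open>The summand \<open>ln (1 / c\<^sub>0)\<close> is absorbed because the logarithm
    at \<open>x\<close> is at least 1.\<close>
  define M where "M = 1 + ln (1 / c\<^sub>0)"
  have "0 \<le> ln (1 / c\<^sub>0)" using c by simp
  then have M: "1 \<le> M" by (simp add: M_def)
  show thesis
  proof (rule that)
    show "0 < M powr - \<kappa> * c\<^sub>1" using M c by simp
    fix x assume x: "x \<in> \<Omega>"
    have dx: "0 < \<delta> x" "4 * \<delta> x \<le> D" using bdist_pos bdist_le_D x by auto
    let ?l = "ln (D / \<delta> x)"
    let ?g = "\<lambda>y. ennreal (k x y) * ennreal (\<delta> y powr - (2 * s - \<gamma>)) * indicator {y \<in> \<Omega>. c\<^sub>0 * \<delta> x \<le> \<delta> y} y"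
    have l: "1 \<le> ?l" using x by (rule ln_D_ge_1)
    have le: "(M * ?l) powr - \<kappa> \<le> ln (D / \<delta> y) powr - \<kappa>" if y: "y \<in> \<Omega>" "c\<^sub>0 * \<delta> x \<le> \<delta> y" for y
    proof -
      have dy: "0 < \<delta> y" using bdist_pos y by blast
      have "ln (D / \<delta> y) \<le> ln (D / \<delta> x * (1 / c\<^sub>0))"
        using y dy dx c by (intro ln_mono) (auto simp: divide_simps mult.commute)
      also have "\<dots> = ?l + ln (1 / c\<^sub>0)" using dx c by (subst ln_mult) auto
      also have "\<dots> \<le> ?l + ln (1 / c\<^sub>0) * ?l"
        using mult_left_mono[OF l \<open>0 \<le> ln (1 / c\<^sub>0)\<close>] by simp
      also have "\<dots> = M * ?l" by (simp add: M_def algebra_simps)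
      finally show ?thesis
        using ln_D_ge_1[OF y(1)] assms by (intro powr_mono2') auto
    qed
    have eq: "M powr - \<kappa> * c\<^sub>1 * (\<delta> x powr \<gamma> * ?l powr (1 - \<kappa>)) = (M * ?l) powr - \<kappa> * (c\<^sub>1 * \<delta> x powr \<gamma> * ?l)"
      using M l by (simp add: powr_mult powr_diff powr_minus divide_simps)
    have "ennreal (M powr - \<kappa> * c\<^sub>1 * (\<delta> x powr \<gamma> * ?l powr (1 - \<kappa>))) = ennreal ((M * ?l) powr - \<kappa>) * ennreal (c\<^sub>1 * \<delta> x powr \<gamma> * ?l)"
      unfolding eq by (rule ennreal_mult') simp
    also have "\<dots> \<le> ennreal ((M * ?l) powr - \<kappa>) * (\<integral>\<^sup>+y. ?g y \<partial>lborel)"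
      by (intro mult_left_mono c x) simp
    also have "\<dots> = (\<integral>\<^sup>+y. ennreal ((M * ?l) powr - \<kappa>) * ?g y \<partial>lborel)"
      by (rule nn_integral_cmult[symmetric]) measurable
    also have "\<dots> \<le> pot (\<lambda>y. ennreal (\<delta> y powr - (2 * s - \<gamma>) * ln (D / \<delta> y) powr - \<kappa>)) x"
      unfolding pot_def
    proof (rule nn_integral_mono)
      fix y
      show "ennreal ((M * ?l) powr - \<kappa>) * ?g y \<le> ennreal (k x y) * ennreal (\<delta> y powr - (2 * s - \<gamma>) * ln (D / \<delta> y) powr - \<kappa>) * indicator \<Omega> y"
      proof (cases "y \<in> \<Omega> \<and> c\<^sub>0 * \<delta> x \<le> \<delta> y")
        case True
        then have "ennreal (k x y * \<delta> y powr - (2 * s - \<gamma>) * (M * ?l) powr - \<kappa>) \<le> ennreal (k x y * \<delta> y powr - (2 * s - \<gamma>) * ln (D / \<delta> y) powr - \<kappa>)"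
          by (intro ennreal_leI mult_left_mono le) auto
        then show ?thesis
          using True by (simp add: ennreal_mult' mult_ac)
      qed (auto simp: indicator_def)
    qed
    finally show "ennreal (M powr - \<kappa> * c\<^sub>1 * (\<delta> x powr \<gamma> * ?l powr (1 - \<kappa>))) \<le> pot (\<lambda>y. ennreal (\<delta> y powr - (2 * s - \<gamma>) * ln (D / \<delta> y) powr - \<kappa>)) x" .
  qed
qed

end

section \<open>Solutions of the integral equation\<close>

text \<open>The integral equation is kept only as a two-sided inequality for the explicit kernel
  \<open>k\<close>, so that every kernel comparable to \<open>k\<close> is covered; \<open>A\<close>
  is the constant of comparison.\<close>

locale singular_solution = green_kernel \<Omega> s \<gamma> for \<Omega> :: "'a::euclidean_space set" and s \<gamma> :: real +
  fixes u :: "'a \<Rightarrow> real" and q A :: real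
  assumes q_pos: "0 < q" and A_pos: "0 < A" and u_measurable [measurable]: "u \<in> borel_measurable borel"
    and u_pot: "AE x in lborel. x \<in> \<Omega> \<longrightarrow> 0 < u x \<and>
      ennreal (u x) \<le> ennreal A * pot (\<lambda>y. ennreal (u y powr - q)) x \<and>
      pot (\<lambda>y. ennreal (u y powr - q)) x \<le> ennreal (A * u x)"
begin

abbreviation F :: "'a \<Rightarrow> ennreal" where "F \<equiv> \<lambda>y. ennreal (u y powr - q)"

section \<open>Exchange of lower and upper bounds through the equation\<close>

text \<open>The nonlinearity is decreasing: a lower bound for \<open>u\<close> bounds u^(-q) from
  above, hence also its potential and, by the equation, \<open>u\<close>.\<close>

lemma upper_from_lower:
  assumes [measurable]: "g \<in> borel_measurable borel" and c: "0 < c"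
    and lower: "AE y in lborel. y \<in> \<Omega> \<longrightarrow> 0 < g y \<and> c * g y \<le> u y"
    and pot: "\<And>x. x \<in> \<Omega> \<Longrightarrow> pot (\<lambda>y. ennreal (g y powr - q)) x \<le> ennreal (B x)" "\<And>x. x \<in> \<Omega> \<Longrightarrow> 0 \<le> B x"
  shows "AE x in lborel. x \<in> \<Omega> \<longrightarrow> u x \<le> A * c powr - q * B x"
proof -
  have "AE y in lborel. y \<in> \<Omega> \<longrightarrow> F y \<le> ennreal (c powr - q) * ennreal (g y powr - q)"
    using lower
  proof eventually_elim
    fix y assume y: "y \<in> \<Omega> \<longrightarrow> 0 < g y \<and> c * g y \<le> u y"
    show "y \<in> \<Omega> \<longrightarrow> F y \<le> ennreal (c powr - q) * ennreal (g y powr - q)"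
    proof
      assume "y \<in> \<Omega>"
      then have "u y powr - q \<le> (c * g y) powr - q"
        using y c q_pos by (intro powr_mono2') auto
      then show "F y \<le> ennreal (c powr - q) * ennreal (g y powr - q)"
        using y c \<open>y \<in> \<Omega>\<close> by (simp add: powr_mult ennreal_mult'[symmetric] ennreal_leI)
    qed
  qed
  then have le: "pot F x \<le> ennreal (c powr - q) * pot (\<lambda>y. ennreal (g y powr - q)) x" for x
    by (subst pot_cmult[symmetric]) (auto intro: pot_mono_AE)
  show ?thesis
    using u_pot
  proof eventually_elim
    fix x assume x: "x \<in> \<Omega> \<longrightarrow> 0 < u x \<and> ennreal (u x) \<le> ennreal A * pot F x \<and> pot F x \<le> ennreal (A * u x)"
    show "x \<in> \<Omega> \<longrightarrow> u x \<le> A * c powr - q * B x"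
    proof
      assume "x \<in> \<Omega>"
      then have "ennreal (u x) \<le> ennreal A * pot F x" using x by blast
      also have "\<dots> \<le> ennreal A * (ennreal (c powr - q) * ennreal (B x))"
        using le pot \<open>x \<in> \<Omega>\<close> by (intro mult_left_mono order_trans[OF le]) auto
      also have "\<dots> = ennreal (A * c powr - q * B x)"
        using A_pos by (simp add: ennreal_mult'[symmetric] mult.assoc)
      finally show "u x \<le> A * c powr - q * B x"
        using A_pos pot(2)[OF \<open>x \<in> \<Omega>\<close>] by (subst (asm) ennreal_le_iff) auto
    qed
  qed
qed

text \<open>The same monotonicity in the other direction; it turns a sharp upper bound into the
  matching lower one.\<close>

lemma lower_from_upper:
  assumes [measurable]: "g \<in> borel_measurable borel" and c: "0 < c"
    and upper: "AE y in lborel. y \<in> \<Omega> \<longrightarrow> u y \<le> c * g y"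
    and pot: "\<And>x. x \<in> \<Omega> \<Longrightarrow> ennreal (B x) \<le> pot (\<lambda>y. ennreal (g y powr - q)) x"
  shows "AE x in lborel. x \<in> \<Omega> \<longrightarrow> c powr - q * B x \<le> A * u x"
proof -
  have "AE y in lborel. y \<in> \<Omega> \<longrightarrow> ennreal (c powr - q) * ennreal (g y powr - q) \<le> F y"
    using upper u_pot
  proof eventually_elim
    fix y assume y: "y \<in> \<Omega> \<longrightarrow> u y \<le> c * g y"
      "y \<in> \<Omega> \<longrightarrow> 0 < u y \<and> ennreal (u y) \<le> ennreal A * pot F y \<and> pot F y \<le> ennreal (A * u y)"
    show "y \<in> \<Omega> \<longrightarrow> ennreal (c powr - q) * ennreal (g y powr - q) \<le> F y"
    proof
      assume "y \<in> \<Omega>"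
      then have uy: "0 < u y" "u y \<le> c * g y" using y by auto
      then have "0 < g y" using c by (metis less_le_trans zero_less_mult_pos)
      have "(c * g y) powr - q \<le> u y powr - q"
        using uy q_pos by (intro powr_mono2') auto
      then show "ennreal (c powr - q) * ennreal (g y powr - q) \<le> F y"
        using \<open>0 < g y\<close> c by (simp add: powr_mult ennreal_mult'[symmetric] ennreal_leI)
    qed
  qed
  then have le: "ennreal (c powr - q) * pot (\<lambda>y. ennreal (g y powr - q)) x \<le> pot F x" for x
    by (subst pot_cmult[symmetric]) (auto intro: pot_mono_AE)
  show ?thesis
    using u_pot
  proof eventually_elim
    fix x assume x: "x \<in> \<Omega> \<longrightarrow> 0 < u x \<and> ennreal (u x) \<le> ennreal A * pot F x \<and> pot F x \<le> ennreal (A * u x)"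
    show "x \<in> \<Omega> \<longrightarrow> c powr - q * B x \<le> A * u x"
    proof
      assume "x \<in> \<Omega>"
      have "ennreal (c powr - q * B x) = ennreal (c powr - q) * ennreal (B x)"
        by (simp add: ennreal_mult')
      also have "\<dots> \<le> pot F x"
        using pot[OF \<open>x \<in> \<Omega>\<close>] by (intro order_trans[OF mult_left_mono le]) auto
      also have "\<dots> \<le> ennreal (A * u x)" using x \<open>x \<in> \<Omega>\<close> by blast
      finally show "c powr - q * B x \<le> A * u x"
        using A_pos x \<open>x \<in> \<Omega>\<close> by (subst (asm) ennreal_le_iff) auto
    qed
  qed
qed

section \<open>Lower bounds for the solution\<close>

text \<open>By \<open>k_ge\<close> with \<open>R = D\<close> the kernel is at least a multiple of
  \<delta>(x)^\<gamma> \<delta>(y)^\<gamma> on all of \<Omega>, so the potential is at least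
  \<delta>(x)^\<gamma> times a positive weighted integral of u^(-q).\<close>

lemma hopf_lower_bound:
  obtains c where "0 < c" "AE x in lborel. x \<in> \<Omega> \<longrightarrow> c * \<delta> x powr \<gamma> \<le> u x"
proof -
  define p where "p = real DIM('a) - 2 * s + 2 * \<gamma>"
  let ?I = "\<integral>\<^sup>+y. ennreal (\<delta> y powr \<gamma>) * F y * indicator \<Omega> y \<partial>lborel"
  \<comment> \<open>The integrand is positive almost everywhere on \<Omega>, so a vanishing integral
    would make the nonempty open set \<Omega> a null set.\<close>
  have "?I \<noteq> 0"
  proof
    assume "?I = 0"
    then have "AE y in lborel. ennreal (\<delta> y powr \<gamma>) * F y * indicator \<Omega> y = 0"
      by (subst (asm) nn_integral_0_iff_AE) auto
    with u_pot have "AE y in lborel. y \<notin> \<Omega>"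
    proof eventually_elim
      fix y assume y: "y \<in> \<Omega> \<longrightarrow> 0 < u y \<and> ennreal (u y) \<le> ennreal A * pot F y \<and> pot F y \<le> ennreal (A * u y)"
        "ennreal (\<delta> y powr \<gamma>) * F y * indicator \<Omega> y = 0"
      show "y \<notin> \<Omega>"
      proof
        assume "y \<in> \<Omega>"
        moreover have "\<delta> y > 0" using bdist_pos \<open>y \<in> \<Omega>\<close> by blast
        ultimately show False using y by auto
      qed
    qed
    then have "\<Omega> \<in> null_sets lborel"
      by (subst AE_iff_null_sets) auto
    then show False
      using open_dom dom_nonempty open_not_negligible null_sets_completionI negligible_iff_null_sets by blast
  qed
  \<comment> \<open>The integral is not known to be finite here, so a positive real number not above
    it is taken, namely 1 if it is infinite.\<close>
  then obtain m where m: "0 < m" "ennreal m \<le> ?I"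
  proof (cases ?I)
    case (real r)
    then show ?thesis using \<open>?I \<noteq> 0\<close> that[of r] by (cases "r = 0") auto
  next
    case top
    then show ?thesis using that[of 1] by simp
  qed
  have le: "ennreal (D powr - p * \<delta> x powr \<gamma> * m) \<le> pot F x" if x: "x \<in> \<Omega>" for x
  proof -
    have "ennreal (D powr - p * \<delta> x powr \<gamma> * m) = ennreal (D powr - p * \<delta> x powr \<gamma>) * ennreal m"
      by (simp add: ennreal_mult')
    also have "\<dots> \<le> ennreal (D powr - p * \<delta> x powr \<gamma>) * ?I"
      using m by (intro mult_left_mono) auto
    also have "\<dots> = (\<integral>\<^sup>+y. ennreal (D powr - p * \<delta> x powr \<gamma>) * (ennreal (\<delta> y powr \<gamma>) * F y * indicator \<Omega> y) \<partial>lborel)"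
      by (rule nn_integral_cmult[symmetric]) measurable
    also have "\<dots> \<le> pot F x"
      unfolding pot_def
    proof (rule nn_integral_mono_AE, use AE_neq[of x] in eventually_elim)
      fix y assume "y \<noteq> x"
      show "ennreal (D powr - p * \<delta> x powr \<gamma>) * (ennreal (\<delta> y powr \<gamma>) * F y * indicator \<Omega> y) \<le> ennreal (k x y) * F y * indicator \<Omega> y"
      proof (cases "y \<in> \<Omega>")
        case True
        have "D powr - p * \<delta> x powr \<gamma> * \<delta> y powr \<gamma> \<le> k x y"
          unfolding p_def using \<open>y \<noteq> x\<close> norm_diff_lt_D[OF x True] bdist_le_D[OF x] bdist_le_D[OF True] bdist_pos[OF x] bdist_pos[OF True]
          by (intro k_ge) auto
        then have "ennreal (D powr - p * \<delta> x powr \<gamma>) * ennreal (\<delta> y powr \<gamma>) \<le> ennreal (k x y)"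
          by (simp add: ennreal_mult'[symmetric] ennreal_leI)
        then show ?thesis
          using True by (simp add: mult.assoc[symmetric] mult_right_mono)
      qed simp
    qed
    finally show ?thesis .
  qed
  show thesis
  proof (rule that)
    show "0 < D powr - p * m / A" using D_pos m A_pos by simp
    show "AE x in lborel. x \<in> \<Omega> \<longrightarrow> D powr - p * m / A * \<delta> x powr \<gamma> \<le> u x"
      using u_pot
    proof eventually_elim
      fix x assume x: "x \<in> \<Omega> \<longrightarrow> 0 < u x \<and> ennreal (u x) \<le> ennreal A * pot F x \<and> pot F x \<le> ennreal (A * u x)"
      show "x \<in> \<Omega> \<longrightarrow> D powr - p * m / A * \<delta> x powr \<gamma> \<le> u x"
      proof
        assume "x \<in> \<Omega>"
        then have "ennreal (D powr - p * \<delta> x powr \<gamma> * m) \<le> ennreal (A * u x)"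
          using le x order_trans by blast
        then have "D powr - p * \<delta> x powr \<gamma> * m \<le> A * u x"
          using A_pos x \<open>x \<in> \<Omega>\<close> by (subst (asm) ennreal_le_iff) auto
        then show "D powr - p * m / A * \<delta> x powr \<gamma> \<le> u x"
          using A_pos by (simp add: divide_simps mult_ac)
      qed
    qed
  qed
qed

text \<open>Integrating the equation over the ball of radius \<delta>(x) / 4 and using
  \<open>k_mean_le\<close>, the mean of \<open>u\<close> there is at most \<open>K * u x\<close>.
  Hence u^(-q) is not small on most of the ball, and the part of the potential coming from the ball
  gives u(x) \<ge> c \<delta>(x)^(2s) u(x)^(-q). Solving for \<open>u x\<close> yields the
  exponent.\<close>

lemma harnack_lower_bound:
  obtains c where "0 < c" "AE x in lborel. x \<in> \<Omega> \<longrightarrow> c * \<delta> x powr (2 * s / (q + 1)) \<le> u x"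
proof -
  let ?N = "real DIM('a)" and ?V = "unit_ball_vol (real DIM('a))"
  obtain C where C: "C > 0" "\<And>x y. x \<in> \<Omega> \<Longrightarrow> y \<in> \<Omega> \<Longrightarrow> y \<noteq> x \<Longrightarrow>
    (\<integral>\<^sup>+z. ennreal (k z y) * indicator (cball x (\<delta> x / 4)) z \<partial>lborel) \<le> ennreal (C * \<delta> x powr ?N * k x y)"
    by (rule k_mean_le) (rule that)
  \<comment> \<open>The two factors \<open>A\<close> come from the two inequalities of
    \<open>u_pot\<close>, \<open>C\<close> from \<open>k_mean_le\<close>, and
    \<open>4 powr ?N / ?V\<close> from dividing by the volume of the ball.\<close>
  define K where "K = A * C * A * 4 powr ?N / ?V"
  have K: "K > 0" using A_pos C by (simp add: K_def)
  define c1 where "c1 = (2 * K) powr - q * ?V * 4 powr - ?N / 2"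
  have c1: "c1 > 0" using K by (simp add: c1_def)
  have mean: "(\<integral>\<^sup>+z. ennreal (u z) * indicator (cball x (\<delta> x / 4)) z \<partial>lborel) \<le> ennreal (A * C * \<delta> x powr ?N) * pot F x"
    if x: "x \<in> \<Omega>" for x
  proof -
    let ?Q = "cball x (\<delta> x / 4)"
    have Q: "z \<in> \<Omega>" if "z \<in> ?Q" for z
      using that bdist_pos[OF x] ball_bdist_subset[of x z] by (auto simp: dist_norm)
    have "(\<integral>\<^sup>+z. ennreal (u z) * indicator ?Q z \<partial>lborel) \<le> (\<integral>\<^sup>+z. ennreal A * (pot F z * indicator ?Q z) \<partial>lborel)"
    proof (rule nn_integral_mono_AE, use u_pot in eventually_elim)
      fix z assume "z \<in> \<Omega> \<longrightarrow> 0 < u z \<and> ennreal (u z) \<le> ennreal A * pot F z \<and> pot F z \<le> ennreal (A * u z)"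
      then show "ennreal (u z) * indicator ?Q z \<le> ennreal A * (pot F z * indicator ?Q z)"
        using Q[of z] by (auto simp: indicator_def)
    qed
    also have "\<dots> = ennreal A * (\<integral>\<^sup>+z. pot F z * indicator ?Q z \<partial>lborel)"
      by (rule nn_integral_cmult) measurable
    also have "(\<integral>\<^sup>+z. pot F z * indicator ?Q z \<partial>lborel) = (\<integral>\<^sup>+z. \<integral>\<^sup>+y. ennreal (k z y) * F y * indicator \<Omega> y * indicator ?Q z \<partial>lborel \<partial>lborel)"
      unfolding pot_def by (subst nn_integral_multc) auto
    also have "\<dots> = (\<integral>\<^sup>+y. \<integral>\<^sup>+z. ennreal (k z y) * F y * indicator \<Omega> y * indicator ?Q z \<partial>lborel \<partial>lborel)"
      by (rule lborel_pair.Fubini') measurable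
    also have "\<dots> = (\<integral>\<^sup>+y. (F y * indicator \<Omega> y) * (\<integral>\<^sup>+z. ennreal (k z y) * indicator ?Q z \<partial>lborel) \<partial>lborel)"
      by (subst nn_integral_cmult[symmetric]) (auto simp: mult_ac)
    also have "\<dots> \<le> (\<integral>\<^sup>+y. ennreal (C * \<delta> x powr ?N) * (ennreal (k x y) * F y * indicator \<Omega> y) \<partial>lborel)"
    proof (rule nn_integral_mono_AE, use AE_neq[of x] in eventually_elim)
      fix y assume "y \<noteq> x"
      show "(F y * indicator \<Omega> y) * (\<integral>\<^sup>+z. ennreal (k z y) * indicator ?Q z \<partial>lborel) \<le> ennreal (C * \<delta> x powr ?N) * (ennreal (k x y) * F y * indicator \<Omega> y)"
      proof (cases "y \<in> \<Omega>")
        case True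
        have "F y * (\<integral>\<^sup>+z. ennreal (k z y) * indicator ?Q z \<partial>lborel) \<le> F y * ennreal (C * \<delta> x powr ?N * k x y)"
          using C(2)[OF x True \<open>y \<noteq> x\<close>] by (rule mult_left_mono) simp
        also have "ennreal (C * \<delta> x powr ?N * k x y) = ennreal (C * \<delta> x powr ?N) * ennreal (k x y)"
          using C by (simp add: ennreal_mult')
        finally show ?thesis using True by (simp add: mult_ac)
      qed simp
    qed
    also have "\<dots> = ennreal (C * \<delta> x powr ?N) * pot F x"
      unfolding pot_def by (rule nn_integral_cmult) measurable
    finally show ?thesis
      using A_pos by (simp add: ennreal_mult' mult.assoc mult_left_mono)
  qed
  have near: "ennreal (\<delta> x powr - (?N - 2 * s)) * (\<integral>\<^sup>+y. F y * indicator (cball x (\<delta> x / 4)) y \<partial>lborel) \<le> pot F x"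
    if x: "x \<in> \<Omega>" for x
  proof -
    have dx: "0 < \<delta> x" using bdist_pos x by blast
    have "ennreal (\<delta> x powr - (?N - 2 * s)) * (\<integral>\<^sup>+y. F y * indicator (cball x (\<delta> x / 4)) y \<partial>lborel)
      = (\<integral>\<^sup>+y. ennreal (\<delta> x powr - (?N - 2 * s)) * (F y * indicator (cball x (\<delta> x / 4)) y) \<partial>lborel)"
      by (rule nn_integral_cmult[symmetric]) measurable
    also have "\<dots> \<le> pot F x"
      unfolding pot_def
    proof (rule nn_integral_mono_AE, use AE_neq[of x] in eventually_elim)
      fix y assume "y \<noteq> x"
      show "ennreal (\<delta> x powr - (?N - 2 * s)) * (F y * indicator (cball x (\<delta> x / 4)) y) \<le> ennreal (k x y) * F y * indicator \<Omega> y"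
      proof (cases "y \<in> cball x (\<delta> x / 4)")
        case True
        then have r: "norm (x - y) \<le> \<delta> x / 4" by (simp add: dist_norm)
        then have "y \<in> \<Omega>" using ball_bdist_subset[of x y] dx by simp
        have "\<delta> x powr - (?N - 2 * s) \<le> norm (x - y) powr - (?N - 2 * s)"
          using r dx s_dim \<open>y \<noteq> x\<close> by (intro powr_mono2') auto
        also have "\<dots> = k x y"
          using k_near[OF x, of y] \<open>y \<noteq> x\<close> r dx by simp
        finally have "ennreal (\<delta> x powr - (?N - 2 * s)) \<le> ennreal (k x y)" by (rule ennreal_leI)
        then show ?thesis
          using True \<open>y \<in> \<Omega>\<close> by (simp add: mult_right_mono)
      qed simp
    qed
    finally show ?thesis .
  qed
  have main: "c1 * \<delta> x powr (2 * s) * u x powr - q \<le> A * u x"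
    if x: "x \<in> \<Omega>" and ux: "0 < u x" "pot F x \<le> ennreal (A * u x)" for x
  proof -
    let ?Q = "cball x (\<delta> x / 4)"
    define v where "v = ?V * (\<delta> x / 4) powr ?N"
    define m where "m = 2 * K * u x"
    have dx: "0 < \<delta> x" using bdist_pos x by blast
    have v: "v > 0" and m: "m > 0" using dx K ux by (auto simp: v_def m_def)
    have Q: "z \<in> \<Omega>" if "z \<in> ?Q" for z
      using that dx ball_bdist_subset[of x z] by (auto simp: dist_norm)
    have emQ: "emeasure lborel ?Q = ennreal v"
      using dx by (simp add: v_def emeasure_cball_powr)
    have "ennreal (m powr - q * v) = (\<integral>\<^sup>+z. ennreal (m powr - q) * indicator ?Q z \<partial>lborel)"
      by (simp add: nn_integral_cmult_indicator emQ ennreal_mult')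
    \<comment> \<open>Markov's inequality in pointwise form: where \<open>u z \<le> m\<close> the
      first term suffices, elsewhere \<open>u z / m > 1\<close>. As \<open>m\<close> is twice the
      bound of the mean, the second term accounts for at most half of the left side.\<close>
    also have "\<dots> \<le> (\<integral>\<^sup>+z. F z * indicator ?Q z + ennreal (m powr - q / m) * (ennreal (u z) * indicator ?Q z) \<partial>lborel)"
    proof (rule nn_integral_mono_AE, use u_pot in eventually_elim)
      fix z assume z: "z \<in> \<Omega> \<longrightarrow> 0 < u z \<and> ennreal (u z) \<le> ennreal A * pot F z \<and> pot F z \<le> ennreal (A * u z)"
      show "ennreal (m powr - q) * indicator ?Q z \<le> F z * indicator ?Q z + ennreal (m powr - q / m) * (ennreal (u z) * indicator ?Q z)"
      proof (cases "z \<in> ?Q")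
        case True
        then have uz: "0 < u z" using Q z by blast
        have "m powr - q \<le> u z powr - q + m powr - q / m * u z"
        proof (cases "u z \<le> m")
          case True
          then have "m powr - q \<le> u z powr - q" using uz q_pos by (intro powr_mono2') auto
          then show ?thesis using uz m by (simp add: add_increasing2)
        next
          case False
          then have "m powr - q * 1 \<le> m powr - q * (u z / m)" using m by (intro mult_left_mono) auto
          then show ?thesis by (simp add: add_increasing)
        qed
        then have "ennreal (m powr - q) \<le> F z + ennreal (m powr - q / m) * ennreal (u z)"
          using m uz by (simp add: ennreal_mult'[symmetric] ennreal_plus[symmetric] ennreal_leI del: ennreal_plus)
        then show ?thesis using True by simp
      qed simp
    qed
    also have "\<dots> = (\<integral>\<^sup>+z. F z * indicator ?Q z \<partial>lborel) + ennreal (m powr - q / m) * (\<integral>\<^sup>+z. ennreal (u z) * indicator ?Q z \<partial>lborel)"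
      by (subst nn_integral_add, simp, simp, subst nn_integral_cmult) simp_all
    also have "\<dots> \<le> (\<integral>\<^sup>+z. F z * indicator ?Q z \<partial>lborel) + ennreal (m powr - q / m) * (ennreal (A * C * \<delta> x powr ?N) * ennreal (A * u x))"
      using ux by (intro add_left_mono mult_left_mono order_trans[OF mean[OF x]]) auto
    also have "ennreal (m powr - q / m) * (ennreal (A * C * \<delta> x powr ?N) * ennreal (A * u x)) = ennreal (m powr - q * v / 2)"
    proof -
      have "?V > 0" by simp
      then have "?V \<noteq> 0" by (rule less_imp_neq[symmetric])
      then have "A * C * \<delta> x powr ?N * (A * u x) = K * u x * v"
        using dx by (simp add: K_def v_def powr_divide)
      then have eq: "m powr - q / m * (A * C * \<delta> x powr ?N * (A * u x)) = m powr - q * v / 2"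
        using m ux K by (simp add: m_def)
      have "ennreal (m powr - q / m) * (ennreal (A * C * \<delta> x powr ?N) * ennreal (A * u x))
        = ennreal (m powr - q / m * (A * C * \<delta> x powr ?N * (A * u x)))"
        using m A_pos C(1) ux(1) by (simp add: ennreal_mult'[symmetric])
      then show ?thesis unfolding eq .
    qed
    finally have half: "ennreal (m powr - q * v) \<le> (\<integral>\<^sup>+z. F z * indicator ?Q z \<partial>lborel) + ennreal (m powr - q * v / 2)" .
    \<comment> \<open>An infinite integral makes the claim trivial; a finite one allows the
      cancellation in the reals.\<close>
    have "ennreal (m powr - q * v / 2) \<le> (\<integral>\<^sup>+z. F z * indicator ?Q z \<partial>lborel)"
    proof (cases "\<integral>\<^sup>+z. F z * indicator ?Q z \<partial>lborel")
      case (real r)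
      have "ennreal (m powr - q * v) \<le> ennreal (r + m powr - q * v / 2)"
        using half real v by simp
      then have "m powr - q * v \<le> r + m powr - q * v / 2"
        using real v by (subst (asm) ennreal_le_iff) auto
      then show ?thesis using real by (simp add: ennreal_leI)
    qed simp
    then have "ennreal (\<delta> x powr - (?N - 2 * s)) * ennreal (m powr - q * v / 2) \<le> ennreal (A * u x)"
      using near[OF x] ux by (meson mult_left_mono order_trans zero_le)
    then have "\<delta> x powr - (?N - 2 * s) * (m powr - q * v / 2) \<le> A * u x"
      using ux A_pos v by (simp add: ennreal_mult'[symmetric] ennreal_le_iff)
    also have "\<delta> x powr - (?N - 2 * s) * (m powr - q * v / 2) = c1 * (\<delta> x powr - (?N - 2 * s) * \<delta> x powr ?N) * u x powr - q"
      using dx ux K by (simp add: c1_def m_def v_def powr_mult powr_divide powr_minus[of 4] divide_simps)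
    also have "\<delta> x powr - (?N - 2 * s) * \<delta> x powr ?N = \<delta> x powr (2 * s)"
      by (simp add: powr_add[symmetric])
    finally show ?thesis .
  qed
  show thesis
  proof (rule that)
    show "0 < (c1 / A) powr (1 / (q + 1))" using c1 A_pos by simp
    show "AE x in lborel. x \<in> \<Omega> \<longrightarrow> (c1 / A) powr (1 / (q + 1)) * \<delta> x powr (2 * s / (q + 1)) \<le> u x"
      using u_pot
    proof eventually_elim
      fix x assume x: "x \<in> \<Omega> \<longrightarrow> 0 < u x \<and> ennreal (u x) \<le> ennreal A * pot F x \<and> pot F x \<le> ennreal (A * u x)"
      show "x \<in> \<Omega> \<longrightarrow> (c1 / A) powr (1 / (q + 1)) * \<delta> x powr (2 * s / (q + 1)) \<le> u x"
      proof
        assume "x \<in> \<Omega>"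
        then have ux: "0 < u x" and m: "c1 * \<delta> x powr (2 * s) * u x powr - q \<le> A * u x"
          using x main by auto
        have dx: "0 < \<delta> x" using bdist_pos \<open>x \<in> \<Omega>\<close> by blast
        have "c1 / A * \<delta> x powr (2 * s) \<le> u x powr (q + 1)"
          using m ux A_pos by (simp add: powr_add powr_minus divide_simps mult_ac)
        then have "(c1 / A * \<delta> x powr (2 * s)) powr (1 / (q + 1)) \<le> (u x powr (q + 1)) powr (1 / (q + 1))"
          using c1 A_pos q_pos by (intro powr_mono2) auto
        also have "\<dots> = u x" using ux q_pos by (simp add: powr_powr)
        also have "(c1 / A * \<delta> x powr (2 * s)) powr (1 / (q + 1)) = (c1 / A) powr (1 / (q + 1)) * \<delta> x powr (2 * s / (q + 1))"
          using c1 A_pos dx by (subst powr_mult) (auto simp: powr_powr)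
        finally show "(c1 / A) powr (1 / (q + 1)) * \<delta> x powr (2 * s / (q + 1)) \<le> u x" .
      qed
    qed
  qed
qed

section \<open>Sharp upper bound in the critical case\<close>

text \<open>The function u^(-q) is split at the level u = t \<delta>^\<gamma>. Below it,
  \<open>weak_domination\<close> carries the bound over to \<open>x\<close>; above it, u^(-q) is at
  most t^(-q) \<delta>^(-(2s-\<gamma>)) by the critical relation, and \<open>pot_critical\<close>
  applies. With \<open>t\<close> proportional to u(x) / \<delta>(x)^\<gamma> the first part is at
  most half of \<open>u x\<close>, and the remaining inequality is solved for u(x)^(q+1).\<close>

lemma critical_upper_bound:
  assumes crit: "\<gamma> * q = 2 * s - \<gamma>" and \<gamma>: "s - 1 / 2 < \<gamma>"
  obtains C where "0 < C" "AE x in lborel. x \<in> \<Omega> \<longrightarrow> u x \<le> C * (\<delta> x powr \<gamma> * ln (D / \<delta> x) powr (1 / (q + 1)))"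
proof -
  define H where "H = 3 powr (real DIM('a) - 2 * s + 2 * \<gamma>)"
  have H: "H > 0" by (simp add: H_def)
  obtain C where C: "C > 0" "\<And>x. x \<in> \<Omega> \<Longrightarrow>
    pot (\<lambda>y. ennreal (\<delta> y powr - (2 * s - \<gamma>))) x \<le> ennreal (C * (\<delta> x powr \<gamma> * ln (D / \<delta> x)))"
    by (rule pot_critical[OF \<gamma>]) (rule that)
  \<comment> \<open>\<open>weak_domination\<close> asks for its bound at every point of
    \<open>E\<close>, so the exceptional null set is named here and later removed from
    \<open>E\<close>.\<close>
  obtain Z where Z: "{x \<in> space lborel. \<not> (x \<in> \<Omega> \<longrightarrow> 0 < u x \<and>
      ennreal (u x) \<le> ennreal A * pot F x \<and> pot F x \<le> ennreal (A * u x))} \<subseteq> Z" "emeasure lborel Z = 0" "Z \<in> sets lborel"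
    by (rule AE_E[OF u_pot])
  have [measurable]: "Z \<in> sets borel" using Z by simp
  have good: "0 < u x" "ennreal (u x) \<le> ennreal A * pot F x" "pot F x \<le> ennreal (A * u x)" if "x \<in> \<Omega>" "x \<notin> Z" for x
    using Z(1) that by auto
  have AEZ: "AE x in lborel. x \<notin> Z" using Z by (intro AE_not_in null_setsI)
  \<comment> \<open>The value for which the bound of the contribution of \<open>E\<close>,
    multiplied by \<open>A\<close>, is exactly half of \<open>u x\<close>.\<close>
  define B where "B = 2 * A * H * A"
  have B: "B > 0" using A_pos H by (simp add: B_def)
  define K where "K = 2 * A * C * B powr q"
  have K: "K > 0" using A_pos B C by (simp add: K_def)
  show thesis
  proof (rule that)
    show "0 < K powr (1 / (q + 1))" using K by simp
    show "AE x in lborel. x \<in> \<Omega> \<longrightarrow> u x \<le> K powr (1 / (q + 1)) * (\<delta> x powr \<gamma> * ln (D / \<delta> x) powr (1 / (q + 1)))"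
      using AEZ
    proof eventually_elim
      fix x assume xZ: "x \<notin> Z"
      show "x \<in> \<Omega> \<longrightarrow> u x \<le> K powr (1 / (q + 1)) * (\<delta> x powr \<gamma> * ln (D / \<delta> x) powr (1 / (q + 1)))"
      proof
        assume x: "x \<in> \<Omega>"
        have dx: "0 < \<delta> x" using bdist_pos x by blast
        have ux: "0 < u x" using good x xZ by blast
        let ?l = "ln (D / \<delta> x)"
        have l: "1 \<le> ?l" using x by (rule ln_D_ge_1)
        define t where "t = u x / (B * \<delta> x powr \<gamma>)"
        have t: "t > 0" using ux B dx by (simp add: t_def)
        define E where "E = {y \<in> \<Omega>. y \<notin> Z \<and> u y \<le> t * \<delta> y powr \<gamma>}"
        have [measurable]: "E \<in> sets borel" unfolding E_def by measurable
        have small: "pot (\<lambda>y. F y * indicator E y) x \<le> ennreal (H * (A * t) * \<delta> x powr \<gamma>)"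
          unfolding H_def
        proof (rule weak_domination)
          show "E \<subseteq> \<Omega>" by (auto simp: E_def)
          show "0 \<le> A * t" using A_pos t by simp
          fix y assume y: "y \<in> E"
          then have y': "y \<in> \<Omega>" "y \<notin> Z" "u y \<le> t * \<delta> y powr \<gamma>" by (auto simp: E_def)
          have "pot (\<lambda>y. F y * indicator E y) y \<le> pot F y"
            by (intro pot_mono_AE AE_I2) (auto simp: indicator_def)
          also have "\<dots> \<le> ennreal (A * u y)" using good y' by blast
          also have "\<dots> \<le> ennreal (A * t * \<delta> y powr \<gamma>)"
            using y' A_pos by (intro ennreal_leI) (simp add: mult.assoc)
          finally show "pot (\<lambda>y. F y * indicator E y) y \<le> ennreal (A * t * \<delta> y powr \<gamma>)" .
        qed (use x in auto)
        have "pot F x \<le> pot (\<lambda>y. F y * indicator E y + ennreal (t powr - q) * ennreal (\<delta> y powr - (2 * s - \<gamma>))) x"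
        proof (rule pot_mono_AE, use AEZ in eventually_elim)
          fix y assume "y \<notin> Z"
          show "y \<in> \<Omega> \<longrightarrow> F y \<le> F y * indicator E y + ennreal (t powr - q) * ennreal (\<delta> y powr - (2 * s - \<gamma>))"
          proof
            assume y: "y \<in> \<Omega>"
            have dy: "0 < \<delta> y" using bdist_pos y by blast
            show "F y \<le> F y * indicator E y + ennreal (t powr - q) * ennreal (\<delta> y powr - (2 * s - \<gamma>))"
            proof (cases "y \<in> E")
              case False
              then have "t * \<delta> y powr \<gamma> \<le> u y" using y \<open>y \<notin> Z\<close> by (auto simp: E_def)
              then have "u y powr - q \<le> (t * \<delta> y powr \<gamma>) powr - q"
                using t dy q_pos by (intro powr_mono2') auto
              also have "\<dots> = t powr - q * \<delta> y powr - (2 * s - \<gamma>)"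
                using t dy crit by (simp add: powr_mult powr_powr)
              finally show ?thesis
                using False by (simp add: ennreal_mult'[symmetric] ennreal_leI)
            qed simp
          qed
        qed
        also have "\<dots> = pot (\<lambda>y. F y * indicator E y) x + ennreal (t powr - q) * pot (\<lambda>y. ennreal (\<delta> y powr - (2 * s - \<gamma>))) x"
          by (simp add: pot_add pot_cmult)
        also have "\<dots> \<le> ennreal (H * (A * t) * \<delta> x powr \<gamma>) + ennreal (t powr - q) * ennreal (C * (\<delta> x powr \<gamma> * ?l))"
          by (intro add_mono small mult_left_mono C x) simp
        also have "\<dots> = ennreal (H * (A * t) * \<delta> x powr \<gamma> + t powr - q * (C * (\<delta> x powr \<gamma> * ?l)))"
          using H A_pos t C l by (simp add: ennreal_mult' ennreal_plus)
        finally have P: "pot F x \<le> ennreal (H * (A * t) * \<delta> x powr \<gamma> + t powr - q * (C * (\<delta> x powr \<gamma> * ?l)))" .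
        have "ennreal (u x) \<le> ennreal A * ennreal (H * (A * t) * \<delta> x powr \<gamma> + t powr - q * (C * (\<delta> x powr \<gamma> * ?l)))"
          using good(2)[OF x xZ] P by (meson mult_left_mono order_trans zero_le)
        also have "\<dots> = ennreal (A * (H * (A * t) * \<delta> x powr \<gamma> + t powr - q * (C * (\<delta> x powr \<gamma> * ?l))))"
          using A_pos by (simp add: ennreal_mult')
        finally have "u x \<le> A * (H * (A * t) * \<delta> x powr \<gamma> + t powr - q * (C * (\<delta> x powr \<gamma> * ?l)))"
          using H A_pos t C l by (subst (asm) ennreal_le_iff) auto
        moreover have "A * (H * (A * t) * \<delta> x powr \<gamma>) = u x / 2"
          using A_pos H dx by (simp add: t_def B_def)
        ultimately have "u x \<le> 2 * A * C * t powr - q * (\<delta> x powr \<gamma> * ?l)"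
          by (simp add: algebra_simps)
        also have "t powr - q = u x powr - q * (B powr q * \<delta> x powr (\<gamma> * q))"
          using ux B dx by (simp add: t_def powr_divide powr_mult powr_powr powr_minus divide_simps)
        finally have "u x \<le> K * (\<delta> x powr \<gamma> * \<delta> x powr (\<gamma> * q) * ?l) * u x powr - q"
          by (simp add: K_def mult_ac)
        also have "\<delta> x powr \<gamma> * \<delta> x powr (\<gamma> * q) = \<delta> x powr (\<gamma> * (q + 1))"
          by (simp add: powr_add[symmetric] algebra_simps)
        finally have "u x powr (q + 1) \<le> K * (\<delta> x powr (\<gamma> * (q + 1)) * ?l)"
          using ux by (simp add: powr_add powr_minus divide_simps mult.commute)
        then have "(u x powr (q + 1)) powr (1 / (q + 1)) \<le> (K * (\<delta> x powr (\<gamma> * (q + 1)) * ?l)) powr (1 / (q + 1))"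
          using q_pos by (intro powr_mono2) auto
        also have "\<dots> = K powr (1 / (q + 1)) * (\<delta> x powr \<gamma> * ?l powr (1 / (q + 1)))"
          using K l q_pos by (simp add: powr_mult powr_powr)
        finally show "u x \<le> K powr (1 / (q + 1)) * (\<delta> x powr \<gamma> * ?l powr (1 / (q + 1)))"
          using ux q_pos by (simp add: powr_powr)
      qed
    qed
  qed
qed

section \<open>The regimes of the exponent\<close>

lemma lower_bound: "lesssim_on \<Omega> (\<lambda>x. \<delta> x powr \<gamma>) u"
proof -
  obtain c where "0 < c" "AE x in lborel. x \<in> \<Omega> \<longrightarrow> c * \<delta> x powr \<gamma> \<le> u x"
    by (rule hopf_lower_bound) (rule that)
  then show ?thesis by (rule lesssim_onI')
qed

text \<open>The lower bound by \<delta>^\<gamma> is inserted into the equation, where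
  (\<delta>^\<gamma>)^(-q) = \<delta>^(-b).\<close>

lemma upper_bound_of_potential:
  assumes b: "b = \<gamma> * q" and C: "0 < C" and B: "\<And>x. x \<in> \<Omega> \<Longrightarrow> 0 \<le> B x"
    "\<And>x. x \<in> \<Omega> \<Longrightarrow> pot (\<lambda>y. ennreal (\<delta> y powr - b)) x \<le> ennreal (C * B x)"
  shows "lesssim_on \<Omega> u B"
proof -
  obtain c where c: "0 < c" "AE x in lborel. x \<in> \<Omega> \<longrightarrow> c * \<delta> x powr \<gamma> \<le> u x"
    by (rule hopf_lower_bound) (rule that)
  show ?thesis
  proof (rule lesssim_onI)
    show "0 < A * c powr - q * C" using A_pos c C by simp
    have "AE x in lborel. x \<in> \<Omega> \<longrightarrow> u x \<le> A * c powr - q * (C * B x)"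
    proof (rule upper_from_lower[OF _ c(1)])
      show "AE y in lborel. y \<in> \<Omega> \<longrightarrow> 0 < \<delta> y powr \<gamma> \<and> c * \<delta> y powr \<gamma> \<le> u y"
        using c(2) by eventually_elim (use bdist_pos in fastforce)
    qed (use B C in \<open>auto simp: powr_powr b\<close>)
    then show "AE x in lborel. x \<in> \<Omega> \<longrightarrow> u x \<le> A * c powr - q * C * B x"
      by (simp add: mult.assoc)
  qed
qed

lemma subcritical:
  assumes "\<gamma> * q < 2 * s - \<gamma>" "s - 1 / 2 \<le> \<gamma>"
  shows "comparable_on \<Omega> u (\<lambda>x. \<delta> x powr \<gamma>)"
proof -
  \<comment> \<open>The first condition follows from the second, since 2s - \<gamma> \<le> 1 +
    \<gamma>.\<close>
  have "\<gamma> * q < 1 + \<gamma>" "\<gamma> * q < 2 * s - \<gamma>" using assms by auto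
  then obtain C where "C > 0" "\<And>x. x \<in> \<Omega> \<Longrightarrow> pot (\<lambda>y. ennreal (\<delta> y powr - (\<gamma> * q))) x \<le> ennreal (C * \<delta> x powr \<gamma>)"
    by (rule pot_subcritical) (rule that)
  then have "lesssim_on \<Omega> u (\<lambda>x. \<delta> x powr \<gamma>)"
    by (intro upper_bound_of_potential[OF refl]) auto
  then show ?thesis using lower_bound by (simp add: comparable_on_def)
qed

text \<open>The lower bound inserted into the equation carries no logarithm, so the potential shows
  its full power.\<close>

lemma critical_upper:
  assumes crit: "\<gamma> * q = 2 * s - \<gamma>" and \<gamma>: "s - 1 / 2 < \<gamma>"
  shows "lesssim_on \<Omega> u (\<lambda>x. \<delta> x powr \<gamma> * ln (D / \<delta> x))"
proof -
  obtain C where C: "C > 0" "\<And>x. x \<in> \<Omega> \<Longrightarrow>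
    pot (\<lambda>y. ennreal (\<delta> y powr - (2 * s - \<gamma>))) x \<le> ennreal (C * (\<delta> x powr \<gamma> * ln (D / \<delta> x)))"
    by (rule pot_critical[OF \<gamma>]) (rule that)
  show ?thesis
    using C crit ln_D_ge_1 by (intro upper_bound_of_potential[of "2 * s - \<gamma>" C]) fastforce+
qed

text \<open>The upper bound by \<open>?g\<close> makes u^(-q) at least a multiple of
  \<delta>^(-(2s-\<gamma>)) times the logarithm to the power -q/(q+1). Its potential gains one power
  of the logarithm, and 1 - q/(q+1) = 1/(q+1) reproduces \<open>?g\<close>.\<close>

lemma critical_sharp:
  assumes crit: "\<gamma> * q = 2 * s - \<gamma>" and \<gamma>: "s - 1 / 2 < \<gamma>"
  shows "comparable_on \<Omega> u (\<lambda>x. \<delta> x powr \<gamma> * ln (D / \<delta> x) powr (1 / (q + 1)))"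
proof -
  let ?g = "\<lambda>x. \<delta> x powr \<gamma> * ln (D / \<delta> x) powr (1 / (q + 1))"
  obtain C where C: "0 < C" "AE x in lborel. x \<in> \<Omega> \<longrightarrow> u x \<le> C * ?g x"
    by (rule critical_upper_bound[OF crit \<gamma>]) (rule that)
  define \<kappa> where "\<kappa> = q / (q + 1)"
  have \<kappa>: "0 \<le> \<kappa>" "1 - \<kappa> = 1 / (q + 1)" using q_pos by (auto simp: \<kappa>_def divide_simps)
  obtain c where c: "0 < c" "\<And>x. x \<in> \<Omega> \<Longrightarrow> ennreal (c * (\<delta> x powr \<gamma> * ln (D / \<delta> x) powr (1 - \<kappa>)))
    \<le> pot (\<lambda>y. ennreal (\<delta> y powr - (2 * s - \<gamma>) * ln (D / \<delta> y) powr - \<kappa>)) x"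
    by (rule pot_log_lower[OF \<kappa>(1)]) (rule that)
  have "AE x in lborel. x \<in> \<Omega> \<longrightarrow> C powr - q * (c * ?g x) \<le> A * u x"
  proof (rule lower_from_upper[OF _ C])
    fix x assume x: "x \<in> \<Omega>"
    have "pot (\<lambda>y. ennreal (\<delta> y powr - (2 * s - \<gamma>) * ln (D / \<delta> y) powr - \<kappa>)) x \<le> pot (\<lambda>y. ennreal (?g y powr - q)) x"
    proof (intro pot_mono_AE AE_I2 impI)
      fix y assume "y \<in> \<Omega>"
      then have "?g y powr - q = \<delta> y powr - (2 * s - \<gamma>) * ln (D / \<delta> y) powr - \<kappa>"
        using bdist_pos ln_D_ge_1 crit q_pos by (simp add: powr_mult powr_powr \<kappa>_def)
      then show "ennreal (\<delta> y powr - (2 * s - \<gamma>) * ln (D / \<delta> y) powr - \<kappa>) \<le> ennreal (?g y powr - q)"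
        by simp
    qed
    then show "ennreal (c * ?g x) \<le> pot (\<lambda>y. ennreal (?g y powr - q)) x"
      using c(2)[OF x] \<kappa>(2) by simp
  qed measurable
  then have "AE x in lborel. x \<in> \<Omega> \<longrightarrow> C powr - q * c / A * ?g x \<le> u x"
    by eventually_elim (use A_pos in \<open>simp add: divide_simps mult_ac\<close>)
  then have "lesssim_on \<Omega> ?g u"
    by (rule lesssim_onI'[rotated]) (use C c A_pos in simp)
  then show ?thesis
    using lesssim_onI[OF C] by (simp add: comparable_on_def)
qed

text \<open>The exponent a = 2s / (q + 1) solves a q = 2s - a, so the potential of (\<delta>^a)^(-q)
  is again of order \<delta>^a. The two hypotheses say that b = 2s - a lies between 2s - \<gamma>
  and 1 + \<gamma>, as \<open>pot_supercritical\<close> demands.\<close>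

lemma supercritical:
  assumes "2 * s / (q + 1) < \<gamma>" "2 * s - 1 - \<gamma> < 2 * s / (q + 1)"
  shows "comparable_on \<Omega> u (\<lambda>x. \<delta> x powr (2 * s / (q + 1)))"
proof -
  define a where "a = 2 * s / (q + 1)"
  have aq: "a * q = 2 * s - a" using q_pos by (simp add: a_def divide_simps) (simp add: algebra_simps)
  obtain c where c: "0 < c" "AE x in lborel. x \<in> \<Omega> \<longrightarrow> c * \<delta> x powr a \<le> u x"
    unfolding a_def by (rule harnack_lower_bound) (rule that[unfolded a_def])
  have "2 * s - a < 1 + \<gamma>" "2 * s - \<gamma> < 2 * s - a" using assms by (auto simp: a_def)
  then obtain C where C: "C > 0" "\<And>x. x \<in> \<Omega> \<Longrightarrow> pot (\<lambda>y. ennreal (\<delta> y powr - (2 * s - a))) x \<le> ennreal (C * \<delta> x powr (2 * s - (2 * s - a)))"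
    by (rule pot_supercritical) (rule that)
  have "AE x in lborel. x \<in> \<Omega> \<longrightarrow> u x \<le> A * c powr - q * (C * \<delta> x powr a)"
  proof (rule upper_from_lower[OF _ c(1)])
    show "AE y in lborel. y \<in> \<Omega> \<longrightarrow> 0 < \<delta> y powr a \<and> c * \<delta> y powr a \<le> u y"
      using c(2) by eventually_elim (use bdist_pos in fastforce)
  qed (use C in \<open>auto simp: powr_powr aq\<close>)
  then have "AE x in lborel. x \<in> \<Omega> \<longrightarrow> u x \<le> A * c powr - q * C * \<delta> x powr a"
    by (simp add: mult.assoc)
  then have "lesssim_on \<Omega> u (\<lambda>x. \<delta> x powr a)"
    by (rule lesssim_onI[rotated]) (use A_pos c C in simp)
  moreover have "lesssim_on \<Omega> (\<lambda>x. \<delta> x powr a) u"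
    using c by (rule lesssim_onI')
  ultimately show ?thesis by (simp add: comparable_on_def a_def)
qed

end

section \<open>The integral equation of a weak-dual solution\<close>

context green_kernel
begin

text \<open>Test functions \<delta>^\<gamma> 1_S and an exchange of integrals show that
  \<open>u\<close> and \<open>W\<close> have the same integral against \<delta>^\<gamma> over every
  Borel set \<open>S\<close>, hence agree almost everywhere on \<Omega>. The bounds of
  \<open>G\<close> by \<open>k\<close> then compare \<open>W\<close> with the potential.\<close>

lemma weak_dual_solution_is_potential:
  assumes G2: "G2_assm \<Omega> s \<gamma> G" and sol: "weak_dual_solution \<Omega> \<gamma> q G u" and q: "0 < q"
  obtains A where "singular_solution \<Omega> s \<gamma> u q A"
proof -
  define O2 where "O2 = {(x, y). x \<in> \<Omega> \<and> y \<in> \<Omega> \<and> x \<noteq> y}"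
  have Gmeas: "(\<lambda>(x, y). G x y) \<in> borel_measurable (restrict_space borel O2)"
    and Gpos: "\<And>x y. x \<in> \<Omega> \<Longrightarrow> y \<in> \<Omega> \<Longrightarrow> x \<noteq> y \<Longrightarrow> 0 < G x y \<and> G x y = G y x"
    using G2 unfolding G2_assm_def O2_def by blast+
  obtain C where C: "C > 0" "\<And>x y. x \<in> \<Omega> \<Longrightarrow> y \<in> \<Omega> \<Longrightarrow> x \<noteq> y \<Longrightarrow> G x y \<le> C * k x y \<and> k x y \<le> C * G x y"
    using G2 unfolding G2_assm_def by blast
  have O2: "O2 \<in> sets borel"
  proof -
    have "O2 = (\<Omega> \<times> \<Omega>) \<inter> - {p. fst p = snd p}" by (auto simp: O2_def)
    moreover have "open \<dots>"
      by (intro open_Int open_Times open_dom open_Compl closed_Collect_eq continuous_intros)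
    ultimately show ?thesis by simp
  qed
  \<comment> \<open>Extension by 0 off the pairs of distinct points of \<Omega>, which makes the
    kernel Borel on the whole product.\<close>
  define g where "g = (\<lambda>x y. indicator O2 (x, y) * G x y)"
  have "(\<lambda>p. indicator O2 p *\<^sub>R (case p of (x, y) \<Rightarrow> G x y)) \<in> borel_measurable borel"
    using Gmeas O2 by (subst borel_measurable_restrict_space_iff[symmetric]) auto
  also have "(\<lambda>p. indicator O2 p *\<^sub>R (case p of (x, y) \<Rightarrow> G x y)) = (\<lambda>(x, y). g x y)"
    by (auto simp: g_def fun_eq_iff)
  finally have gm [measurable]: "(\<lambda>(x, y). g x y) \<in> borel_measurable (borel \<Otimes>\<^sub>M borel)"
    by (simp add: borel_prod)
  have g_nonneg [simp]: "0 \<le> g x y" for x y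
    using Gpos by (auto simp: g_def O2_def indicator_def less_imp_le)
  have g_le: "g x y \<le> C * k x y" for x y
    using C by (auto simp: g_def O2_def indicator_def)
  have [measurable]: "u \<in> borel_measurable borel"
  proof -
    have "u \<in> borel_measurable (lborel_on \<Omega>)" "\<And>x. x \<notin> \<Omega> \<Longrightarrow> u x = 0"
      using sol by (auto simp: weak_dual_solution_def L1w0_def L1w_def)
    then have "(\<lambda>x. indicator \<Omega> x *\<^sub>R u x) \<in> borel_measurable lborel"
      by (subst borel_measurable_restrict_space_iff[symmetric]) auto
    moreover have "(\<lambda>x. indicator \<Omega> x *\<^sub>R u x) = u"
      using \<open>\<And>x. x \<notin> \<Omega> \<Longrightarrow> u x = 0\<close> by (auto simp: indicator_def fun_eq_iff)
    ultimately show ?thesis by simp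
  qed
  have u_pos: "AE x in lborel. x \<in> \<Omega> \<longrightarrow> 0 < u x"
    using sol by (simp add: weak_dual_solution_def AE_lborel_on)
  let ?F = "\<lambda>y. ennreal (u y powr - q)"
  \<comment> \<open>The potential of \<delta>^\<gamma> is at most a multiple of \<delta>^\<gamma>;
    with the weighted integrability of u^(-q) this makes the right side of the weak formulation
    finite.\<close>
  have "- \<gamma> < 1 + \<gamma>" "- \<gamma> < 2 * s - \<gamma>" using s_pos \<gamma>_pos by auto
  then obtain B where B: "B > 0" "\<And>x. x \<in> \<Omega> \<Longrightarrow> pot (\<lambda>y. ennreal (\<delta> y powr - (- \<gamma>))) x \<le> ennreal (B * \<delta> x powr \<gamma>)"
    by (rule pot_subcritical) (rule that)
  define W where "W = (\<lambda>y. \<integral>\<^sup>+x. ?F x * ennreal (g x y) \<partial>lborel)"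
  have [measurable]: "W \<in> borel_measurable borel"
  proof -
    have "(\<lambda>y. \<integral>\<^sup>+x. ?F x * ennreal (g x y) \<partial>lborel) \<in> borel_measurable lborel"
      by (rule lborel.borel_measurable_nn_integral) measurable
    then show ?thesis by (simp add: W_def)
  qed
  have key: "(\<integral>\<^sup>+x. (ennreal (u x * \<delta> x powr \<gamma>) * indicator \<Omega> x) * indicator S x \<partial>lborel)
      = (\<integral>\<^sup>+y. (ennreal (\<delta> y powr \<gamma>) * W y) * indicator S y \<partial>lborel)" if S [measurable]: "S \<in> sets borel" for S
  proof -
    define \<xi> where "\<xi> = (\<lambda>x. \<delta> x powr \<gamma> * indicator S x)"
    have [measurable]: "\<xi> \<in> borel_measurable borel" unfolding \<xi>_def by measurable
    have \<xi>0: "0 \<le> \<xi> x" "\<xi> x \<le> \<delta> x powr \<gamma>" for x by (auto simp: \<xi>_def indicator_def)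
    have "(\<lambda>x. indicator S x :: real) \<in> Linf \<Omega>"
      unfolding Linf_def by (auto intro!: borel_measurable_lborel_onI AE_I2 exI[of _ 1] simp: indicator_def)
    then have "\<xi> \<in> weighted_Linf \<Omega> \<gamma>" unfolding weighted_Linf_def \<xi>_def by blast
    then have eq: "(\<integral>x. u x * \<xi> x \<partial>lborel_on \<Omega>) = (\<integral>x. u x powr (- q) * green_op \<Omega> G \<xi> x \<partial>lborel_on \<Omega>)"
      using sol by (simp add: weak_dual_solution_def)
    define I where "I = (\<lambda>x. \<integral>\<^sup>+y. ennreal (g x y) * ennreal (\<xi> y) \<partial>lborel)"
    have [measurable]: "I \<in> borel_measurable borel"
    proof -
      have "(\<lambda>x. \<integral>\<^sup>+y. ennreal (g x y) * ennreal (\<xi> y) \<partial>lborel) \<in> borel_measurable lborel"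
        by (rule lborel.borel_measurable_nn_integral) measurable
      then show ?thesis by (simp add: I_def)
    qed
    have I_le: "I x \<le> ennreal (C * B * \<delta> x powr \<gamma>)" if x: "x \<in> \<Omega>" for x
    proof -
      have "I x \<le> (\<integral>\<^sup>+y. ennreal C * (ennreal (k x y) * ennreal (\<delta> y powr - (- \<gamma>)) * indicator \<Omega> y) \<partial>lborel)"
        unfolding I_def
      proof (rule nn_integral_mono)
        fix y
        have "g x y * \<xi> y \<le> C * k x y * \<delta> y powr \<gamma>"
          using g_le \<xi>0 C by (intro mult_mono) auto
        moreover have "y \<notin> \<Omega> \<Longrightarrow> g x y = 0" by (simp add: g_def O2_def)
        ultimately show "ennreal (g x y) * ennreal (\<xi> y) \<le> ennreal C * (ennreal (k x y) * ennreal (\<delta> y powr - (- \<gamma>)) * indicator \<Omega> y)"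
          using C \<xi>0 by (cases "y \<in> \<Omega>") (auto simp: ennreal_mult'[symmetric] mult.assoc intro!: ennreal_leI)
      qed
      also have "\<dots> = ennreal C * pot (\<lambda>y. ennreal (\<delta> y powr - (- \<gamma>))) x"
        unfolding pot_def by (rule nn_integral_cmult) measurable
      also have "\<dots> \<le> ennreal C * ennreal (B * \<delta> x powr \<gamma>)"
        by (intro mult_left_mono B x) simp
      finally show ?thesis using C by (simp add: ennreal_mult'[symmetric] mult.assoc)
    qed
    have green: "green_op \<Omega> G \<xi> x = enn2real (I x)" if x: "x \<in> \<Omega>" for x
    proof -
      have "green_op \<Omega> G \<xi> x = (\<integral>y. indicator \<Omega> y *\<^sub>R (G x y * \<xi> y) \<partial>lborel)"
        unfolding green_op_def by (rule integral_restrict_space) simp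
      \<comment> \<open>\<open>G x x\<close> is unconstrained, so the integrand is only almost everywhere equal to \<open>g x y * \<xi> y\<close>.\<close>
      also have "\<dots> = (\<integral>y. (g x y + indicator {x} y * G x x) * \<xi> y \<partial>lborel)"
        using x by (intro Bochner_Integration.integral_cong) (auto simp: g_def O2_def indicator_def \<xi>_def bdist_notin)
      also have "\<dots> = (\<integral>y. g x y * \<xi> y \<partial>lborel)"
      proof (rule integral_cong_AE)
        show "AE y in lborel. (g x y + indicator {x} y * G x x) * \<xi> y = g x y * \<xi> y"
          using AE_neq[of x] by eventually_elim auto
      qed measurable
      also have "\<dots> = enn2real (\<integral>\<^sup>+y. ennreal (g x y * \<xi> y) \<partial>lborel)"
        using \<xi>0 by (intro integral_eq_nn_integral) auto
      finally show ?thesis using \<xi>0 by (simp add: I_def ennreal_mult')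
    qed
    have enn_I: "ennreal (enn2real (I x)) = I x" if "x \<in> \<Omega>" for x
      using I_le[OF that] by (intro ennreal_enn2real) (auto simp: le_less_trans)
    let ?X = "\<integral>\<^sup>+x. ennreal (u x * \<xi> x) \<partial>lborel_on \<Omega>"
    let ?Y = "\<integral>\<^sup>+x. ennreal (u x powr (- q) * enn2real (I x)) \<partial>lborel_on \<Omega>"
    have "(\<integral>x. u x * \<xi> x \<partial>lborel_on \<Omega>) = enn2real ?X"
    proof (rule integral_eq_nn_integral)
      show "AE x in lborel_on \<Omega>. 0 \<le> u x * \<xi> x"
        unfolding AE_lborel_on using u_pos by eventually_elim (auto simp: \<xi>0)
    qed (rule borel_measurable_lborel_onI, measurable)
    moreover have "(\<integral>x. u x powr (- q) * green_op \<Omega> G \<xi> x \<partial>lborel_on \<Omega>) = (\<integral>x. u x powr (- q) * enn2real (I x) \<partial>lborel_on \<Omega>)"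
      by (intro Bochner_Integration.integral_cong) (auto simp: space_lborel_on green)
    moreover have "\<dots> = enn2real ?Y"
      by (intro integral_eq_nn_integral borel_measurable_lborel_onI) auto
    \<comment> \<open>As \<open>enn2real\<close> sends infinity to 0, this gives
      \<open>?X = ?Y\<close> only once both sides are shown to be finite.\<close>
    ultimately have XY: "enn2real ?X = enn2real ?Y" using eq by simp
    have "?X \<le> (\<integral>\<^sup>+x. ennreal (\<bar>u x\<bar> * \<delta> x powr \<gamma>) \<partial>lborel_on \<Omega>)"
      by (intro nn_integral_mono ennreal_leI) (use \<xi>0 in \<open>auto intro!: mult_mono\<close>)
    also have "\<dots> < \<infinity>"
      using sol by (auto simp: weak_dual_solution_def L1w0_def L1w_def integrable_iff_bounded)
    finally have X: "?X < top" by simp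
    have "?Y \<le> (\<integral>\<^sup>+x. ennreal (C * B) * ennreal (\<bar>u x powr - q\<bar> * \<delta> x powr \<gamma>) \<partial>lborel_on \<Omega>)"
    proof (rule nn_integral_mono)
      fix x assume "x \<in> space (lborel_on \<Omega>)"
      then have x: "x \<in> \<Omega>" by (simp add: space_lborel_on)
      have "enn2real (I x) \<le> C * B * \<delta> x powr \<gamma>"
        using I_le[OF x] B C by (intro enn2real_leI) auto
      then have "u x powr (- q) * enn2real (I x) \<le> u x powr (- q) * (C * B * \<delta> x powr \<gamma>)"
        by (intro mult_left_mono) auto
      also have "\<dots> = C * B * (\<bar>u x powr - q\<bar> * \<delta> x powr \<gamma>)" by simp
      finally show "ennreal (u x powr (- q) * enn2real (I x)) \<le> ennreal (C * B) * ennreal (\<bar>u x powr - q\<bar> * \<delta> x powr \<gamma>)"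
        using B C by (subst ennreal_mult'[symmetric]) (auto intro!: ennreal_leI)
    qed
    also have "\<dots> = ennreal (C * B) * (\<integral>\<^sup>+x. ennreal (\<bar>u x powr - q\<bar> * \<delta> x powr \<gamma>) \<partial>lborel_on \<Omega>)"
      by (intro nn_integral_cmult borel_measurable_lborel_onI) measurable
    also have "\<dots> < \<infinity>"
      using sol by (auto simp: weak_dual_solution_def L1w_def integrable_iff_bounded ennreal_mult_less_top)
    finally have Y: "?Y < top" by simp
    have "?X = ?Y" using XY X Y by (metis ennreal_enn2real)
    moreover have "?X = (\<integral>\<^sup>+x. (ennreal (u x * \<delta> x powr \<gamma>) * indicator \<Omega> x) * indicator S x \<partial>lborel)"
      unfolding nn_integral_lborel_on by (intro nn_integral_cong) (auto simp: \<xi>_def indicator_def)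
    moreover have "?Y = (\<integral>\<^sup>+x. \<integral>\<^sup>+y. ?F x * (ennreal (g x y) * ennreal (\<xi> y)) \<partial>lborel \<partial>lborel)"
      unfolding nn_integral_lborel_on
    proof (intro nn_integral_cong)
      fix x
      have "ennreal (u x powr (- q) * enn2real (I x)) * indicator \<Omega> x = ?F x * I x"
      proof (cases "x \<in> \<Omega>")
        case True
        then show ?thesis using enn_I[OF True] by (simp add: ennreal_mult')
      next
        case False
        then have "I x = 0" by (simp add: I_def g_def O2_def)
        then show ?thesis using False by simp
      qed
      then show "ennreal (u x powr (- q) * enn2real (I x)) * indicator \<Omega> x = (\<integral>\<^sup>+y. ?F x * (ennreal (g x y) * ennreal (\<xi> y)) \<partial>lborel)"
        by (simp add: I_def nn_integral_cmult)
    qed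
    \<comment> \<open>The integrand is nonnegative, so the exchange moves the kernel from the test
      function to u^(-q).\<close>
    moreover have "\<dots> = (\<integral>\<^sup>+y. \<integral>\<^sup>+x. ?F x * (ennreal (g x y) * ennreal (\<xi> y)) \<partial>lborel \<partial>lborel)"
      by (rule lborel_pair.Fubini'[symmetric]) measurable
    moreover have "\<dots> = (\<integral>\<^sup>+y. (ennreal (\<delta> y powr \<gamma>) * W y) * indicator S y \<partial>lborel)"
    proof (intro nn_integral_cong)
      fix y
      have "(\<integral>\<^sup>+x. ?F x * (ennreal (g x y) * ennreal (\<xi> y)) \<partial>lborel) = (\<integral>\<^sup>+x. (?F x * ennreal (g x y)) * ennreal (\<xi> y) \<partial>lborel)"
        by (simp add: mult.assoc)
      also have "\<dots> = W y * ennreal (\<xi> y)" unfolding W_def by (rule nn_integral_multc) measurable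
      also have "\<dots> = (ennreal (\<delta> y powr \<gamma>) * W y) * indicator S y"
        by (auto simp: \<xi>_def indicator_def mult.commute)
      finally show "(\<integral>\<^sup>+x. ?F x * (ennreal (g x y) * ennreal (\<xi> y)) \<partial>lborel) = (ennreal (\<delta> y powr \<gamma>) * W y) * indicator S y" .
    qed
    ultimately show ?thesis by simp
  qed
  \<comment> \<open>Two densities with the same integral over every Borel set agree almost
    everywhere.\<close>
  have "AE x in lborel. ennreal (u x * \<delta> x powr \<gamma>) * indicator \<Omega> x = ennreal (\<delta> x powr \<gamma>) * W x"
  proof (rule sigma_finite_measure.density_unique[OF sigma_finite_lborel])
    show "density lborel (\<lambda>x. ennreal (u x * \<delta> x powr \<gamma>) * indicator \<Omega> x) = density lborel (\<lambda>x. ennreal (\<delta> x powr \<gamma>) * W x)"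
      by (rule measure_eqI) (auto simp: emeasure_density key)
  qed measurable
  then have uW: "AE x in lborel. x \<in> \<Omega> \<longrightarrow> ennreal (u x) = W x"
  proof eventually_elim
    fix x assume eq: "ennreal (u x * \<delta> x powr \<gamma>) * indicator \<Omega> x = ennreal (\<delta> x powr \<gamma>) * W x"
    show "x \<in> \<Omega> \<longrightarrow> ennreal (u x) = W x"
    proof
      assume x: "x \<in> \<Omega>"
      have "ennreal (\<delta> x powr \<gamma>) * ennreal (u x) = ennreal (\<delta> x powr \<gamma>) * W x"
        using eq x by (simp add: ennreal_mult'' mult.commute)
      then show "ennreal (u x) = W x"
        using bdist_pos[OF x] by (simp add: ennreal_mult_cancel_left)
    qed
  qed
  have W_le: "W x \<le> ennreal C * pot ?F x" if x: "x \<in> \<Omega>" for x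
  proof -
    have "W x \<le> (\<integral>\<^sup>+y. ennreal C * (ennreal (k x y) * ?F y * indicator \<Omega> y) \<partial>lborel)"
      unfolding W_def
    proof (rule nn_integral_mono)
      fix y
      have "ennreal (g y x) \<le> ennreal C * ennreal (k x y)"
        using g_le[of y x] C by (simp add: ennreal_mult'[symmetric] ennreal_leI k_commute[of y x])
      then have "?F y * ennreal (g y x) \<le> ?F y * (ennreal C * ennreal (k x y))" by (rule mult_left_mono) simp
      moreover have "y \<notin> \<Omega> \<Longrightarrow> g y x = 0" by (simp add: g_def O2_def)
      ultimately show "?F y * ennreal (g y x) \<le> ennreal C * (ennreal (k x y) * ?F y * indicator \<Omega> y)"
        by (cases "y \<in> \<Omega>") (auto simp: mult_ac)
    qed
    also have "\<dots> = ennreal C * pot ?F x" unfolding pot_def by (rule nn_integral_cmult) measurable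
    finally show ?thesis .
  qed
  have W_ge: "pot ?F x \<le> ennreal C * W x" if x: "x \<in> \<Omega>" for x
  proof -
    have "pot ?F x \<le> (\<integral>\<^sup>+y. ennreal C * (?F y * ennreal (g y x)) \<partial>lborel)"
      unfolding pot_def
    proof (rule nn_integral_mono_AE, use AE_neq[of x] in eventually_elim)
      fix y assume "y \<noteq> x"
      show "ennreal (k x y) * ?F y * indicator \<Omega> y \<le> ennreal C * (?F y * ennreal (g y x))"
      proof (cases "y \<in> \<Omega>")
        case True
        then have "k x y \<le> C * g y x"
          using C(2)[OF True x \<open>y \<noteq> x\<close>] x \<open>y \<noteq> x\<close> by (simp add: g_def O2_def k_commute[of x y])
        then have "ennreal (k x y) \<le> ennreal C * ennreal (g y x)"
          using C by (simp add: ennreal_mult'[symmetric] ennreal_leI)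
        then have "ennreal (k x y) * ?F y \<le> ennreal C * ennreal (g y x) * ?F y" by (rule mult_right_mono) simp
        then show ?thesis using True by (simp add: mult_ac)
      qed simp
    qed
    also have "\<dots> = ennreal C * W x" unfolding W_def by (rule nn_integral_cmult) measurable
    finally show ?thesis .
  qed
  have "singular_solution \<Omega> s \<gamma> u q C"
  proof unfold_locales
    show "AE x in lborel. x \<in> \<Omega> \<longrightarrow> 0 < u x \<and> ennreal (u x) \<le> ennreal C * pot ?F x \<and> pot ?F x \<le> ennreal (C * u x)"
      using u_pos uW
    proof eventually_elim
      fix x assume "x \<in> \<Omega> \<longrightarrow> 0 < u x" "x \<in> \<Omega> \<longrightarrow> ennreal (u x) = W x"
      then show "x \<in> \<Omega> \<longrightarrow> 0 < u x \<and> ennreal (u x) \<le> ennreal C * pot ?F x \<and> pot ?F x \<le> ennreal (C * u x)"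
        using W_le[of x] W_ge[of x] C(1) by (auto simp: ennreal_mult')
    qed
  qed (use q C in auto)
  then show thesis by (rule that)
qed

end

theorem theorem3p4:
  fixes \<Omega> :: "'a::euclidean_space set"
    and s \<gamma> q :: real
    and L :: "('a \<Rightarrow> real) \<Rightarrow> 'a \<Rightarrow> real"
    and G :: "'a \<Rightarrow> 'a \<Rightarrow> real"
    and u :: "'a \<Rightarrow> real"
  assumes "2 \<le> DIM('a)" and "C2_bounded_domain \<Omega>"
    and "0 < s" "s \<le> 1" and "0 < \<gamma>" "\<gamma> \<le> 1" and "2 * s < real DIM('a)"
    and "L1_assm \<Omega> L" and "L2_assm \<Omega> L" and "L3_assm \<Omega> s L" and "L4_assm \<Omega> L"
    and "G1_assm \<Omega> L G" and "G2_assm \<Omega> s \<gamma> G" and "G3_assm \<Omega> G"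
    and "(q, \<gamma>) \<in> admissible s"
    and "weak_dual_solution \<Omega> \<gamma> q G u"
  shows
    "(0 < q \<and> q < q_crit s \<gamma> \<longrightarrow> comparable_on \<Omega> u (\<lambda>x. bdist \<Omega> x powr \<gamma>)) \<and>
     (q = q_crit s \<gamma> \<longrightarrow>
        (s \<le> \<gamma> \<longrightarrow>
           comparable_on \<Omega> u (\<lambda>x. bdist \<Omega> x powr \<gamma> * ln (d_dom \<Omega> / bdist \<Omega> x) powr (\<gamma> / (2 * s)))) \<and>
        (s - 1 / 2 < \<gamma> \<and> \<gamma> < s \<longrightarrow>
           lesssim_on \<Omega> (\<lambda>x. bdist \<Omega> x powr \<gamma>) u \<and>
           lesssim_on \<Omega> u (\<lambda>x. bdist \<Omega> x powr \<gamma> * ln (d_dom \<Omega> / bdist \<Omega> x)))) \<and>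
     (q_crit s \<gamma> < q \<and> ereal q < q_crit2 s \<gamma> \<longrightarrow>
        comparable_on \<Omega> u (\<lambda>x. bdist \<Omega> x powr (2 * s / (q + 1))))"
proof -
  have q: "0 < q" using assms(15) by (auto simp: admissible_def)
  interpret green_kernel \<Omega> s \<gamma>
    using assms(2,3,5,7) by unfold_locales
  obtain A where "singular_solution \<Omega> s \<gamma> u q A"
    by (rule weak_dual_solution_is_potential[OF assms(13,16) q])
  then interpret singular_solution \<Omega> s \<gamma> u q A .
  \<comment> \<open>Multiplication by \<open>\<gamma>\<close> turns the threshold 2s / \<gamma> - 1
    for \<open>q\<close> into the threshold 2s - \<gamma> for the exponent of the potential.\<close>
  have less: "q < q_crit s \<gamma> \<longleftrightarrow> \<gamma> * q < 2 * s - \<gamma>" and eq: "q = q_crit s \<gamma> \<longleftrightarrow> \<gamma> * q = 2 * s - \<gamma>"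
    using assms(5) by (auto simp: q_crit_def field_simps)
  show ?thesis
  proof (intro conjI impI)
    assume "0 < q \<and> q < q_crit s \<gamma>"
    then show "comparable_on \<Omega> u (\<lambda>x. bdist \<Omega> x powr \<gamma>)"
      using assms(15) less by (intro subcritical) (auto simp: admissible_def)
  next
    assume "q = q_crit s \<gamma>" "s \<le> \<gamma>"
    then have crit: "\<gamma> * q = 2 * s - \<gamma>" using eq by blast
    \<comment> \<open>The critical relation identifies the exponent 1 / (q + 1) of
      \<open>critical_sharp\<close> with \<gamma> / (2s).\<close>
    then have "\<gamma> * (q + 1) = 2 * s" by (simp add: algebra_simps)
    then have "1 / (q + 1) = \<gamma> / (2 * s)" using assms(3) q by (simp add: divide_simps)
    then show "comparable_on \<Omega> u (\<lambda>x. bdist \<Omega> x powr \<gamma> * ln (d_dom \<Omega> / bdist \<Omega> x) powr (\<gamma> / (2 * s)))"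
      using critical_sharp[OF crit] \<open>s \<le> \<gamma>\<close> by simp
  next
    show "lesssim_on \<Omega> (\<lambda>x. bdist \<Omega> x powr \<gamma>) u" by (rule lower_bound)
  next
    assume "q = q_crit s \<gamma>" "s - 1 / 2 < \<gamma> \<and> \<gamma> < s"
    then show "lesssim_on \<Omega> u (\<lambda>x. bdist \<Omega> x powr \<gamma> * ln (d_dom \<Omega> / bdist \<Omega> x))"
      using eq by (intro critical_upper) auto
  next
    assume super: "q_crit s \<gamma> < q \<and> ereal q < q_crit2 s \<gamma>"
    show "comparable_on \<Omega> u (\<lambda>x. bdist \<Omega> x powr (2 * s / (q + 1)))"
    proof (rule supercritical)
      show "2 * s / (q + 1) < \<gamma>"
        using super assms(5) q by (simp add: q_crit_def field_simps)
      \<comment> \<open>Clear by sign if 2s - 1 \<le> \<gamma>; otherwise it is a rearrangement of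
        the bound of \<open>q\<close> by the second critical exponent.\<close>
      show "2 * s - 1 - \<gamma> < 2 * s / (q + 1)"
      proof (cases "2 * s - 1 \<le> \<gamma>")
        case True
        moreover have "0 < 2 * s / (q + 1)" using assms(3) q by simp
        ultimately show ?thesis by linarith
      next
        case False
        then have "q < (\<gamma> + 1) / (2 * s - \<gamma> - 1)" using super by (simp add: q_crit2_def)
        then have "q * (2 * s - \<gamma> - 1) < \<gamma> + 1" using False by (simp add: less_divide_eq)
        then show ?thesis using q by (simp add: less_divide_eq algebra_simps)
      qed
    qed
  qed
qed

end
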